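(* Let $(\mu,\mathcal V,\mathcal C)$ be a Gårding–Wightman triple on $X=\mathbb Z_2^{\infty}$, with $\nu(x)=\dim V_x$, let $V=V(\mu,\nu,\mathcal C)=\int_X^{\oplus}V_x\,d\mu(x)$, and for $k\ge 1$ define operators on $V$ by $$J_kf(x)=-i(-1)^{x_1+\dots+x_{k-1}}\,c_k(x)\Big(\sqrt{\tfrac{d\mu(x+\delta^k)}{d\mu(x)}}\,f(x+\delta^k)\Big),$$ $$J_k'f(x)=(-1)^{x_1+\dots+x_{k}}\,c_k(x)\Big(\sqrt{\tfrac{d\mu(x+\delta^k)}{d\mu(x)}}\,f(x+\delta^k)\Big).$$ Then $J_1,J_1',J_2,J_2',\dots$ are mutually anticommuting orthogonal complex structures on $V$ (each is $\mathbb C$-linear, norm-preserving, has square $-I$, and any two distinct ones anticommute), and therefore define a complex spinor structure on $V$. Conversely, every complex spinor structure $(J_1,J_1',J_2,J_2',\dots)$ on a separable complex Hilbert space is unitarily equivalent to the one on $V(\mu,\nu,\mathcal C)$ for some Gårding–Wightman triple.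
   Context: $X=\mathbb Z_2^{\infty}$ is the compact abelian group of sequences $x=(x_1,x_2,\dots)$ of $0$'s and $1$'s with componentwise addition mod $2$, the product topology and its Borel $\sigma$-algebra. $\delta^k\in X$ has a $1$ in position $k$ and $0$ elsewhere; $\Delta\subset X$ is the subgroup of sequences with finitely many $1$'s. A Gårding–Wightman triple $(\mu,\mathcal V,\mathcal C)$ (also written $(\mu,\nu,\mathcal C)$) consists of: (1) a $\sigma$-finite positive Borel measure $\mu$ on $X$, quasi-invariant under $\Delta$, i.e. for each $\delta\in\Delta$ the measure $A\mapsto\mu(A+\delta)$ is equivalent to (mutually absolutely continuous with) $\mu$; (2) a family $\mathcal V=\{V_x\}_{x\in X}$ of nonzero separable complex Hilbert spaces with $V_{x+\delta}=V_x$ for $\delta\in\Delta$ and almost all $x$, and with $\nu(x)=\dim V_x$ measurable (up to unitary change, $V_x$ may be taken to be a fixed model Hilbert space of dimension $\nu(x)$); (3) a family $\mathcal C=\{c_k(x):k\ge 1,x\in X\}$ of unitary operators $c_k(x):V_x\to V_{x+\delta^k}=V_x$, depending measurably on $x$, with $c_k(x)^*=c_k(x+\delta^k)$ and $c_k(x)c_l(x+\delta^k)=c_l(x)c_k(x+\delta^l)$ for all $k,l$ and almost all $x$. $d\mu(x+\delta^k)/d\mu(x)$ is the Radon–Nikodym derivative of $A\mapsto\mu(A+\delta^k)$ with respect to $\mu$. A complex spinor structure on a complex Hilbert space is a sequence of norm-preserving $\mathbb C$-linear operators, each of square $-I$, which pairwise anticommute; the sequence here is enumerated as $J_1,J_1',J_2,J_2',\dots$.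 It is the same as a representation of the Clifford algebra $C(H)$, $H$ a real prehilbert space with orthonormal basis of that cardinality, with $\|h\cdot v\|=\|h\|\|v\|$ for $h\in H$. Unitary equivalence means a unitary map intertwining the corresponding operators. *)

theory Defs
  imports "HOL-Analysis.Analysis"
begin

section \<open>Complex Hilbert spaces and spinor structures\<close>

text \<open>
  Hilbert spaces are given by explicit carriers, because the direct integral below depends on
  a measure and so cannot be a type.  The inner product is linear in its first argument.
\<close>

record 'a cspace =
  pts :: "'a set"
  vadd :: "'a \<Rightarrow> 'a \<Rightarrow> 'a"
  vzero :: 'a
  smul :: "complex \<Rightarrow> 'a \<Rightarrow> 'a"
  ip :: "'a \<Rightarrow> 'a \<Rightarrow> complex"

definition vminus :: "'a cspace \<Rightarrow> 'a \<Rightarrow> 'a" where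
  "vminus H v = smul H (- 1) v"

definition vnorm :: "'a cspace \<Rightarrow> 'a \<Rightarrow> real" where
  "vnorm H v = sqrt (Re (ip H v v))"

definition vdist :: "'a cspace \<Rightarrow> 'a \<Rightarrow> 'a \<Rightarrow> real" where
  "vdist H v w = vnorm H (vadd H v (vminus H w))"

locale complex_inner_space =
  fixes H :: "'a cspace"
  assumes add_closed: "\<lbrakk>u \<in> pts H; v \<in> pts H\<rbrakk> \<Longrightarrow> vadd H u v \<in> pts H"
    and zero_closed: "vzero H \<in> pts H"
    and smul_closed: "v \<in> pts H \<Longrightarrow> smul H a v \<in> pts H"
    and add_assoc: "\<lbrakk>u \<in> pts H; v \<in> pts H; w \<in> pts H\<rbrakk> \<Longrightarrow>
          vadd H (vadd H u v) w = vadd H u (vadd H v w)"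
    and add_commute: "\<lbrakk>u \<in> pts H; v \<in> pts H\<rbrakk> \<Longrightarrow> vadd H u v = vadd H v u"
    and add_zero: "v \<in> pts H \<Longrightarrow> vadd H v (vzero H) = v"
    and add_minus: "v \<in> pts H \<Longrightarrow> vadd H v (vminus H v) = vzero H"
    and smul_add_right: "\<lbrakk>u \<in> pts H; v \<in> pts H\<rbrakk> \<Longrightarrow>
          smul H a (vadd H u v) = vadd H (smul H a u) (smul H a v)"
    and smul_add_left: "v \<in> pts H \<Longrightarrow> smul H (a + b) v = vadd H (smul H a v) (smul H b v)"
    and smul_smul: "v \<in> pts H \<Longrightarrow> smul H a (smul H b v) = smul H (a * b) v"
    and smul_one: "v \<in> pts H \<Longrightarrow> smul H 1 v = v"
    and ip_add: "\<lbrakk>u \<in> pts H; v \<in> pts H; w \<in> pts H\<rbrakk> \<Longrightarrow>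
          ip H (vadd H u v) w = ip H u w + ip H v w"
    and ip_smul: "\<lbrakk>u \<in> pts H; v \<in> pts H\<rbrakk> \<Longrightarrow> ip H (smul H a u) v = a * ip H u v"
    and ip_cnj: "\<lbrakk>u \<in> pts H; v \<in> pts H\<rbrakk> \<Longrightarrow> ip H v u = cnj (ip H u v)"
    and ip_nonneg: "v \<in> pts H \<Longrightarrow> 0 \<le> Re (ip H v v)"
    and ip_definite: "\<lbrakk>v \<in> pts H; ip H v v = 0\<rbrakk> \<Longrightarrow> v = vzero H"

locale complex_hilbert_space = complex_inner_space +
  assumes complete:
    "\<lbrakk>\<forall>n. s n \<in> pts H; \<forall>e>0. \<exists>N. \<forall>m\<ge>N. \<forall>n\<ge>N. vdist H (s m) (s n) < e\<rbrakk> \<Longrightarrow>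
      \<exists>v\<in>pts H. (\<lambda>n. vdist H (s n) v) \<longlonglongrightarrow> 0"

definition separable_cspace :: "'a cspace \<Rightarrow> bool" where
  "separable_cspace H \<longleftrightarrow>
     (\<exists>D. countable D \<and> D \<subseteq> pts H \<and> (\<forall>v\<in>pts H. \<forall>e>0. \<exists>d\<in>D. vdist H v d < e))"

definition clinear_map :: "'a cspace \<Rightarrow> 'b cspace \<Rightarrow> ('a \<Rightarrow> 'b) \<Rightarrow> bool" where
  "clinear_map H K T \<longleftrightarrow>
     (\<forall>v\<in>pts H. T v \<in> pts K) \<and>
     (\<forall>u\<in>pts H. \<forall>v\<in>pts H. T (vadd H u v) = vadd K (T u) (T v)) \<and>
     (\<forall>a. \<forall>v\<in>pts H. T (smul H a v) = smul K a (T v))"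

definition unitary_map :: "'a cspace \<Rightarrow> 'b cspace \<Rightarrow> ('a \<Rightarrow> 'b) \<Rightarrow> bool" where
  "unitary_map H K U \<longleftrightarrow>
     clinear_map H K U \<and> bij_betw U (pts H) (pts K) \<and>
     (\<forall>u\<in>pts H. \<forall>v\<in>pts H. ip K (U u) (U v) = ip H u v)"

definition is_adjoint :: "'a cspace \<Rightarrow> 'b cspace \<Rightarrow> ('a \<Rightarrow> 'b) \<Rightarrow> ('b \<Rightarrow> 'a) \<Rightarrow> bool" where
  "is_adjoint H K T T' \<longleftrightarrow> (\<forall>u\<in>pts H. \<forall>v\<in>pts K. ip K (T u) v = ip H u (T' v))"

definition orthogonal_complex_structure :: "'a cspace \<Rightarrow> ('a \<Rightarrow> 'a) \<Rightarrow> bool" where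
  "orthogonal_complex_structure H J \<longleftrightarrow>
     clinear_map H H J \<and>
     (\<forall>v\<in>pts H. vnorm H (J v) = vnorm H v) \<and>
     (\<forall>v\<in>pts H. J (J v) = vminus H v)"

definition anticommute :: "'a cspace \<Rightarrow> ('a \<Rightarrow> 'a) \<Rightarrow> ('a \<Rightarrow> 'a) \<Rightarrow> bool" where
  "anticommute H A B \<longleftrightarrow> (\<forall>v\<in>pts H. A (B v) = vminus H (B (A v)))"

definition complex_spinor_structure :: "'a cspace \<Rightarrow> (nat \<Rightarrow> 'a \<Rightarrow> 'a) \<Rightarrow> bool" where
  "complex_spinor_structure H S \<longleftrightarrow>
     complex_hilbert_space H \<and>
     (\<forall>n. orthogonal_complex_structure H (S n)) \<and>
     (\<forall>m n. m \<noteq> n \<longrightarrow> anticommute H (S m) (S n))"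

definition unitarily_equivalent ::
    "'a cspace \<Rightarrow> (nat \<Rightarrow> 'a \<Rightarrow> 'a) \<Rightarrow> 'b cspace \<Rightarrow> (nat \<Rightarrow> 'b \<Rightarrow> 'b) \<Rightarrow> bool" where
  "unitarily_equivalent H S K T \<longleftrightarrow>
     (\<exists>U. unitary_map H K U \<and> (\<forall>n. \<forall>v\<in>pts H. U (S n v) = T n (U v)))"

text \<open>The enumeration \<open>J 0, J' 0, J 1, J' 1, \<dots>\<close>.\<close>

definition interleave :: "(nat \<Rightarrow> 'c) \<Rightarrow> (nat \<Rightarrow> 'c) \<Rightarrow> nat \<Rightarrow> 'c" where
  "interleave J J' n = (if even n then J (n div 2) else J' (n div 2))"


section \<open>The group of binary sequences\<close>

text \<open>
  A point is a function \<open>nat \<Rightarrow> bool\<close> with \<open>True\<close> for 1; the type carries the product topology.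
  Positions start at 0, so \<open>x j\<close> is the mathematical \<open>x\<^sub>j\<^sub>+\<^sub>1\<close>, and likewise for the
  indices of \<open>delta\<close> and of the operators \<open>c\<close>, \<open>J\<close>, \<open>J'\<close>.
\<close>

type_synonym bseq = "nat \<Rightarrow> bool"

definition bplus :: "bseq \<Rightarrow> bseq \<Rightarrow> bseq" (infixl "\<oplus>" 65) where
  "x \<oplus> y = (\<lambda>j. x j \<noteq> y j)"

definition delta :: "nat \<Rightarrow> bseq" where
  "delta k = (\<lambda>j. j = k)"

definition Delta :: "bseq set" where
  "Delta = {d. finite {j. d j}}"

definition translate :: "bseq measure \<Rightarrow> bseq \<Rightarrow> bseq measure" where
  "translate \<mu> d = distr \<mu> borel (\<lambda>x. x \<oplus> d)"

lemma measurable_bplus: "(\<lambda>x. x \<oplus> d) \<in> borel_measurable borel"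
proof (rule borel_measurable_continuous_onI)
  have "continuous_on UNIV (\<lambda>x::bseq. (x \<oplus> d) j)" for j
  proof -
    have "continuous_on UNIV (\<lambda>x::bseq. (\<lambda>b. b \<noteq> d j) (x j))"
      by (rule continuous_on_compose2[where t = UNIV])
        (auto intro!: continuous_on_product_coordinates continuous_on_discrete)
    then show ?thesis by (simp add: bplus_def)
  qed
  then show "continuous_on UNIV (\<lambda>x::bseq. x \<oplus> d)"
    by (rule continuous_on_coordinatewise_then_product)
qed

text \<open>Since every element is its own inverse, this is the measure \<open>A \<mapsto> \<mu> (A + d)\<close>.\<close>

lemma emeasure_translate:
  assumes "sets \<mu> = sets borel" and "A \<in> sets borel"
  shows "emeasure (translate \<mu> d) A = emeasure \<mu> ((\<lambda>x. x \<oplus> d) ` A)"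
proof -
  have inv: "(x \<oplus> d) \<oplus> d = x" for x by (auto simp: bplus_def)
  have "(\<lambda>x. x \<oplus> d) -` A = (\<lambda>x. x \<oplus> d) ` A"
  proof (intro set_eqI iffI)
    fix x assume "x \<in> (\<lambda>x. x \<oplus> d) -` A"
    then have "x = (x \<oplus> d) \<oplus> d" "x \<oplus> d \<in> A" by (simp_all add: inv)
    then show "x \<in> (\<lambda>x. x \<oplus> d) ` A" by blast
  next
    fix x assume "x \<in> (\<lambda>x. x \<oplus> d) ` A"
    then show "x \<in> (\<lambda>x. x \<oplus> d) -` A" by (auto simp: inv)
  qed
  moreover have "space \<mu> = UNIV" using sets_eq_imp_space_eq[OF assms(1)] by simp
  moreover have "(\<lambda>x. x \<oplus> d) \<in> measurable \<mu> borel"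
    using measurable_bplus measurable_cong_sets[OF assms(1) refl] by blast
  ultimately show ?thesis using assms(2) by (simp add: translate_def emeasure_distr)
qed

definition quasi_invariant :: "bseq measure \<Rightarrow> bool" where
  "quasi_invariant \<mu> \<longleftrightarrow>
     (\<forall>d\<in>Delta. absolutely_continuous \<mu> (translate \<mu> d) \<and>
                absolutely_continuous (translate \<mu> d) \<mu>)"


section \<open>Fibres and direct integrals\<close>

text \<open>
  The model Hilbert space of dimension \<open>d \<in> {0, 1, 2, \<dots>, \<infinity>}\<close>: the square summable sequences
  supported on the first \<open>d\<close> coordinates.
\<close>

definition model_space :: "enat \<Rightarrow> (nat \<Rightarrow> complex) cspace" where
  "model_space d =
     \<lparr>pts = {v. (\<forall>n. d \<le> enat n \<longrightarrow> v n = 0) \<and> summable (\<lambda>n. (cmod (v n))\<^sup>2)},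
      vadd = (\<lambda>v w n. v n + w n),
      vzero = (\<lambda>n. 0),
      smul = (\<lambda>a v n. a * v n),
      ip = (\<lambda>v w. \<Sum>n. v n * cnj (w n))\<rparr>"

abbreviation fibre :: "(bseq \<Rightarrow> enat) \<Rightarrow> bseq \<Rightarrow> (nat \<Rightarrow> complex) cspace" where
  "fibre \<nu> x \<equiv> model_space (\<nu> x)"

type_synonym bfield = "bseq \<Rightarrow> nat \<Rightarrow> complex"

definition measurable_section :: "bseq measure \<Rightarrow> (bseq \<Rightarrow> enat) \<Rightarrow> bfield \<Rightarrow> bool" where
  "measurable_section \<mu> \<nu> f \<longleftrightarrow>
     (\<forall>x. f x \<in> pts (fibre \<nu> x)) \<and> (\<forall>n. (\<lambda>x. f x n) \<in> borel_measurable \<mu>)"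

definition L2_sections :: "bseq measure \<Rightarrow> (bseq \<Rightarrow> enat) \<Rightarrow> bfield set" where
  "L2_sections \<mu> \<nu> =
     {f. measurable_section \<mu> \<nu> f \<and> integrable \<mu> (\<lambda>x. (vnorm (fibre \<nu> x) (f x))\<^sup>2)}"

text \<open>
  Here \<open>h\<close> itself need not be a section; it only has to agree almost everywhere with one for
  the class to be nonempty.
\<close>

definition ae_class :: "bseq measure \<Rightarrow> (bseq \<Rightarrow> enat) \<Rightarrow> bfield \<Rightarrow> bfield set" where
  "ae_class \<mu> \<nu> h = {g \<in> L2_sections \<mu> \<nu>. AE x in \<mu>. g x = h x}"

definition rep :: "bfield set \<Rightarrow> bfield" where
  "rep F = (SOME f. f \<in> F)"

definition direct_integral :: "bseq measure \<Rightarrow> (bseq \<Rightarrow> enat) \<Rightarrow> bfield set cspace" where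
  "direct_integral \<mu> \<nu> =
     \<lparr>pts = ae_class \<mu> \<nu> ` L2_sections \<mu> \<nu>,
      vadd = (\<lambda>F G. \<Union>f\<in>F. \<Union>g\<in>G. ae_class \<mu> \<nu> (\<lambda>x. vadd (fibre \<nu> x) (f x) (g x))),
      vzero = ae_class \<mu> \<nu> (\<lambda>x. vzero (fibre \<nu> x)),
      smul = (\<lambda>a F. \<Union>f\<in>F. ae_class \<mu> \<nu> (\<lambda>x. smul (fibre \<nu> x) a (f x))),
      ip = (\<lambda>F G. \<integral>x. ip (fibre \<nu> x) (rep F x) (rep G x) \<partial>\<mu>)\<rparr>"


section \<open>Garding--Wightman triples\<close>

text \<open>
  The fibres are the model spaces of dimension \<open>\<nu> x\<close>.  The operators \<open>c k x\<close> are unitary on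
  the fibre at every \<open>x\<close>, while the fibres at \<open>x\<close> and \<open>x \<oplus> delta k\<close> need only coincide almost
  everywhere.  Values of \<open>c k x\<close> outside the fibre are irrelevant.
\<close>

type_synonym opfield = "nat \<Rightarrow> bseq \<Rightarrow> (nat \<Rightarrow> complex) \<Rightarrow> (nat \<Rightarrow> complex)"

locale gw_triple =
  fixes \<mu> :: "bseq measure" and \<nu> :: "bseq \<Rightarrow> enat" and c :: opfield
  assumes borel_sets: "sets \<mu> = sets borel"
    and sigma_finite: "sigma_finite_measure \<mu>"
    and quasi_inv: "quasi_invariant \<mu>"
    and nu_nonzero: "\<nu> x \<noteq> 0"
    and nu_measurable: "\<nu> \<in> measurable \<mu> (count_space UNIV)"
    and nu_invariant: "d \<in> Delta \<Longrightarrow> AE x in \<mu>. fibre \<nu> (x \<oplus> d) = fibre \<nu> x"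
    and c_unitary: "unitary_map (fibre \<nu> x) (fibre \<nu> x) (c k x)"
    and c_measurable:
      "measurable_section \<mu> \<nu> f \<Longrightarrow> measurable_section \<mu> \<nu> (\<lambda>x. c k x (f x))"
    and c_adjoint:
      "AE x in \<mu>. is_adjoint (fibre \<nu> x) (fibre \<nu> (x \<oplus> delta k)) (c k x) (c k (x \<oplus> delta k))"
    and c_commute:
      "AE x in \<mu>. \<forall>v\<in>pts (fibre \<nu> x).
         c k x (c l (x \<oplus> delta k) v) = c l x (c k (x \<oplus> delta l) v)"

definition translation_factor :: "bseq measure \<Rightarrow> nat \<Rightarrow> bseq \<Rightarrow> complex" where
  "translation_factor \<mu> k x =
     complex_of_real (sqrt (enn2real (RN_deriv \<mu> (translate \<mu> (delta k)) x)))"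

text \<open>
  In one-based numbering the sign exponents below are \<open>x\<^sub>1 + \<dots> + x\<^sub>k\<^sub>-\<^sub>1\<close> and
  \<open>x\<^sub>1 + \<dots> + x\<^sub>k\<close>.  The operators act on classes: the union over representatives is a
  single class precisely when the formula is well defined modulo null sets and square integrable.
\<close>

definition gw_J ::
    "bseq measure \<Rightarrow> (bseq \<Rightarrow> enat) \<Rightarrow> opfield \<Rightarrow> nat \<Rightarrow> bfield set \<Rightarrow> bfield set" where
  "gw_J \<mu> \<nu> c k F =
     (\<Union>f\<in>F. ae_class \<mu> \<nu> (\<lambda>x. smul (fibre \<nu> x)
        (- \<i> * (- 1) ^ (\<Sum>j<k. of_bool (x j)))
        (c k x (smul (fibre \<nu> x) (translation_factor \<mu> k x) (f (x \<oplus> delta k))))))"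

definition gw_J' ::
    "bseq measure \<Rightarrow> (bseq \<Rightarrow> enat) \<Rightarrow> opfield \<Rightarrow> nat \<Rightarrow> bfield set \<Rightarrow> bfield set" where
  "gw_J' \<mu> \<nu> c k F =
     (\<Union>f\<in>F. ae_class \<mu> \<nu> (\<lambda>x. smul (fibre \<nu> x)
        ((- 1) ^ (\<Sum>j\<le>k. of_bool (x j)))
        (c k x (smul (fibre \<nu> x) (translation_factor \<mu> k x) (f (x \<oplus> delta k))))))"

end

theory Submission
  imports Defs
begin

text \<open>
  The operators \<open>A k = - \<i> J k J' k\<close> are commuting self-adjoint involutions, acting on a direct
  integral as multiplication by the sign of the \<open>k\<close>-th coordinate, and the operators
  \<open>U k = \<i> A 0 \<dots> A (k - 1) J k\<close> are commuting unitary involutions that anticommute with \<open>A k\<close> and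
  commute with the other \<open>A l\<close>; both \<open>J k\<close> and \<open>J' k\<close> are recovered from them. That a triple yields
  a spinor structure is then the cocycle identity for the square roots of the Radon--Nikodym
  derivatives together with the identities for \<open>c\<close>.

  Conversely, the spectral projections of the \<open>A k\<close> are indexed by cylinder sets. A maximal family
  of unit vectors \<open>w m\<close> generating mutually orthogonal cyclic subspaces is countable, the numbers
  \<open>\<parallel>E(C) w m\<parallel>\<^sup>2\<close> define measures, and with \<open>\<mu>\<close> the (rescaled) sum of these measures, a fibre with
  one basis vector for every \<open>m\<close> whose density is positive turns the Hilbert space into a direct
  integral. There \<open>U k\<close> permutes the cylinder sets, so it maps the field of basis vectors to a
  field that is, up to the square root of a density, pointwise orthonormal. This density makes
  \<open>\<mu>\<close> quasi-invariant, and the pointwise isometries are the operators \<open>c k x\<close>.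
\<close>

section \<open>Isometric extension\<close>

text \<open>The products \<open>A 0 ... A (k - 1)\<close> inside \<open>U k\<close> form a
  Jordan-Wigner transformation: they trade anticommutation for commutation. The projections in use
  are finite products of \<open>(1 + A j) / 2\<close> and \<open>(1 - A j) / 2\<close>, so no
  projection-valued measure on all Borel sets is built; scalar measures are extended from cylinders,
  and equality almost everywhere is tested on cylinders.

  The obstacle is the passage from operators on classes to statements at single points. Only
  countably many basis fields are compared, so the exceptional null sets can be united, and a Gram
  identity at a point then yields an isometry between fibres. At first these fibres may differ;
  invariance of the dimension is deduced from the isometry. As it is chosen point by point, its
  measurability comes from its matrix entries, which are coordinates of \<open>U k\<close> applied
  to basis fields.

  Multiplicities are never sorted: at each point the generators with positive density are numbered
  in the order of their indices, which avoids a chain of absolutely continuous measures. Scaling the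
  generators by powers of 1/2 keeps the sum of their measures finite.\<close>

context complex_inner_space
begin

lemma minus_closed [simp]: "v \<in> pts H \<Longrightarrow> vminus H v \<in> pts H"
  by (simp add: vminus_def smul_closed)

lemmas closed_rules [simp] = add_closed zero_closed smul_closed

lemma ip_add_right:
  "\<lbrakk>u \<in> pts H; v \<in> pts H; w \<in> pts H\<rbrakk> \<Longrightarrow> ip H w (vadd H u v) = ip H w u + ip H w v"
  by (metis add_closed complex_cnj_add ip_add ip_cnj)

lemma ip_smul_right:
  "\<lbrakk>u \<in> pts H; v \<in> pts H\<rbrakk> \<Longrightarrow> ip H v (smul H a u) = cnj a * ip H v u"
  by (metis complex_cnj_mult ip_cnj ip_smul smul_closed)

lemma ip_minus: "\<lbrakk>u \<in> pts H; v \<in> pts H\<rbrakk> \<Longrightarrow> ip H (vminus H u) v = - ip H u v"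
  by (simp add: vminus_def ip_smul)

lemma ip_minus_right: "\<lbrakk>u \<in> pts H; v \<in> pts H\<rbrakk> \<Longrightarrow> ip H u (vminus H v) = - ip H u v"
  by (simp add: vminus_def ip_smul_right)

lemma ip_zero: "v \<in> pts H \<Longrightarrow> ip H (vzero H) v = 0"
  using ip_add[of "vzero H" "vzero H" v] add_zero[of "vzero H"] by simp

lemma ip_zero_right: "v \<in> pts H \<Longrightarrow> ip H v (vzero H) = 0"
  using ip_add_right[of "vzero H" "vzero H" v] add_zero[of "vzero H"] by simp

lemmas ip_rules [simp] = ip_add ip_smul ip_add_right ip_smul_right ip_minus ip_minus_right
  ip_zero ip_zero_right

text \<open>Vector identities are proved by pairing with a test vector, so that the simplifier
  computes in the complex numbers instead of with the axioms of the carrier.\<close>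

lemma eq_by_ip:
  assumes "u \<in> pts H" "v \<in> pts H" "\<And>w. w \<in> pts H \<Longrightarrow> ip H u w = ip H v w"
  shows "u = v"
proof -
  let ?d = "vadd H u (vminus H v)"
  have "ip H ?d ?d = 0" using assms by simp
  then have d: "?d = vzero H" using assms by (intro ip_definite) auto
  have c: "vadd H (vminus H v) v = vzero H"
    using add_minus[OF assms(2)] add_commute[OF minus_closed[OF assms(2)] assms(2)] by (rule trans[rotated])
  have "u = vadd H u (vadd H (vminus H v) v)"
    unfolding c using add_zero[OF assms(1)] by (rule sym)
  also have "\<dots> = vadd H ?d v"
    by (rule add_assoc[symmetric]) (use assms in auto)
  also have "\<dots> = vadd H v (vzero H)"
    unfolding d by (rule add_commute) (use assms in auto)
  also have "\<dots> = v" by (rule add_zero[OF assms(2)])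
  finally show ?thesis .
qed

lemma vnorm_nonneg [simp]: "v \<in> pts H \<Longrightarrow> 0 \<le> vnorm H v"
  by (simp add: vnorm_def ip_nonneg)

lemma vnorm_sq: "v \<in> pts H \<Longrightarrow> (vnorm H v)\<^sup>2 = Re (ip H v v)"
  by (simp add: vnorm_def ip_nonneg)

lemma ip_self: "v \<in> pts H \<Longrightarrow> ip H v v = complex_of_real ((vnorm H v)\<^sup>2)"
proof -
  assume v: "v \<in> pts H"
  have "Im (ip H v v) = Im (cnj (ip H v v))" using ip_cnj[OF v v] by (rule arg_cong)
  then show ?thesis using v by (simp add: complex_eq_iff vnorm_sq)
qed

lemma vnorm_eq_0: "v \<in> pts H \<Longrightarrow> vnorm H v = 0 \<longleftrightarrow> v = vzero H"
proof
  assume v: "v \<in> pts H" and "vnorm H v = 0"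
  then show "v = vzero H" using ip_self[OF v] by (intro ip_definite) auto
next
  assume "v = vzero H"
  then show "vnorm H v = 0" by (simp add: vnorm_def)
qed

lemma vnorm_smul: "v \<in> pts H \<Longrightarrow> vnorm H (smul H a v) = cmod a * vnorm H v"
proof (rule power2_eq_imp_eq)
  assume v: "v \<in> pts H"
  have "ip H (smul H a v) (smul H a v) = (a * cnj a) * ip H v v"
    using v by simp
  also have "\<dots> = complex_of_real ((cmod a * vnorm H v)\<^sup>2)"
    unfolding complex_norm_square[symmetric] ip_self[OF v] by (simp add: power_mult_distrib)
  finally show "(vnorm H (smul H a v))\<^sup>2 = (cmod a * vnorm H v)\<^sup>2"
    using v by (simp only: vnorm_sq closed_rules Re_complex_of_real)
qed auto

lemma vdist_sq:
  "\<lbrakk>u \<in> pts H; v \<in> pts H\<rbrakk> \<Longrightarrow>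
    (vdist H u v)\<^sup>2 = (vnorm H u)\<^sup>2 + (vnorm H v)\<^sup>2 - 2 * Re (ip H u v)"
  using ip_cnj[of u v] by (simp add: vdist_def vnorm_sq)

lemma vdist_nonneg [simp]: "\<lbrakk>u \<in> pts H; v \<in> pts H\<rbrakk> \<Longrightarrow> 0 \<le> vdist H u v"
  by (simp add: vdist_def)

lemma vdist_commute: "\<lbrakk>u \<in> pts H; v \<in> pts H\<rbrakk> \<Longrightarrow> vdist H u v = vdist H v u"
  using ip_cnj[of u v] by (simp add: power2_eq_iff_nonneg[symmetric] vdist_sq)

lemma cauchy_schwarz:
  assumes u: "u \<in> pts H" and v: "v \<in> pts H"
  shows "cmod (ip H u v) \<le> vnorm H u * vnorm H v"
proof (cases "vnorm H v = 0")
  case True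
  then show ?thesis using assms by (simp add: vnorm_eq_0)
next
  case False
  let ?a = "ip H u v" and ?b = "complex_of_real ((vnorm H v)\<^sup>2)"
  \<comment> \<open>\<open>?w\<close> is the part of \<open>u\<close> orthogonal to
    \<open>v\<close>, multiplied by the squared norm of \<open>v\<close> to avoid a
    division.\<close>
  let ?w = "vadd H (smul H ?b u) (vminus H (smul H ?a v))"
  have "0 \<le> Re (ip H ?w ?w)" using assms by (intro ip_nonneg) auto
  also have "ip H ?w ?w = ?b * (?b * ip H u u - ?a * cnj ?a)"
    using assms ip_cnj[OF u v] ip_self[OF v] by (simp add: algebra_simps)
  also have "\<dots> = complex_of_real ((vnorm H v)\<^sup>2 * ((vnorm H v)\<^sup>2 * (vnorm H u)\<^sup>2 - (cmod ?a)\<^sup>2))"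
    unfolding complex_norm_square[symmetric] ip_self[OF u] by simp
  finally have "0 \<le> (vnorm H v)\<^sup>2 * ((vnorm H v)\<^sup>2 * (vnorm H u)\<^sup>2 - (cmod ?a)\<^sup>2)" by simp
  then have "(cmod ?a)\<^sup>2 \<le> (vnorm H u * vnorm H v)\<^sup>2"
    using False by (simp add: zero_le_mult_iff power_mult_distrib mult.commute)
  then show ?thesis by (rule power2_le_imp_le) (use assms in auto)
qed

lemma vnorm_triangle:
  assumes u: "u \<in> pts H" and v: "v \<in> pts H"
  shows "vnorm H (vadd H u v) \<le> vnorm H u + vnorm H v"
proof (rule power2_le_imp_le)
  have "Re (ip H u v) \<le> vnorm H u * vnorm H v"
    using cauchy_schwarz[OF assms] complex_Re_le_cmod[of "ip H u v"] by linarith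
  then show "(vnorm H (vadd H u v))\<^sup>2 \<le> (vnorm H u + vnorm H v)\<^sup>2"
    using assms ip_cnj[OF u v] by (simp add: vnorm_sq power2_sum)
qed (use assms in auto)

lemma vdist_triangle:
  assumes "u \<in> pts H" "v \<in> pts H" "w \<in> pts H"
  shows "vdist H u w \<le> vdist H u v + vdist H v w"
proof -
  have "vadd H u (vminus H w) = vadd H (vadd H u (vminus H v)) (vadd H v (vminus H w))"
    by (rule eq_by_ip) (use assms in auto)
  then show ?thesis using assms by (simp add: vdist_def vnorm_triangle)
qed

lemma vdist_self [simp]: "v \<in> pts H \<Longrightarrow> vdist H v v = 0"
  using vdist_sq[of v v] by (simp add: vnorm_sq)

lemma eq_by_vdist: "\<lbrakk>u \<in> pts H; v \<in> pts H; vdist H u v = 0\<rbrakk> \<Longrightarrow> u = v"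
proof -
  assume a: "u \<in> pts H" "v \<in> pts H" "vdist H u v = 0"
  then have z: "vadd H u (vminus H v) = vzero H" by (simp add: vdist_def vnorm_eq_0)
  show ?thesis
  proof (rule eq_by_ip)
    fix w assume "w \<in> pts H"
    then have "ip H (vadd H u (vminus H v)) w = 0" using z by simp
    then show "ip H u w = ip H v w" using a \<open>w \<in> pts H\<close> by simp
  qed (use a in auto)
qed

lemma vdist_add:
  assumes "u \<in> pts H" "v \<in> pts H" "u' \<in> pts H" "v' \<in> pts H"
  shows "vdist H (vadd H u v) (vadd H u' v') \<le> vdist H u u' + vdist H v v'"
proof -
  have "vadd H (vadd H u v) (vminus H (vadd H u' v')) =
      vadd H (vadd H u (vminus H u')) (vadd H v (vminus H v'))"
    by (rule eq_by_ip) (use assms in auto)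
  then show ?thesis using assms by (simp add: vdist_def vnorm_triangle)
qed

lemma vdist_smul:
  assumes "u \<in> pts H" "v \<in> pts H"
  shows "vdist H (smul H a u) (smul H a v) = cmod a * vdist H u v"
proof -
  have "vadd H (smul H a u) (vminus H (smul H a v)) = smul H a (vadd H u (vminus H v))"
    by (rule eq_by_ip) (use assms in \<open>auto simp: algebra_simps\<close>)
  then show ?thesis using assms by (simp add: vdist_def vnorm_smul)
qed

lemma tendsto_ip:
  assumes "\<And>n. s n \<in> pts H" "\<And>n. t n \<in> pts H" and u: "u \<in> pts H" and v: "v \<in> pts H"
    and su: "(\<lambda>n. vdist H (s n) u) \<longlonglongrightarrow> 0" and tv: "(\<lambda>n. vdist H (t n) v) \<longlonglongrightarrow> 0"
  shows "(\<lambda>n. ip H (s n) (t n)) \<longlonglongrightarrow> ip H u v"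
proof (rule LIM_zero_cancel, rule Lim_null_comparison)
  let ?B = "\<lambda>n. vdist H (s n) u * (vdist H (t n) v + vnorm H v) + vnorm H u * vdist H (t n) v"
  have "cmod (ip H (s n) (t n) - ip H u v) \<le> ?B n" for n
  proof -
    note m = assms(1)[of n] assms(2)[of n] u v
    let ?a = "vadd H (s n) (vminus H u)" and ?b = "vadd H (t n) (vminus H v)"
    have eq: "ip H (s n) (t n) - ip H u v = ip H ?a ?b + ip H ?a v + ip H u ?b"
      using m by (simp add: algebra_simps)
    have "cmod (ip H (s n) (t n) - ip H u v) \<le> cmod (ip H ?a ?b) + cmod (ip H ?a v) + cmod (ip H u ?b)"
      unfolding eq by (rule order_trans[OF norm_triangle_ineq add_right_mono[OF norm_triangle_ineq]])
    also have "\<dots> \<le> vnorm H ?a * vnorm H ?b + vnorm H ?a * vnorm H v + vnorm H u * vnorm H ?b"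
      using m by (intro add_mono cauchy_schwarz) auto
    finally show ?thesis by (simp add: vdist_def algebra_simps)
  qed
  then show "\<forall>\<^sub>F n in sequentially. norm (ip H (s n) (t n) - ip H u v) \<le> ?B n" by simp
  have "?B \<longlonglongrightarrow> 0 * (0 + vnorm H v) + vnorm H u * 0"
    by (intro tendsto_intros su tv)
  then show "?B \<longlonglongrightarrow> 0" by simp
qed

lemma tendsto_ip_left:
  assumes "\<And>n. s n \<in> pts H" "u \<in> pts H" "v \<in> pts H" "(\<lambda>n. vdist H (s n) u) \<longlonglongrightarrow> 0"
  shows "(\<lambda>n. ip H (s n) v) \<longlonglongrightarrow> ip H u v"
  using assms by (intro tendsto_ip) auto

lemma vdist_limit_add:
  assumes "\<And>n. s n \<in> pts H" "\<And>n. t n \<in> pts H" "u \<in> pts H" "v \<in> pts H"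
    and "(\<lambda>n. vdist H (s n) u) \<longlonglongrightarrow> 0" "(\<lambda>n. vdist H (t n) v) \<longlonglongrightarrow> 0"
  shows "(\<lambda>n. vdist H (vadd H (s n) (t n)) (vadd H u v)) \<longlonglongrightarrow> 0"
proof (rule Lim_null_comparison)
  show "\<forall>\<^sub>F n in sequentially. norm (vdist H (vadd H (s n) (t n)) (vadd H u v))
      \<le> vdist H (s n) u + vdist H (t n) v"
    using assms(1-4) vdist_add by simp
  show "(\<lambda>n. vdist H (s n) u + vdist H (t n) v) \<longlonglongrightarrow> 0"
    using tendsto_add[OF assms(5,6)] by simp
qed

lemma vdist_limit_smul:
  assumes "\<And>n. s n \<in> pts H" "u \<in> pts H" "(\<lambda>n. vdist H (s n) u) \<longlonglongrightarrow> 0"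
  shows "(\<lambda>n. vdist H (smul H a (s n)) (smul H a u)) \<longlonglongrightarrow> 0"
  using tendsto_mult_left[OF assms(3), of "cmod a"] assms by (simp add: vdist_smul)

end

text \<open>
  Spanning both sides simultaneously avoids the question whether \<open>x i \<mapsto> y i\<close> extends
  consistently to linear combinations.
\<close>

inductive pair_span :: "'a cspace \<Rightarrow> 'b cspace \<Rightarrow> ('i \<Rightarrow> 'a) \<Rightarrow> ('i \<Rightarrow> 'b) \<Rightarrow> 'a \<Rightarrow> 'b \<Rightarrow> bool"
  for H K x y where
  zero: "pair_span H K x y (vzero H) (vzero K)"
| add: "pair_span H K x y u v \<Longrightarrow>
    pair_span H K x y (vadd H u (smul H a (x i))) (vadd K v (smul K a (y i)))"

text \<open>Trivial orthogonal complement is the form in which totality can be checked for the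
  generators on both sides; in a Hilbert space it makes the span dense, see
  \<open>span_dense\<close>.\<close>

definition total_family :: "'a cspace \<Rightarrow> ('i \<Rightarrow> 'a) \<Rightarrow> bool" where
  "total_family H x \<longleftrightarrow>
     (\<forall>i. x i \<in> pts H) \<and> (\<forall>v\<in>pts H. (\<forall>i. ip H v (x i) = 0) \<longrightarrow> v = vzero H)"

lemma (in complex_inner_space) total_family_eqI:
  assumes "total_family H x" "u \<in> pts H" "v \<in> pts H" "\<And>i. ip H u (x i) = ip H v (x i)"
  shows "u = v"
proof -
  have x: "\<And>i. x i \<in> pts H" using assms(1) by (auto simp: total_family_def)
  have "vadd H u (vminus H v) = vzero H"
    using assms x unfolding total_family_def by auto
  then have "vdist H u v = 0" by (simp add: vdist_def vnorm_eq_0)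
  then show ?thesis using assms by (intro eq_by_vdist)
qed

section \<open>Extension of a Gram-preserving assignment to the closed span\<close>

locale hilbert_pair = H: complex_hilbert_space H + K: complex_hilbert_space K
  for H :: "'a cspace" and K :: "'b cspace" +
  fixes x :: "'i \<Rightarrow> 'a" and y :: "'i \<Rightarrow> 'b"
  assumes x_in: "x i \<in> pts H" and y_in: "y i \<in> pts K"
    and gram: "ip H (x i) (x j) = ip K (y i) (y j)"
begin

abbreviation "S \<equiv> pair_span H K x y"

lemma S_closed: "S u v \<Longrightarrow> u \<in> pts H \<and> v \<in> pts K"
  by (induction rule: pair_span.induct) (auto simp: x_in y_in)

lemma S_ip_gen: "S u v \<Longrightarrow> ip H u (x j) = ip K v (y j)"
  by (induction rule: pair_span.induct) (auto simp: x_in y_in gram dest: S_closed)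

lemma S_ip: "S u v \<Longrightarrow> S u' v' \<Longrightarrow> ip H u' u = ip K v' v"
proof (induction rule: pair_span.induct)
  case zero
  then show ?case using S_closed by auto
next
  case (add u v a i)
  then show ?case using S_closed[OF add.hyps] S_closed[OF add.prems] S_ip_gen
    by (simp add: x_in y_in)
qed

lemma S_add: "S u v \<Longrightarrow> S u' v' \<Longrightarrow> S (vadd H u' u) (vadd K v' v)"
proof (induction rule: pair_span.induct)
  case zero
  then show ?case using S_closed[OF zero] by (simp add: H.add_zero K.add_zero)
next
  case (add u v a i)
  have "S (vadd H (vadd H u' u) (smul H a (x i))) (vadd K (vadd K v' v) (smul K a (y i)))"
    using add by (intro pair_span.add) auto
  then show ?case using S_closed[OF add.hyps] S_closed[OF add.prems]
    by (simp add: x_in y_in H.add_assoc K.add_assoc)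
qed

lemma S_smul: "S u v \<Longrightarrow> S (smul H b u) (smul K b v)"
proof (induction rule: pair_span.induct)
  case zero
  have "smul H b (vzero H) = vzero H" by (rule H.eq_by_ip) auto
  moreover have "smul K b (vzero K) = vzero K" by (rule K.eq_by_ip) auto
  ultimately show ?case by (simp add: pair_span.zero)
next
  case (add u v a i)
  have "S (vadd H (smul H b u) (smul H (b * a) (x i))) (vadd K (smul K b v) (smul K (b * a) (y i)))"
    using add by (intro pair_span.add)
  then show ?case using S_closed[OF add.hyps]
    by (simp add: x_in y_in H.smul_add_right K.smul_add_right H.smul_smul K.smul_smul)
qed

lemma S_gen: "S (x i) (y i)"
proof -
  have "S (vadd H (vzero H) (smul H 1 (x i))) (vadd K (vzero K) (smul K 1 (y i)))"
    by (intro pair_span.intros)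
  moreover have "vadd H (vzero H) (smul H 1 (x i)) = x i"
    by (rule H.eq_by_ip) (auto simp: x_in)
  moreover have "vadd K (vzero K) (smul K 1 (y i)) = y i"
    by (rule K.eq_by_ip) (auto simp: y_in)
  ultimately show ?thesis by simp
qed

lemma S_vnorm: "S u v \<Longrightarrow> vnorm H u = vnorm K v"
  using S_ip[of u v u v] by (simp add: vnorm_def)

lemma S_vdist: "S u v \<Longrightarrow> S u' v' \<Longrightarrow> vdist H u u' = vdist K v v'"
  unfolding vdist_def vminus_def by (intro S_vnorm S_add S_smul)

text \<open>A sequence in the span whose distances to \<open>v\<close> approach the infimum is
  Cauchy by the parallelogram law. The difference of \<open>v\<close> and its limit \<open>p\<close>
  is orthogonal to all generators, for otherwise a small multiple of a generator would push the
  distance below the infimum; totality gives \<open>v = p\<close>. The companions \<open>b n\<close>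
  come along because the argument runs on pairs in \<open>S\<close>.\<close>

lemma span_dense:
  assumes tot: "total_family H x" and v: "v \<in> pts H"
  shows "\<exists>a b. (\<forall>n::nat. S (a n) (b n)) \<and> (\<lambda>n. vdist H (a n) v) \<longlonglongrightarrow> 0"
proof -
  define Q where "Q = {(vdist H u v)\<^sup>2 | u w. S u w}"
  define I where "I = Inf Q"
  have Q_bdd: "bdd_below Q" by (rule bdd_belowI[of _ 0]) (auto simp: Q_def)
  have I_le: "I \<le> (vdist H u v)\<^sup>2" if "S u w" for u w
    unfolding I_def by (rule cInf_lower[OF _ Q_bdd]) (use that in \<open>auto simp: Q_def\<close>)
  have "Q \<noteq> {}" using pair_span.zero[of H K x y] by (auto simp: Q_def)
  then have "\<exists>q\<in>Q. q < I + 1 / real (Suc n)" for n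
    unfolding I_def using Q_bdd by (intro cInf_lessD) auto
  then have "\<exists>u w. S u w \<and> (vdist H u v)\<^sup>2 < I + 1 / real (Suc n)" for n
    by (fastforce simp: Q_def)
  then obtain a b where S: "S (a n) (b n)" and near: "(vdist H (a n) v)\<^sup>2 < I + 1 / real (Suc n)"
    for n by metis
  have a: "a n \<in> pts H" for n using S_closed[OF S] by blast
  have cau: "(vdist H (a m) (a n))\<^sup>2 \<le> 2 / real (Suc m) + 2 / real (Suc n)" for m n
  proof -
    let ?h = "smul H (1 / 2) (vadd H (a m) (a n))"
    have "I \<le> (vdist H ?h v)\<^sup>2" using S_smul[OF S_add[OF S S]] by (rule I_le)
    \<comment> \<open>Parallelogram law about \<open>v\<close>; the midpoint \<open>?h\<close> lies
      in the span, so its squared distance is at least \<open>I\<close>.\<close>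
    moreover have "(vdist H (a m) (a n))\<^sup>2 + 4 * (vdist H ?h v)\<^sup>2 =
        2 * (vdist H (a m) v)\<^sup>2 + 2 * (vdist H (a n) v)\<^sup>2"
      using a v H.ip_cnj[OF a a, of m n] by (simp add: H.vdist_sq H.vnorm_sq algebra_simps)
    ultimately show ?thesis using near[of m] near[of n] by linarith
  qed
  have "\<forall>e>0. \<exists>N. \<forall>m\<ge>N. \<forall>n\<ge>N. vdist H (a m) (a n) < e"
  proof (intro allI impI)
    fix e :: real assume e: "e > 0"
    obtain N where N: "4 / e\<^sup>2 < real N" using reals_Archimedean2 by blast
    have "vdist H (a m) (a n) < e" if "m \<ge> N" "n \<ge> N" for m n
    proof (rule power2_less_imp_less)
      have N0: "0 < real N" using N e by (smt (verit) divide_pos_pos zero_less_power)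
      have "(vdist H (a m) (a n))\<^sup>2 \<le> 2 / real (Suc m) + 2 / real (Suc n)" by (rule cau)
      also have "\<dots> \<le> 2 / real N + 2 / real N"
        using that N0 by (intro add_mono divide_left_mono) auto
      also have "\<dots> < e\<^sup>2" using N N0 e by (simp add: field_simps)
      finally show "(vdist H (a m) (a n))\<^sup>2 < e\<^sup>2" .
    qed (use e in auto)
    then show "\<exists>N. \<forall>m\<ge>N. \<forall>n\<ge>N. vdist H (a m) (a n) < e" by blast
  qed
  then obtain p where p: "p \<in> pts H" and lim: "(\<lambda>n. vdist H (a n) p) \<longlonglongrightarrow> 0"
    using H.complete a by blast
  have "ip H v (x i) = ip H p (x i)" for i
  proof -
    define z where "z = ip H v (x i) - ip H p (x i)"
    define C where "C = (vnorm H (x i))\<^sup>2"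
    have C0: "0 \<le> C" by (simp add: C_def)
    have lower: "0 \<le> 1 / real (Suc n) - 2 * Re (cnj t * (ip H v (x i) - ip H (a n) (x i))) + (cmod t)\<^sup>2 * C"
      for n t
    proof -
      let ?u = "vadd H (a n) (smul H t (x i))"
      have "I \<le> (vdist H ?u v)\<^sup>2" using pair_span.add[OF S] by (rule I_le)
      also have "(vdist H ?u v)\<^sup>2 = (vdist H (a n) v)\<^sup>2
          - 2 * Re (cnj t * (ip H v (x i) - ip H (a n) (x i))) + (cmod t)\<^sup>2 * C"
      proof -
        have c1: "ip H (x i) (a n) = cnj (ip H (a n) (x i))" by (rule H.ip_cnj[OF a x_in])
        have c2: "ip H (x i) v = cnj (ip H v (x i))" by (rule H.ip_cnj[OF v x_in])
        have c3: "(cmod t)\<^sup>2 * C = Re (t * cnj t * ip H (x i) (x i))"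
          unfolding complex_norm_square[symmetric] H.ip_self[OF x_in] C_def by simp
        have c4: "Re (t * cnj (ip H v (x i))) = Re (cnj t * ip H v (x i))" 
          "Re (t * cnj (ip H (a n) (x i))) = Re (cnj t * ip H (a n) (x i))"
          by simp_all
        show ?thesis unfolding c3 using a v x_in
          by (simp add: H.vdist_sq H.vnorm_sq c1 c2 algebra_simps del: complex_Re_of_nat)
      qed
      finally show ?thesis using near[of n] by linarith
    qed
    have "(\<lambda>n. ip H (a n) (x i)) \<longlonglongrightarrow> ip H p (x i)"
      using a p x_in lim by (intro H.tendsto_ip_left)
    then have "(\<lambda>n. 1 / real (Suc n) - 2 * Re (cnj t * (ip H v (x i) - ip H (a n) (x i))) + (cmod t)\<^sup>2 * C)
        \<longlonglongrightarrow> 0 - 2 * Re (cnj t * z) + (cmod t)\<^sup>2 * C" for t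
      unfolding z_def by (intro tendsto_intros LIMSEQ_inverse_real_of_nat[unfolded inverse_eq_divide])
    then have "0 \<le> 0 - 2 * Re (cnj t * z) + (cmod t)\<^sup>2 * C" for t
      by (rule LIMSEQ_le_const) (use lower in auto)
    \<comment> \<open>At this \<open>t\<close> the linear gain \<open>2 |z|^2 / (C + 1)\<close>
      exceeds the quadratic cost \<open>|z|^2 C / (C + 1)^2\<close> unless \<open>z = 0\<close>;
      \<open>C + 1\<close> in place of \<open>C\<close> covers \<open>x i = 0\<close>.\<close>
    note this[of "complex_of_real (1 / (C + 1)) * z"]
    also have "Re (cnj (complex_of_real (1 / (C + 1)) * z) * z) = (cmod z)\<^sup>2 / (C + 1)"
      unfolding cmod_power2 by (simp add: power2_eq_square add_divide_distrib)
    also have "(cmod (complex_of_real (1 / (C + 1)) * z))\<^sup>2 = (cmod z)\<^sup>2 / (C + 1)\<^sup>2"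
      using C0 by (simp add: norm_mult norm_divide power_mult_distrib power_divide del: of_real_add)
    finally have "2 * (cmod z)\<^sup>2 / (C + 1) \<le> (cmod z)\<^sup>2 * C / (C + 1)\<^sup>2" by simp
    moreover have "2 * Z / D \<le> Z * C / D\<^sup>2 \<Longrightarrow> 2 * Z * D \<le> Z * C" if "D > 0" for Z D :: real
      using that by (simp add: field_simps power2_eq_square)
    ultimately have "2 * (cmod z)\<^sup>2 * (C + 1) \<le> (cmod z)\<^sup>2 * C" using C0 by simp
    then have "(cmod z)\<^sup>2 * (C + 2) \<le> 0" by (simp add: algebra_simps)
    then have "z = 0" using C0 by (simp add: mult_le_0_iff)
    then show ?thesis by (simp add: z_def)
  qed
  then have "v = p" using tot v p by (intro H.total_family_eqI) auto
  then show ?thesis using S lim by blast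
qed

text \<open>The closure of the pair span in the product space. Isometry makes it single-valued
  (\<open>R_unique\<close>); density and completeness of \<open>K\<close> make it defined everywhere
  (\<open>R_exists\<close>).\<close>

definition R :: "'a \<Rightarrow> 'b \<Rightarrow> bool" where
  "R v w \<longleftrightarrow> v \<in> pts H \<and> w \<in> pts K \<and> (\<exists>a b. (\<forall>n::nat. S (a n) (b n)) \<and>
     (\<lambda>n. vdist H (a n) v) \<longlonglongrightarrow> 0 \<and> (\<lambda>n. vdist K (b n) w) \<longlonglongrightarrow> 0)"

lemma R_ip: assumes "R v w" "R v' w'" shows "ip K w w' = ip H v v'"
proof -
  obtain a b where ab: "\<And>n. S (a n) (b n)" "(\<lambda>n. vdist H (a n) v) \<longlonglongrightarrow> 0"
      "(\<lambda>n. vdist K (b n) w) \<longlonglongrightarrow> 0"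
    using assms(1) unfolding R_def by blast
  obtain a' b' where ab': "\<And>n. S (a' n) (b' n)" "(\<lambda>n. vdist H (a' n) v') \<longlonglongrightarrow> 0"
      "(\<lambda>n. vdist K (b' n) w') \<longlonglongrightarrow> 0"
    using assms(2) unfolding R_def by blast
  have "(\<lambda>n. ip H (a n) (a' n)) \<longlonglongrightarrow> ip H v v'"
    using assms ab ab' S_closed by (intro H.tendsto_ip) (auto simp: R_def)
  moreover have "(\<lambda>n. ip K (b n) (b' n)) \<longlonglongrightarrow> ip K w w'"
    using assms ab ab' S_closed by (intro K.tendsto_ip) (auto simp: R_def)
  ultimately show ?thesis
    using S_ip[OF ab'(1) ab(1)] by (simp add: LIMSEQ_unique)
qed

lemma R_unique: assumes "R v w" "R v w'" shows "w = w'"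
proof (rule K.eq_by_vdist)
  show w: "w \<in> pts K" "w' \<in> pts K" using assms by (auto simp: R_def)
  have "(vdist K w w')\<^sup>2 = 0"
    using w R_ip[OF assms(1,1)] R_ip[OF assms(2,2)] R_ip[OF assms]
    by (simp add: K.vdist_sq K.vnorm_sq)
  then show "vdist K w w' = 0" by simp
qed

lemma R_add: assumes "R v w" "R v' w'" shows "R (vadd H v v') (vadd K w w')"
proof -
  obtain a b where ab: "\<And>n. S (a n) (b n)" "(\<lambda>n. vdist H (a n) v) \<longlonglongrightarrow> 0"
      "(\<lambda>n. vdist K (b n) w) \<longlonglongrightarrow> 0"
    using assms(1) unfolding R_def by blast
  obtain a' b' where ab': "\<And>n. S (a' n) (b' n)" "(\<lambda>n. vdist H (a' n) v') \<longlonglongrightarrow> 0"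
      "(\<lambda>n. vdist K (b' n) w') \<longlonglongrightarrow> 0"
    using assms(2) unfolding R_def by blast
  note in_spaces = assms[unfolded R_def] S_closed[OF ab(1)] S_closed[OF ab'(1)]
  have "(\<lambda>n. vdist H (vadd H (a n) (a' n)) (vadd H v v')) \<longlonglongrightarrow> 0"
    using in_spaces ab ab' by (intro H.vdist_limit_add) auto
  moreover have "(\<lambda>n. vdist K (vadd K (b n) (b' n)) (vadd K w w')) \<longlonglongrightarrow> 0"
    using in_spaces ab ab' by (intro K.vdist_limit_add) auto
  moreover have "S (vadd H (a n) (a' n)) (vadd K (b n) (b' n))" for n
    by (rule S_add[OF ab'(1) ab(1)])
  moreover have "vadd H v v' \<in> pts H" "vadd K w w' \<in> pts K" using in_spaces by auto
  ultimately show ?thesis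
    unfolding R_def by (intro conjI exI[of _ "\<lambda>n. vadd H (a n) (a' n)"] exI[of _ "\<lambda>n. vadd K (b n) (b' n)"]) auto
qed

lemma R_smul: assumes "R v w" shows "R (smul H t v) (smul K t w)"
proof -
  obtain a b where ab: "\<And>n. S (a n) (b n)" "(\<lambda>n. vdist H (a n) v) \<longlonglongrightarrow> 0"
      "(\<lambda>n. vdist K (b n) w) \<longlonglongrightarrow> 0"
    using assms(1) unfolding R_def by blast
  note in_spaces = assms[unfolded R_def] S_closed[OF ab(1)]
  have "(\<lambda>n. vdist H (smul H t (a n)) (smul H t v)) \<longlonglongrightarrow> 0"
    using in_spaces ab by (intro H.vdist_limit_smul) auto
  moreover have "(\<lambda>n. vdist K (smul K t (b n)) (smul K t w)) \<longlonglongrightarrow> 0"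
    using in_spaces ab by (intro K.vdist_limit_smul) auto
  moreover have "S (smul H t (a n)) (smul K t (b n))" for n
    by (rule S_smul[OF ab(1)])
  moreover have "smul H t v \<in> pts H" "smul K t w \<in> pts K" using in_spaces by auto
  ultimately show ?thesis
    unfolding R_def by (intro conjI exI[of _ "\<lambda>n. smul H t (a n)"] exI[of _ "\<lambda>n. smul K t (b n)"]) auto
qed

lemma R_gen: "R (x i) (y i)"
  unfolding R_def using S_gen x_in y_in
  by (intro conjI exI[of _ "\<lambda>_. x i"] exI[of _ "\<lambda>_. y i"]) auto

lemma R_exists: assumes "total_family H x" "v \<in> pts H" shows "\<exists>w. R v w"
proof -
  obtain a b where S: "\<And>n::nat. S (a n) (b n)" and lim: "(\<lambda>n. vdist H (a n) v) \<longlonglongrightarrow> 0"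
    using span_dense[OF assms] by blast
  note ab = S_closed[OF S]
  have "\<forall>e>0. \<exists>N. \<forall>m\<ge>N. \<forall>n\<ge>N. vdist K (b m) (b n) < e"
  proof (intro allI impI)
    fix e :: real assume "e > 0"
    then have "\<forall>\<^sub>F n in sequentially. vdist H (a n) v < e / 2"
      using order_tendstoD(2)[OF lim, of "e / 2"] by simp
    then obtain N where N: "\<And>n. n \<ge> N \<Longrightarrow> vdist H (a n) v < e / 2"
      by (auto simp: eventually_sequentially)
    have "vdist K (b m) (b n) < e" if "m \<ge> N" "n \<ge> N" for m n
    proof -
      have "vdist H (a m) (a n) \<le> vdist H (a m) v + vdist H v (a n)"
        using ab assms(2) by (intro H.vdist_triangle) auto
      also have "\<dots> < e" using N[OF that(1)] N[OF that(2)] ab assms(2)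
        by (simp add: H.vdist_commute)
      finally show ?thesis by (simp add: S_vdist[OF S S])
    qed
    then show "\<exists>N. \<forall>m\<ge>N. \<forall>n\<ge>N. vdist K (b m) (b n) < e" by blast
  qed
  then obtain w where "w \<in> pts K" "(\<lambda>n. vdist K (b n) w) \<longlonglongrightarrow> 0"
    using K.complete[of b] ab by blast
  then show ?thesis using S lim assms(2) unfolding R_def by blast
qed

end

definition isometry_map :: "'a cspace \<Rightarrow> 'b cspace \<Rightarrow> ('a \<Rightarrow> 'b) \<Rightarrow> bool" where
  "isometry_map H K U \<longleftrightarrow>
     clinear_map H K U \<and> (\<forall>u\<in>pts H. \<forall>v\<in>pts H. ip K (U u) (U v) = ip H u v)"

text \<open>Totality is asked of the source family alone: for the maps between fibres nothing is
  known beforehand about the span of the images.\<close>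

theorem isometric_extension:
  assumes H: "complex_hilbert_space H" and K: "complex_hilbert_space K"
    and x: "total_family H x" and y: "\<And>i. y i \<in> pts K"
    and gram: "\<And>i j. ip H (x i) (x j) = ip K (y i) (y j)"
  shows "\<exists>U. isometry_map H K U \<and> (\<forall>i. U (x i) = y i)"
proof -
  interpret hilbert_pair H K x y
    using assms unfolding total_family_def
    by (intro hilbert_pair.intro hilbert_pair_axioms.intro) auto
  define U where "U v = (SOME w. R v w)" for v
  have RU: "R v (U v)" if "v \<in> pts H" for v
    unfolding U_def using R_exists[OF x that] by (rule someI_ex)
  have "clinear_map H K U"
    unfolding clinear_map_def
  proof (intro conjI ballI allI)
    fix u v assume "u \<in> pts H" "v \<in> pts H"
    then show "U (vadd H u v) = vadd K (U u) (U v)"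
      by (intro R_unique[OF RU R_add[OF RU RU]]) auto
  next
    fix a v assume "v \<in> pts H"
    then show "U (smul H a v) = smul K a (U v)"
      by (intro R_unique[OF RU R_smul[OF RU]]) auto
  next
    fix v assume "v \<in> pts H"
    then show "U v \<in> pts K" using RU by (auto simp: R_def)
  qed
  moreover have "\<forall>u\<in>pts H. \<forall>v\<in>pts H. ip K (U u) (U v) = ip H u v"
    using R_ip[OF RU RU] by blast
  moreover have "U (x i) = y i" for i
    by (rule R_unique[OF RU R_gen]) (rule x_in)
  ultimately show ?thesis unfolding isometry_map_def by blast
qed

text \<open>Two isometric extensions in opposite directions are mutually inverse.\<close>

theorem unitary_extension:
  assumes H: "complex_hilbert_space H" and K: "complex_hilbert_space K"
    and x: "total_family H x" and y: "total_family K y"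
    and gram: "\<And>i j. ip H (x i) (x j) = ip K (y i) (y j)"
  shows "\<exists>U. unitary_map H K U \<and> (\<forall>i. U (x i) = y i)"
proof -
  interpret H: complex_hilbert_space H by (rule H)
  interpret K: complex_hilbert_space K by (rule K)
  have xy: "x i \<in> pts H" "y i \<in> pts K" for i using x y by (auto simp: total_family_def)
  obtain U where U: "isometry_map H K U" "\<And>i. U (x i) = y i"
    using isometric_extension[OF H K x xy(2) gram] by blast
  obtain V where V: "isometry_map K H V" "\<And>i. V (y i) = x i"
    using isometric_extension[OF K H y xy(1) gram[symmetric]] by blast
  have in_K: "U u \<in> pts K" if "u \<in> pts H" for u
    using U(1) that by (auto simp: isometry_map_def clinear_map_def)
  have in_H: "V u \<in> pts H" if "u \<in> pts K" for u
    using V(1) that by (auto simp: isometry_map_def clinear_map_def)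
  have ipU: "ip K (U u) (U v) = ip H u v" if "u \<in> pts H" "v \<in> pts H" for u v
    using U(1) that by (auto simp: isometry_map_def)
  have ipV: "ip H (V u) (V v) = ip K u v" if "u \<in> pts K" "v \<in> pts K" for u v
    using V(1) that by (auto simp: isometry_map_def)
  have UV: "U (V w) = w" if w: "w \<in> pts K" for w
  proof (rule K.total_family_eqI[OF y])
    fix i
    have "ip K (U (V w)) (y i) = ip H (V w) (x i)"
      using ipU[of "V w" "x i"] w in_H xy U(2) by simp
    also have "\<dots> = ip K w (y i)" using ipV[of w "y i"] w xy V(2) by simp
    finally show "ip K (U (V w)) (y i) = ip K w (y i)" .
  qed (use w in_K in_H in auto)
  have VU: "V (U w) = w" if w: "w \<in> pts H" for w
  proof (rule H.total_family_eqI[OF x])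
    fix i
    have "ip H (V (U w)) (x i) = ip K (U w) (y i)"
      using ipV[of "U w" "y i"] w in_K xy V(2) by simp
    also have "\<dots> = ip H w (x i)" using ipU[of w "x i"] w xy U(2) by simp
    finally show "ip H (V (U w)) (x i) = ip H w (x i)" .
  qed (use w in_K in_H in auto)
  have "bij_betw U (pts H) (pts K)"
    by (rule bij_betw_byWitness[of _ V]) (use UV VU in_H in_K in auto)
  then show ?thesis using U unfolding unitary_map_def isometry_map_def by blast
qed

section \<open>The model fibres\<close>

lemma in_model:
  "v \<in> pts (model_space d) \<longleftrightarrow>
     (\<forall>n. d \<le> enat n \<longrightarrow> v n = 0) \<and> summable (\<lambda>n. (cmod (v n))\<^sup>2)"
  by (simp add: model_space_def)

lemma model_simps [simp]:
  "vadd (model_space d) v w = (\<lambda>n. v n + w n)"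
  "vzero (model_space d) = (\<lambda>n. 0)"
  "smul (model_space d) a v = (\<lambda>n. a * v n)"
  "vminus (model_space d) v = (\<lambda>n. - v n)"
  by (simp_all add: model_space_def vminus_def)

lemma ip_model: "ip (model_space d) v w = (\<Sum>n. v n * cnj (w n))"
  by (simp add: model_space_def)

lemma l2_mult_summable:
  fixes v w :: "nat \<Rightarrow> complex"
  assumes "summable (\<lambda>n. (cmod (v n))\<^sup>2)" "summable (\<lambda>n. (cmod (w n))\<^sup>2)"
  shows "summable (\<lambda>n. cmod (v n * cnj (w n)))"
proof (rule summable_comparison_test')
  show "summable (\<lambda>n. (cmod (v n))\<^sup>2 + (cmod (w n))\<^sup>2)" by (intro summable_add assms)
  fix n
  have "0 \<le> (cmod (v n) - cmod (w n))\<^sup>2" "0 \<le> cmod (v n) * cmod (w n)" by simp_all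
  then show "norm (cmod (v n * cnj (w n))) \<le> (cmod (v n))\<^sup>2 + (cmod (w n))\<^sup>2"
    unfolding power2_diff norm_mult complex_mod_cnj real_norm_def abs_mult abs_norm_cancel by linarith
qed

lemma l2_add_summable:
  fixes v w :: "nat \<Rightarrow> complex"
  assumes "summable (\<lambda>n. (cmod (v n))\<^sup>2)" "summable (\<lambda>n. (cmod (w n))\<^sup>2)"
  shows "summable (\<lambda>n. (cmod (v n + w n))\<^sup>2)"
proof (rule summable_comparison_test')
  show "summable (\<lambda>n. 2 * (cmod (v n))\<^sup>2 + 2 * (cmod (w n))\<^sup>2)" by (intro summable_add summable_mult assms)
  fix n
  have "(cmod (v n + w n))\<^sup>2 \<le> (cmod (v n) + cmod (w n))\<^sup>2"
    by (intro power_mono norm_triangle_ineq) auto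
  also have "\<dots> \<le> 2 * (cmod (v n))\<^sup>2 + 2 * (cmod (w n))\<^sup>2"
    using zero_le_power2[of "cmod (v n) - cmod (w n)"] by (simp add: power2_sum power2_diff)
  finally show "norm ((cmod (v n + w n))\<^sup>2) \<le> 2 * (cmod (v n))\<^sup>2 + 2 * (cmod (w n))\<^sup>2" by simp
qed

lemma model_inner: "complex_inner_space (model_space d)"
proof
  fix u v w :: "nat \<Rightarrow> complex" and a b
  assume u: "u \<in> pts (model_space d)" and v: "v \<in> pts (model_space d)"
  note sm = u[unfolded in_model, THEN conjunct2] v[unfolded in_model, THEN conjunct2]
  have uv: "summable (\<lambda>n. u n * cnj (v n))"
    by (rule summable_norm_cancel) (rule l2_mult_summable[OF sm])
  show "vadd (model_space d) u v \<in> pts (model_space d)"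
    using u v l2_add_summable by (auto simp: in_model)
  show "vadd (model_space d) u v = vadd (model_space d) v u" by (simp add: add.commute)
  show "smul (model_space d) a (vadd (model_space d) u v) =
      vadd (model_space d) (smul (model_space d) a u) (smul (model_space d) a v)"
    by (simp add: distrib_left)
  show "ip (model_space d) (smul (model_space d) a u) v = a * ip (model_space d) u v"
    using suminf_mult[OF uv, of a] by (simp add: ip_model mult.assoc)
  show "ip (model_space d) v u = cnj (ip (model_space d) u v)"
    using sums_cnj[of "\<lambda>n. u n * cnj (v n)" "\<Sum>n. u n * cnj (v n)"] summable_sums[OF uv]
    unfolding ip_model by (intro sums_unique[symmetric]) (simp add: mult.commute)
  assume w: "w \<in> pts (model_space d)"
  note sw = w[unfolded in_model, THEN conjunct2]
  show "vadd (model_space d) (vadd (model_space d) u v) w =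
      vadd (model_space d) u (vadd (model_space d) v w)" by (simp add: add.assoc)
  have "summable (\<lambda>n. u n * cnj (w n))" "summable (\<lambda>n. v n * cnj (w n))"
    by (rule summable_norm_cancel, rule l2_mult_summable[OF _ sw], rule sm)+
  then show "ip (model_space d) (vadd (model_space d) u v) w =
      ip (model_space d) u w + ip (model_space d) v w"
    by (simp add: ip_model distrib_right suminf_add)
next
  fix v :: "nat \<Rightarrow> complex" and a b assume v: "v \<in> pts (model_space d)"
  show "smul (model_space d) a v \<in> pts (model_space d)"
    using v by (auto simp: in_model norm_mult power_mult_distrib intro!: summable_mult)
  show "vadd (model_space d) v (vzero (model_space d)) = v" by simp
  show "vadd (model_space d) v (vminus (model_space d) v) = vzero (model_space d)" by simp
  show "smul (model_space d) (a + b) v =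
      vadd (model_space d) (smul (model_space d) a v) (smul (model_space d) b v)"
    by (simp add: distrib_right)
  show "smul (model_space d) a (smul (model_space d) b v) = smul (model_space d) (a * b) v"
    by (simp add: mult.assoc)
  show "smul (model_space d) 1 v = v" by simp
  have sv: "summable (\<lambda>n. (cmod (v n))\<^sup>2)" using v by (simp add: in_model)
  have eq: "v n * cnj (v n) = complex_of_real ((cmod (v n))\<^sup>2)" for n
    by (rule complex_norm_square[symmetric, folded of_real_power])
  have self: "ip (model_space d) v v = complex_of_real (\<Sum>n. (cmod (v n))\<^sup>2)"
    unfolding ip_model eq by (rule suminf_of_real[OF sv, symmetric])
  show "0 \<le> Re (ip (model_space d) v v)"
    unfolding self using sv by (simp add: suminf_nonneg)
  assume "ip (model_space d) v v = 0"
  then have "(\<Sum>n. (cmod (v n))\<^sup>2) = 0" unfolding self by (simp only: of_real_eq_0_iff)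
  then show "v = vzero (model_space d)"
    using suminf_eq_zero_iff[OF sv] by (simp add: fun_eq_iff)
next
  show "vzero (model_space d) \<in> pts (model_space d)" by (simp add: in_model)
qed

interpretation model: complex_inner_space "model_space d" for d by (rule model_inner)

lemma vnorm_model_sq:
  assumes "v \<in> pts (model_space d)"
  shows "(vnorm (model_space d) v)\<^sup>2 = (\<Sum>n. (cmod (v n))\<^sup>2)"
proof -
  have sv: "summable (\<lambda>n. (cmod (v n))\<^sup>2)" using assms by (simp add: in_model)
  have eq: "v n * cnj (v n) = complex_of_real ((cmod (v n))\<^sup>2)" for n
    by (rule complex_norm_square[symmetric, folded of_real_power])
  have "ip (model_space d) v v = complex_of_real (\<Sum>n. (cmod (v n))\<^sup>2)"
    unfolding ip_model eq by (rule suminf_of_real[OF sv, symmetric])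
  then show ?thesis using assms by (simp add: model.vnorm_sq)
qed

lemma vdist_model:
  "vdist (model_space d) v w = vnorm (model_space d) (\<lambda>n. v n - w n)"
  by (simp add: vdist_def)

lemma cmod_le_vnorm:
  assumes "v \<in> pts (model_space d)"
  shows "cmod (v n) \<le> vnorm (model_space d) v"
proof (rule power2_le_imp_le)
  have "summable (\<lambda>n. (cmod (v n))\<^sup>2)" using assms by (simp add: in_model)
  then show "(cmod (v n))\<^sup>2 \<le> (vnorm (model_space d) v)\<^sup>2"
    unfolding vnorm_model_sq[OF assms] using sum_le_suminf[of "\<lambda>n. (cmod (v n))\<^sup>2" "{n}"] by simp
qed (use assms in simp)

lemma model_diff_in:
  "\<lbrakk>v \<in> pts (model_space d); w \<in> pts (model_space d)\<rbrakk> \<Longrightarrow> (\<lambda>n. v n - w n) \<in> pts (model_space d)"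
  using model.add_closed[of v d "vminus (model_space d) w"] model.minus_closed[of w d] by simp

lemma tendsto_coord:
  assumes "\<And>k. s k \<in> pts (model_space d)" "v \<in> pts (model_space d)"
    and "(\<lambda>k. vdist (model_space d) (s k) v) \<longlonglongrightarrow> 0"
  shows "(\<lambda>k. s k n) \<longlonglongrightarrow> v n"
proof (rule LIM_zero_cancel, rule Lim_null_comparison[OF _ assms(3)])
  show "\<forall>\<^sub>F k in sequentially. norm (s k n - v n) \<le> vdist (model_space d) (s k) v"
    using cmod_le_vnorm[OF model_diff_in[OF assms(1,2)]] by (simp add: vdist_model)
qed

lemma l2_bounded_partial:
  fixes v :: "nat \<Rightarrow> complex"
  assumes "\<And>N. (\<Sum>n<N. (cmod (v n))\<^sup>2) \<le> B"
  shows "summable (\<lambda>n. (cmod (v n))\<^sup>2) \<and> (\<Sum>n. (cmod (v n))\<^sup>2) \<le> B"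
proof -
  have "summable (\<lambda>n. (cmod (v n))\<^sup>2)"
    by (rule summableI_nonneg_bounded[OF _ assms]) auto
  then show ?thesis using assms by (auto intro: suminf_le_const)
qed

theorem model_hilbert: "complex_hilbert_space (model_space d)"
proof (intro complex_hilbert_space.intro complex_hilbert_space_axioms.intro model_inner)
  fix s :: "nat \<Rightarrow> nat \<Rightarrow> complex"
  assume s: "\<forall>n. s n \<in> pts (model_space d)"
    and cau: "\<forall>e>0. \<exists>N. \<forall>m\<ge>N. \<forall>n\<ge>N. vdist (model_space d) (s m) (s n) < e"
  have "Cauchy (\<lambda>k. s k n)" for n
  proof (rule metric_CauchyI)
    fix e :: real assume "e > 0"
    then obtain N where N: "\<forall>m\<ge>N. \<forall>k\<ge>N. vdist (model_space d) (s m) (s k) < e" using cau by blast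
    have "dist (s m n) (s k n) < e" if "m \<ge> N" "k \<ge> N" for m k
    proof -
      have "dist (s m n) (s k n) \<le> vdist (model_space d) (s m) (s k)"
        using cmod_le_vnorm[OF model_diff_in, of "s m" d "s k" n] s by (simp add: vdist_model dist_norm)
      then show ?thesis using N that by fastforce
    qed
    then show "\<exists>M. \<forall>m\<ge>M. \<forall>k\<ge>M. dist (s m n) (s k n) < e" by blast
  qed
  then have "\<exists>L. (\<lambda>k. s k n) \<longlonglongrightarrow> L" for n
    using Cauchy_convergent convergent_def by blast
  then obtain v where v: "\<And>n. (\<lambda>k. s k n) \<longlonglongrightarrow> v n" by metis
  \<comment> \<open>The bound holds for every partial sum before the coordinatewise limit in
    \<open>k\<close> and therefore survives it, uniformly in \<open>M\<close>.\<close>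
  have near: "summable (\<lambda>n. (cmod (s m n - v n))\<^sup>2) \<and> (\<Sum>n. (cmod (s m n - v n))\<^sup>2) \<le> e\<^sup>2"
    if N: "\<forall>m\<ge>N. \<forall>k\<ge>N. vdist (model_space d) (s m) (s k) < e" and m: "m \<ge> N" for m N e
  proof (rule l2_bounded_partial)
    fix M
    have "(\<lambda>k. \<Sum>n<M. (cmod (s m n - s k n))\<^sup>2) \<longlonglongrightarrow> (\<Sum>n<M. (cmod (s m n - v n))\<^sup>2)"
      by (intro tendsto_intros v)
    then show "(\<Sum>n<M. (cmod (s m n - v n))\<^sup>2) \<le> e\<^sup>2"
    proof (rule LIMSEQ_le_const2)
      have "(\<Sum>n<M. (cmod (s m n - s k n))\<^sup>2) \<le> e\<^sup>2" if k: "k \<ge> N" for k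
      proof -
        have in_d: "(\<lambda>n. s m n - s k n) \<in> pts (model_space d)" using s by (intro model_diff_in) auto
        have "(\<Sum>n<M. (cmod (s m n - s k n))\<^sup>2) \<le> (\<Sum>n. (cmod (s m n - s k n))\<^sup>2)"
          using in_d by (intro sum_le_suminf) (auto simp: in_model)
        also have "\<dots> = (vdist (model_space d) (s m) (s k))\<^sup>2"
          using vnorm_model_sq[OF in_d] by (simp add: vdist_model)
        also have "\<dots> \<le> e\<^sup>2"
          using N m k s by (intro power_mono) (auto intro: less_imp_le)
        finally show ?thesis .
      qed
      then show "\<exists>N. \<forall>k\<ge>N. (\<Sum>n<M. (cmod (s m n - s k n))\<^sup>2) \<le> e\<^sup>2" by blast
    qed
  qed
  have in_v: "v \<in> pts (model_space d)"
  proof -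
    obtain N where N: "\<forall>m\<ge>N. \<forall>k\<ge>N. vdist (model_space d) (s m) (s k) < 1"
      using cau by (meson zero_less_one)
    have "summable (\<lambda>n. (cmod (s N n - v n))\<^sup>2)" using near[OF N, of N] by simp
    then have "summable (\<lambda>n. (cmod (v n - s N n))\<^sup>2)" by (simp add: norm_minus_commute)
    then have "summable (\<lambda>n. (cmod ((v n - s N n) + s N n))\<^sup>2)"
      using s by (intro l2_add_summable) (auto simp: in_model)
    moreover have "v n = 0" if "d \<le> enat n" for n
    proof -
      have "(\<lambda>k. s k n) = (\<lambda>k. 0)" using s that by (auto simp: in_model)
      then show ?thesis using v[of n] by (simp add: LIMSEQ_const_iff)
    qed
    ultimately show ?thesis by (simp add: in_model)
  qed
  moreover have "(\<lambda>n. vdist (model_space d) (s n) v) \<longlonglongrightarrow> 0"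
  proof (rule LIMSEQ_I)
    fix r :: real assume r: "r > 0"
    then obtain N where N: "\<forall>m\<ge>N. \<forall>k\<ge>N. vdist (model_space d) (s m) (s k) < r / 2"
      using cau by (meson half_gt_zero)
    have "norm (vdist (model_space d) (s m) v - 0) < r" if "m \<ge> N" for m
    proof -
      have in_d: "(\<lambda>n. s m n - v n) \<in> pts (model_space d)" using s in_v by (intro model_diff_in) auto
      have "(vdist (model_space d) (s m) v)\<^sup>2 \<le> (r / 2)\<^sup>2"
        using near[OF N that] vnorm_model_sq[OF in_d] by (simp add: vdist_model)
      then have "vdist (model_space d) (s m) v \<le> r / 2"
        using r by (meson power2_le_imp_le half_gt_zero less_imp_le)
      then show ?thesis using r s in_v by simp
    qed
    then show "\<exists>no. \<forall>n\<ge>no. norm (vdist (model_space d) (s n) v - 0) < r" by blast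
  qed
  ultimately show "\<exists>v\<in>pts (model_space d). (\<lambda>n. vdist (model_space d) (s n) v) \<longlonglongrightarrow> 0" by blast
qed

text \<open>Indexed by all naturals whatever \<open>d\<close> is, so that one countable index set
  serves all fibres and a fixed \<open>j\<close> gives a field over the whole base space. The zero
  vectors disturb neither Gram identities nor totality.\<close>

definition munit :: "enat \<Rightarrow> nat \<Rightarrow> nat \<Rightarrow> complex" where
  "munit d j = (\<lambda>n. if n = j \<and> enat j < d then 1 else 0)"

lemma munit_in [simp]: "munit d j \<in> pts (model_space d)"
proof -
  have "summable (\<lambda>n. (cmod (munit d j n))\<^sup>2)"
    by (rule summable_finite[of "{j}"]) (auto simp: munit_def)
  then show ?thesis by (auto simp: in_model munit_def)
qed

lemma ip_munit:
  assumes "v \<in> pts (model_space d)"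
  shows "ip (model_space d) v (munit d j) = v j"
proof -
  have "ip (model_space d) v (munit d j) = (\<Sum>n\<in>{j}. v n * cnj (munit d j n))"
    unfolding ip_model by (rule suminf_finite) (auto simp: munit_def)
  then show ?thesis using assms by (auto simp: munit_def in_model not_less)
qed

lemma ip_munit_munit:
  "ip (model_space d) (munit d i) (munit d j) = of_bool (i = j \<and> enat j < d)"
  by (simp add: ip_munit) (simp add: munit_def)

lemma total_munit: "total_family (model_space d) (munit d)"
  unfolding total_family_def by (auto simp: ip_munit)

definition trunc :: "(nat \<Rightarrow> complex) \<Rightarrow> nat \<Rightarrow> nat \<Rightarrow> complex" where
  "trunc v N = (\<lambda>n. if n < N then v n else 0)"

lemma trunc_in: "v \<in> pts (model_space d) \<Longrightarrow> trunc v N \<in> pts (model_space d)"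
proof -
  assume v: "v \<in> pts (model_space d)"
  have "summable (\<lambda>n. (cmod (trunc v N n))\<^sup>2)"
    by (rule summable_finite[of "{..<N}"]) (auto simp: trunc_def)
  then show ?thesis using v by (auto simp: in_model trunc_def)
qed

lemma trunc_tendsto:
  assumes v: "v \<in> pts (model_space d)"
  shows "(\<lambda>N. vdist (model_space d) (trunc v N) v) \<longlonglongrightarrow> 0"
proof -
  have sv: "summable (\<lambda>n. (cmod (v n))\<^sup>2)" using v by (simp add: in_model)
  have "(vdist (model_space d) (trunc v N) v)\<^sup>2 = (\<Sum>n. (cmod (v (n + N)))\<^sup>2)" for N
  proof -
    have in_d: "(\<lambda>n. trunc v N n - v n) \<in> pts (model_space d)" by (intro model_diff_in trunc_in v)
    have "(vdist (model_space d) (trunc v N) v)\<^sup>2 = (\<Sum>n. (cmod (trunc v N n - v n))\<^sup>2)"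
      unfolding vdist_model by (rule vnorm_model_sq[OF in_d])
    also have "\<dots> = (\<Sum>n. (cmod (trunc v N (n + N) - v (n + N)))\<^sup>2)"
      using in_d by (subst suminf_split_initial_segment[where k = N]) (auto simp: in_model trunc_def)
    finally show ?thesis by (simp add: trunc_def)
  qed
  moreover have "(\<lambda>N. \<Sum>n. (cmod (v (n + N)))\<^sup>2) \<longlonglongrightarrow> 0"
    using suminf_exist_split2[OF sv] by simp
  ultimately have "(\<lambda>N. sqrt ((vdist (model_space d) (trunc v N) v)\<^sup>2)) \<longlonglongrightarrow> sqrt 0"
    by (intro tendsto_real_sqrt) simp
  then show ?thesis using v by (simp add: trunc_in)
qed

lemma trunc_Suc:
  assumes "v \<in> pts (model_space d)"
  shows "trunc v (Suc N) =
    vadd (model_space d) (trunc v N) (smul (model_space d) (v N) (munit d N))"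
  using assms by (auto simp: trunc_def munit_def fun_eq_iff in_model less_Suc_eq not_less)

lemma isometry_vdist:
  assumes T: "isometry_map H K T" and "complex_inner_space H" "complex_inner_space K"
    and u: "u \<in> pts H" "v \<in> pts H"
  shows "vdist K (T u) (T v) = vdist H u v"
proof -
  interpret H: complex_inner_space H by fact
  interpret K: complex_inner_space K by fact
  have "T u \<in> pts K" "T v \<in> pts K" using T u by (auto simp: isometry_map_def clinear_map_def)
  then have "(vdist K (T u) (T v))\<^sup>2 = (vdist H u v)\<^sup>2" "0 \<le> vdist K (T u) (T v)"
    using T u by (simp_all add: H.vdist_sq K.vdist_sq H.vnorm_sq K.vnorm_sq isometry_map_def)
  then show ?thesis using u by simp
qed

lemma isometry_trunc_tendsto:
  assumes T: "isometry_map (model_space d) K T" and K: "complex_inner_space K"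
    and v: "v \<in> pts (model_space d)"
  shows "(\<lambda>N. vdist K (T (trunc v N)) (T v)) \<longlonglongrightarrow> 0"
  using trunc_tendsto[OF v] by (simp add: isometry_vdist[OF T model_inner K] trunc_in v)

text \<open>An isometry is determined by its matrix through convergent series. Besides uniqueness
  (\<open>isometry_model_eq\<close>) this gives the measurability of the fibre maps in
  \<open>cT_measurable\<close>.\<close>

lemma isometry_model_sums:
  assumes T: "isometry_map (model_space d) (model_space d') T" and v: "v \<in> pts (model_space d)"
  shows "(\<lambda>j. v j * T (munit d j) i) sums T v i"
proof -
  have in_T: "T u \<in> pts (model_space d')" if "u \<in> pts (model_space d)" for u
    using T that by (auto simp: isometry_map_def clinear_map_def)
  have Tadd: "T (\<lambda>n. u n + w n) = (\<lambda>n. T u n + T w n)"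
    if "u \<in> pts (model_space d)" "w \<in> pts (model_space d)" for u w
    using T that by (auto simp: isometry_map_def clinear_map_def)
  have Tsmul: "T (\<lambda>n. a * u n) = (\<lambda>n. a * T u n)" if "u \<in> pts (model_space d)" for u a
    using T that by (auto simp: isometry_map_def clinear_map_def)
  have fin: "T (trunc v N) i = (\<Sum>j<N. v j * T (munit d j) i)" for N
  proof (induction N)
    case 0
    have "trunc v 0 = (\<lambda>n. 0 * munit d 0 n)" by (simp add: trunc_def)
    then show ?case using Tsmul[OF munit_in, of 0] by simp
  next
    case (Suc N)
    have "smul (model_space d) (v N) (munit d N) \<in> pts (model_space d)" by (intro model.smul_closed) simp
    then show ?case
      using Suc by (simp add: trunc_Suc[OF v] Tadd[OF trunc_in[OF v]] Tsmul)
  qed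
  have "(\<lambda>N. T (trunc v N) i) \<longlonglongrightarrow> T v i"
    using isometry_trunc_tendsto[OF T model_inner v] in_T v trunc_in by (intro tendsto_coord) auto
  then show ?thesis by (simp add: sums_def fin)
qed

lemma isometry_model_eq:
  assumes "isometry_map (model_space d) (model_space d') T"
    "isometry_map (model_space d) (model_space d') T'"
    and v: "v \<in> pts (model_space d)" and "\<And>j. T (munit d j) = T' (munit d j)"
  shows "T v = T' v"
proof
  fix i
  show "T v i = T' v i"
    using isometry_model_sums[OF assms(1) v, of i] isometry_model_sums[OF assms(2) v, of i] assms(4)
    by (simp add: sums_unique2)
qed

text \<open>The last hypothesis says that \<open>z\<close> is the adjoint of \<open>T\<close>
  applied to \<open>a\<close>, tested on basis vectors; continuity along \<open>trunc v N\<close>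
  carries this to every \<open>v\<close> without a construction of the adjoint.\<close>

lemma isometry_ip_right:
  assumes T: "isometry_map (model_space d) K T" and K: "complex_inner_space K"
    and v: "v \<in> pts (model_space d)" and z: "z \<in> pts (model_space d)" and a: "a \<in> pts K"
    and eq: "\<And>j. ip K a (T (munit d j)) = ip (model_space d) z (munit d j)"
  shows "ip K a (T v) = ip (model_space d) z v"
proof -
  interpret K: complex_inner_space K by (rule K)
  have in_T: "T u \<in> pts K" if "u \<in> pts (model_space d)" for u
    using T that by (auto simp: isometry_map_def clinear_map_def)
  have Tadd: "T (vadd (model_space d) u w) = vadd K (T u) (T w)"
    if "u \<in> pts (model_space d)" "w \<in> pts (model_space d)" for u w
    using T that unfolding isometry_map_def clinear_map_def by blast
  have Tsmul: "T (smul (model_space d) b u) = smul K b (T u)" if "u \<in> pts (model_space d)" for u b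
    using T that unfolding isometry_map_def clinear_map_def by blast
  have fin: "ip K a (T (trunc v N)) = ip (model_space d) z (trunc v N)" for N
  proof (induction N)
    case 0
    have t: "trunc v 0 = smul (model_space d) 0 (munit d 0)" by (simp add: trunc_def)
    show ?case unfolding t Tsmul[OF munit_in]
      using a z in_T[OF munit_in] by (simp del: model_simps)
  next
    case (Suc N)
    have m: "smul (model_space d) (v N) (munit d N) \<in> pts (model_space d)"
      by (intro model.smul_closed) simp
    show ?case
      unfolding trunc_Suc[OF v] Tadd[OF trunc_in[OF v] m] Tsmul[OF munit_in]
      using Suc a z eq in_T[OF munit_in] in_T[OF trunc_in[OF v]] trunc_in[OF v] m
      by (simp del: model_simps)
  qed
  have "(\<lambda>N. ip K a (T (trunc v N))) \<longlonglongrightarrow> ip K a (T v)"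
    using isometry_trunc_tendsto[OF T K v] in_T v trunc_in[OF v] a by (intro K.tendsto_ip) auto
  moreover have "(\<lambda>N. ip (model_space d) z (trunc v N)) \<longlonglongrightarrow> ip (model_space d) z v"
    using trunc_tendsto[OF v] v trunc_in[OF v] z by (intro model.tendsto_ip) auto
  ultimately show ?thesis unfolding fin by (rule LIMSEQ_unique)
qed

text \<open>The double sum of \<open>\<bar>\<langle>T e\<^sub>j, e\<^sub>i\<rangle>\<bar>\<^sup>2\<close> over \<open>j \<le> m\<close> and \<open>i < m\<close> is \<open>m + 1\<close> by rows, at most \<open>m\<close> by columns.\<close>

lemma isometry_dim_le:
  assumes T: "isometry_map (model_space d) (model_space d') T"
  shows "d \<le> d'"
proof (rule ccontr)
  assume "\<not> d \<le> d'"
  then have lt: "d' < d" by simp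
  then obtain m where m: "d' = enat m" by (cases d') auto
  define y where "y j = T (munit d j)" for j
  have dj: "enat j < d" if "j \<le> m" for j using that lt m by (metis enat_ord_simps(1) order_le_less_trans)
  have yin: "y j \<in> pts (model_space d')" for j
    using T munit_in by (auto simp: y_def isometry_map_def clinear_map_def)
  have yip: "ip (model_space d') (y i) (y j) = of_bool (i = j)" if "i \<le> m" "j \<le> m" for i j
    using T that dj by (auto simp: y_def isometry_map_def ip_munit_munit)
  have row: "(\<Sum>i<m. (cmod (y j i))\<^sup>2) = 1" if "j \<le> m" for j
  proof -
    have "(\<Sum>i. (cmod (y j i))\<^sup>2) = (\<Sum>i<m. (cmod (y j i))\<^sup>2)"
      using yin[of j] m by (intro suminf_finite) (auto simp: in_model)
    moreover have "(\<Sum>i. (cmod (y j i))\<^sup>2) = 1"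
      using vnorm_model_sq[OF yin, of j] yip[OF that that] by (simp add: model.vnorm_sq yin)
    ultimately show ?thesis by simp
  qed
  have col: "(\<Sum>j\<le>m. (cmod (y j i))\<^sup>2) \<le> 1" if "i < m" for i
  proof -
    define c where "c j = cnj (y j i)" for j
    \<comment> \<open>Bessel's inequality for the basis vector with index \<open>i\<close>:
      \<open>q\<close> is its projection onto the span of the \<open>y j\<close>, so its
      \<open>i\<close>-th coordinate and its squared norm are the same number \<open>B\<close>,
      whence \<open>B\<^sup>2 \<le> B\<close>.\<close>
    define q where "q = (\<lambda>n. \<Sum>j\<le>m. c j * y j n)"
    define B where "B = (\<Sum>j\<le>m. (cmod (y j i))\<^sup>2)"
    have qk: "(\<lambda>n. \<Sum>j\<le>k. c j * y j n) \<in> pts (model_space d') \<and>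
        (\<forall>w\<in>pts (model_space d'). ip (model_space d') (\<lambda>n. \<Sum>j\<le>k. c j * y j n) w =
          (\<Sum>j\<le>k. c j * ip (model_space d') (y j) w))" for k
    proof (induction k)
      case 0
      then show ?case using model.smul_closed[OF yin, of "c 0" 0] model.ip_smul[OF yin, of _ "c 0" 0] by simp
    next
      case (Suc k)
      have s: "smul (model_space d') (c (Suc k)) (y (Suc k)) \<in> pts (model_space d')"
        by (intro model.smul_closed yin)
      show ?case
      proof (intro conjI ballI)
        show "(\<lambda>n. \<Sum>j\<le>Suc k. c j * y j n) \<in> pts (model_space d')"
          using model.add_closed[OF conjunct1[OF Suc] s] by simp
        fix w assume w: "w \<in> pts (model_space d')"
        show "ip (model_space d') (\<lambda>n. \<Sum>j\<le>Suc k. c j * y j n) w =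
            (\<Sum>j\<le>Suc k. c j * ip (model_space d') (y j) w)"
          using model.ip_add[OF conjunct1[OF Suc] s w] Suc w model.ip_smul[OF yin w] by simp
      qed
    qed
    have q: "q \<in> pts (model_space d')" using qk by (simp add: q_def)
    have qi: "q i = complex_of_real B"
      unfolding q_def B_def c_def of_real_sum complex_norm_square by (simp only: mult.commute)
    have yq: "ip (model_space d') (y j) q = cnj (c j)" if "j \<le> m" for j
    proof -
      have "ip (model_space d') q (y j) = (\<Sum>k\<le>m. c k * of_bool (k = j))"
        using qk yin[of j] that yip by (simp add: q_def)
      also have "\<dots> = c j" using that by (simp add: if_distrib cong: if_cong)
      finally show ?thesis using model.ip_cnj[OF q yin] by simp
    qed
    have "ip (model_space d') q q = (\<Sum>j\<le>m. c j * cnj (c j))"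
      using qk[of m] q yq by (simp add: q_def)
    also have "\<dots> = complex_of_real B"
      unfolding B_def c_def of_real_sum complex_norm_square by (simp only: mult.commute complex_cnj_cnj)
    finally have qq: "(vnorm (model_space d') q)\<^sup>2 = B" using q by (simp add: model.vnorm_sq)
    have B0: "0 \<le> B" by (simp add: B_def sum_nonneg)
    have "B\<^sup>2 \<le> B"
    proof -
      have "B \<le> vnorm (model_space d') q" using cmod_le_vnorm[OF q, of i] qi B0 by simp
      then have "B\<^sup>2 \<le> (vnorm (model_space d') q)\<^sup>2" using B0 by (intro power_mono)
      then show ?thesis by (simp add: qq)
    qed
    then have "B \<le> 1" using B0 by (cases "B = 0") (auto simp: power2_eq_square)
    then show ?thesis by (simp add: B_def)
  qed
  have "real (Suc m) = (\<Sum>j\<le>m. \<Sum>i<m. (cmod (y j i))\<^sup>2)" using row by simp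
  also have "\<dots> = (\<Sum>i<m. \<Sum>j\<le>m. (cmod (y j i))\<^sup>2)" by (rule sum.swap)
  also have "\<dots> \<le> (\<Sum>i<m. 1)" by (intro sum_mono col) auto
  finally show False by simp
qed

section \<open>Direct integrals\<close>

text \<open>The squared norm without reference to a fibre, infinite for sequences that are not
  square summable: pointwise limits can thus be integrated before they are known to be
  sections.\<close>

definition sq_sum :: "(nat \<Rightarrow> complex) \<Rightarrow> ennreal" where
  "sq_sum v = (\<Sum>n. ennreal ((cmod (v n))\<^sup>2))"

lemma sq_sum_vnorm:
  assumes "v \<in> pts (model_space d)"
  shows "sq_sum v = ennreal ((vnorm (model_space d) v)\<^sup>2)"
  unfolding sq_sum_def vnorm_model_sq[OF assms]
  using assms by (intro suminf_ennreal2) (auto simp: in_model)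

lemma ennreal_le_suminf: "f n \<le> (\<Sum>n. f n)" for f :: "nat \<Rightarrow> ennreal"
  using sum_le_suminf[of f "{n}"] by simp

lemma sq_sum_finite: "sq_sum v < \<infinity> \<Longrightarrow> summable (\<lambda>n. (cmod (v n))\<^sup>2)"
  unfolding sq_sum_def by (rule summable_suminf_not_top) auto

lemma borel_measurable_cnj [measurable (raw)]:
  "f \<in> borel_measurable M \<Longrightarrow> (\<lambda>x. cnj (f x)) \<in> borel_measurable M"
  by (rule borel_measurable_continuous_on[OF continuous_on_cnj[OF continuous_on_id]])

lemma measurable_sq_sum:
  assumes "\<And>n. (\<lambda>x. f x n) \<in> borel_measurable M"
  shows "(\<lambda>x. sq_sum (f x)) \<in> borel_measurable M"
  unfolding sq_sum_def using assms by measurable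

text \<open>Fatou's lemma for counting measure on the coordinates.\<close>

lemma sq_sum_liminf:
  assumes "\<And>n. (\<lambda>k. v k n) \<longlonglongrightarrow> w n"
  shows "sq_sum w \<le> liminf (\<lambda>k. sq_sum (v k))"
proof -
  have "ennreal ((cmod (w n))\<^sup>2) = liminf (\<lambda>k. ennreal ((cmod (v k n))\<^sup>2))" for n
    by (rule lim_imp_Liminf[symmetric]) (auto intro!: tendsto_intros tendsto_ennrealI assms)
  then have "sq_sum w = (\<integral>\<^sup>+n. liminf (\<lambda>k. ennreal ((cmod (v k n))\<^sup>2)) \<partial>count_space UNIV)"
    by (simp add: sq_sum_def nn_integral_count_space_nat)
  also have "\<dots> \<le> liminf (\<lambda>k. \<integral>\<^sup>+n. ennreal ((cmod (v k n))\<^sup>2) \<partial>count_space UNIV)"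
    by (rule nn_integral_liminf) simp
  finally show ?thesis by (simp add: sq_sum_def nn_integral_count_space_nat)
qed

text \<open>Quasi-invariance is kept out because in the converse it is deduced from operators that
  already act on \<open>D\<close>.\<close>

locale section_space =
  fixes \<mu> :: "bseq measure" and \<nu> :: "bseq \<Rightarrow> enat"
begin

abbreviation "L2 \<equiv> L2_sections \<mu> \<nu>"
abbreviation "D \<equiv> direct_integral \<mu> \<nu>"
abbreviation "cls \<equiv> ae_class \<mu> \<nu>"

lemma section_fibre: "measurable_section \<mu> \<nu> f \<Longrightarrow> f x \<in> pts (fibre \<nu> x)"
  by (simp add: measurable_section_def)

lemma section_coord: "measurable_section \<mu> \<nu> f \<Longrightarrow> (\<lambda>x. f x n) \<in> borel_measurable \<mu>"
  by (simp add: measurable_section_def)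

lemma L2_section: "f \<in> L2 \<Longrightarrow> measurable_section \<mu> \<nu> f"
  by (simp add: L2_sections_def)

lemmas L2_fibre = section_fibre[OF L2_section]
lemmas L2_coord = section_coord[OF L2_section]

lemma section_sq_sum:
  "measurable_section \<mu> \<nu> f \<Longrightarrow> sq_sum (f x) = ennreal ((vnorm (fibre \<nu> x) (f x))\<^sup>2)"
  by (rule sq_sum_vnorm) (rule section_fibre)

lemma section_sq_measurable:
  assumes "measurable_section \<mu> \<nu> f"
  shows "(\<lambda>x. (vnorm (fibre \<nu> x) (f x))\<^sup>2) \<in> borel_measurable \<mu>"
proof -
  have [measurable]: "(\<lambda>x. f x n) \<in> borel_measurable \<mu>" for n by (rule section_coord[OF assms])
  show ?thesis unfolding vnorm_model_sq[OF section_fibre[OF assms]] by measurable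
qed

lemma L2_iff:
  "f \<in> L2 \<longleftrightarrow> measurable_section \<mu> \<nu> f \<and> (\<integral>\<^sup>+x. sq_sum (f x) \<partial>\<mu>) < \<infinity>"
proof (cases "measurable_section \<mu> \<nu> f")
  case True
  then show ?thesis
    by (auto simp: L2_sections_def section_sq_sum[OF True] integrable_iff_bounded
        section_sq_measurable[OF True])
qed (simp add: L2_sections_def)

lemma L2_add:
  assumes f: "f \<in> L2" and g: "g \<in> L2"
  shows "(\<lambda>x n. f x n + g x n) \<in> L2"
proof -
  note [measurable] = L2_coord[OF f] L2_coord[OF g]
  have in_V: "(\<lambda>n. f x n + g x n) \<in> pts (fibre \<nu> x)" for x
    using model.add_closed[OF L2_fibre[OF f] L2_fibre[OF g]] by simp
  have sec: "measurable_section \<mu> \<nu> (\<lambda>x n. f x n + g x n)"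
    unfolding measurable_section_def using in_V by auto
  have "integrable \<mu> (\<lambda>x. (vnorm (fibre \<nu> x) (\<lambda>n. f x n + g x n))\<^sup>2)"
  proof (rule Bochner_Integration.integrable_bound)
    show "integrable \<mu> (\<lambda>x. 2 * (vnorm (fibre \<nu> x) (f x))\<^sup>2 + 2 * (vnorm (fibre \<nu> x) (g x))\<^sup>2)"
      using f g by (auto simp: L2_sections_def)
    show "(\<lambda>x. (vnorm (fibre \<nu> x) (\<lambda>n. f x n + g x n))\<^sup>2) \<in> borel_measurable \<mu>"
      by (rule section_sq_measurable[OF sec])
    have "(vnorm (fibre \<nu> x) (\<lambda>n. f x n + g x n))\<^sup>2
        \<le> 2 * (vnorm (fibre \<nu> x) (f x))\<^sup>2 + 2 * (vnorm (fibre \<nu> x) (g x))\<^sup>2" for x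
    proof -
      let ?a = "vnorm (fibre \<nu> x) (f x)" and ?b = "vnorm (fibre \<nu> x) (g x)"
      have "vnorm (fibre \<nu> x) (\<lambda>n. f x n + g x n) \<le> ?a + ?b"
        using model.vnorm_triangle[OF L2_fibre[OF f] L2_fibre[OF g]] by simp
      then have "(vnorm (fibre \<nu> x) (\<lambda>n. f x n + g x n))\<^sup>2 \<le> (?a + ?b)\<^sup>2"
        using in_V by (intro power_mono) auto
      then show ?thesis using zero_le_power2[of "?a - ?b"] by (simp add: power2_sum power2_diff)
    qed
    then show "AE x in \<mu>. norm ((vnorm (fibre \<nu> x) (\<lambda>n. f x n + g x n))\<^sup>2)
        \<le> norm (2 * (vnorm (fibre \<nu> x) (f x))\<^sup>2 + 2 * (vnorm (fibre \<nu> x) (g x))\<^sup>2)" by simp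
  qed
  then show ?thesis using sec by (simp add: L2_sections_def)
qed

lemma L2_mult:
  assumes f: "f \<in> L2" and phi[measurable]: "\<phi> \<in> borel_measurable \<mu>" and B: "\<And>x. cmod (\<phi> x) \<le> B"
  shows "(\<lambda>x n. \<phi> x * f x n) \<in> L2"
proof -
  note [measurable] = L2_coord[OF f]
  have in_V: "(\<lambda>n. \<phi> x * f x n) \<in> pts (fibre \<nu> x)" for x
    using model.smul_closed[OF L2_fibre[OF f]] by simp
  have sec: "measurable_section \<mu> \<nu> (\<lambda>x n. \<phi> x * f x n)"
    unfolding measurable_section_def using in_V by auto
  have nrm: "vnorm (fibre \<nu> x) (\<lambda>n. \<phi> x * f x n) = cmod (\<phi> x) * vnorm (fibre \<nu> x) (f x)" for x
    using model.vnorm_smul[OF L2_fibre[OF f]] by simp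
  have "integrable \<mu> (\<lambda>x. (vnorm (fibre \<nu> x) (\<lambda>n. \<phi> x * f x n))\<^sup>2)"
  proof (rule Bochner_Integration.integrable_bound)
    show "integrable \<mu> (\<lambda>x. B\<^sup>2 * (vnorm (fibre \<nu> x) (f x))\<^sup>2)"
      using f by (auto simp: L2_sections_def)
    show "(\<lambda>x. (vnorm (fibre \<nu> x) (\<lambda>n. \<phi> x * f x n))\<^sup>2) \<in> borel_measurable \<mu>"
      by (rule section_sq_measurable[OF sec])
    show "AE x in \<mu>. norm ((vnorm (fibre \<nu> x) (\<lambda>n. \<phi> x * f x n))\<^sup>2)
        \<le> norm (B\<^sup>2 * (vnorm (fibre \<nu> x) (f x))\<^sup>2)"
      unfolding nrm power_mult_distrib by (auto intro!: AE_I2 mult_right_mono power_mono B)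
  qed
  then show ?thesis using sec by (simp add: L2_sections_def)
qed

lemma L2_smul: "f \<in> L2 \<Longrightarrow> (\<lambda>x n. a * f x n) \<in> L2"
  by (rule L2_mult[of f "\<lambda>_. a" "cmod a"]) auto

lemma L2_zero: "(\<lambda>x n. 0) \<in> L2"
  by (simp add: L2_iff measurable_section_def in_model sq_sum_def)

lemma L2_diff: "\<lbrakk>f \<in> L2; g \<in> L2\<rbrakk> \<Longrightarrow> (\<lambda>x n. f x n - g x n) \<in> L2"
  using L2_add[OF _ L2_smul[of g "-1"], of f] by simp

lemma ip_measurable:
  assumes "measurable_section \<mu> \<nu> f" "measurable_section \<mu> \<nu> g"
  shows "(\<lambda>x. ip (fibre \<nu> x) (f x) (g x)) \<in> borel_measurable \<mu>"
proof -
  note [measurable] = section_coord[OF assms(1)] section_coord[OF assms(2)]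
  show ?thesis unfolding ip_model by measurable
qed

lemma ip_integrable:
  assumes f: "f \<in> L2" and g: "g \<in> L2"
  shows "integrable \<mu> (\<lambda>x. ip (fibre \<nu> x) (f x) (g x))"
proof (rule Bochner_Integration.integrable_bound)
  show "integrable \<mu> (\<lambda>x. (vnorm (fibre \<nu> x) (f x))\<^sup>2 + (vnorm (fibre \<nu> x) (g x))\<^sup>2)"
    using f g by (auto simp: L2_sections_def)
  show "(\<lambda>x. ip (fibre \<nu> x) (f x) (g x)) \<in> borel_measurable \<mu>"
    by (intro ip_measurable L2_section f g)
  have "cmod (ip (fibre \<nu> x) (f x) (g x)) \<le> (vnorm (fibre \<nu> x) (f x))\<^sup>2 + (vnorm (fibre \<nu> x) (g x))\<^sup>2" for x
  proof -
    let ?a = "vnorm (fibre \<nu> x) (f x)" and ?b = "vnorm (fibre \<nu> x) (g x)"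
    have "cmod (ip (fibre \<nu> x) (f x) (g x)) \<le> ?a * ?b"
      by (intro model.cauchy_schwarz L2_fibre f g)
    moreover have "0 \<le> ?a * ?b" by (simp add: L2_fibre f g)
    ultimately show ?thesis using zero_le_power2[of "?a - ?b"] unfolding power2_diff by linarith
  qed
  then show "AE x in \<mu>. norm (ip (fibre \<nu> x) (f x) (g x))
      \<le> norm ((vnorm (fibre \<nu> x) (f x))\<^sup>2 + (vnorm (fibre \<nu> x) (g x))\<^sup>2)" by simp
qed

lemma in_cls: "g \<in> cls h \<longleftrightarrow> g \<in> L2 \<and> (AE x in \<mu>. g x = h x)"
  by (simp add: ae_class_def)

lemma cls_cong: "AE x in \<mu>. h x = h' x \<Longrightarrow> cls h = cls h'"
  unfolding ae_class_def by (auto elim: eventually_mono simp: eventually_conj_iff[symmetric])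

lemma cls_self: "f \<in> L2 \<Longrightarrow> f \<in> cls f"
  by (simp add: in_cls)

lemma cls_eq_iff: "f \<in> L2 \<Longrightarrow> cls f = cls g \<longleftrightarrow> (AE x in \<mu>. f x = g x)"
  using in_cls[of f g] cls_self[of f] cls_cong[of f g] by metis

lemma cls_in_D [simp]: "f \<in> L2 \<Longrightarrow> cls f \<in> pts D"
  by (simp add: direct_integral_def)

lemma rep_cls:
  assumes "f \<in> L2" shows "rep (cls f) \<in> L2" "AE x in \<mu>. rep (cls f) x = f x"
proof -
  have "rep (cls f) \<in> cls f" using cls_self[OF assms] unfolding rep_def some_in_eq by blast
  then show "rep (cls f) \<in> L2" "AE x in \<mu>. rep (cls f) x = f x" by (auto simp: in_cls)
qed

lemma rep_D:
  assumes "F \<in> pts D" shows "rep F \<in> L2" "cls (rep F) = F"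
proof -
  obtain f where f: "f \<in> L2" "F = cls f" using assms by (auto simp: direct_integral_def)
  then show "rep F \<in> L2" using rep_cls by simp
  show "cls (rep F) = F" unfolding f(2) by (rule cls_cong) (rule rep_cls(2)[OF f(1)])
qed

text \<open>Operations on classes are unions over representatives; a formula that respects equality
  almost everywhere makes all members of the union equal.\<close>

lemma UN_cls:
  assumes "f \<in> L2" and "\<And>g. g \<in> L2 \<Longrightarrow> AE x in \<mu>. g x = f x \<Longrightarrow> AE x in \<mu>. \<Psi> g x = \<Psi> f x"
  shows "(\<Union>g\<in>cls f. cls (\<Psi> g)) = cls (\<Psi> f)"
proof -
  have "cls (\<Psi> g) = cls (\<Psi> f)" if "g \<in> cls f" for g
    using that assms(2)[of g] by (intro cls_cong) (simp add: in_cls)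
  then show ?thesis using cls_self[OF assms(1)] by blast
qed

lemma D_smul: assumes f: "f \<in> L2" shows "smul D a (cls f) = cls (\<lambda>x n. a * f x n)"
proof -
  have "smul D a (cls f) = (\<Union>g\<in>cls f. cls ((\<lambda>g x n. a * g x n) g))"
    by (simp add: direct_integral_def)
  also have "\<dots> = cls (\<lambda>x n. a * f x n)"
    by (rule UN_cls[OF f]) (auto elim: eventually_mono)
  finally show ?thesis .
qed

lemma D_add:
  assumes f: "f \<in> L2" and g: "g \<in> L2"
  shows "vadd D (cls f) (cls g) = cls (\<lambda>x n. f x n + g x n)"
proof -
  have "(\<Union>g'\<in>cls g. cls (\<lambda>x n. f' x n + g' x n)) = cls (\<lambda>x n. f' x n + g x n)" for f'
    by (rule UN_cls[OF g, of "\<lambda>g x n. f' x n + g x n"]) (auto elim: eventually_mono)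
  then have "vadd D (cls f) (cls g) = (\<Union>f'\<in>cls f. cls (\<lambda>x n. f' x n + g x n))"
    by (simp add: direct_integral_def)
  also have "\<dots> = cls (\<lambda>x n. f x n + g x n)"
    by (rule UN_cls[OF f, of "\<lambda>f x n. f x n + g x n"]) (auto elim: eventually_mono)
  finally show ?thesis .
qed

lemma D_zero: "vzero D = cls (\<lambda>x n. 0)"
  by (simp add: direct_integral_def)

lemma D_minus: "f \<in> L2 \<Longrightarrow> vminus D (cls f) = cls (\<lambda>x n. - f x n)"
  by (simp add: vminus_def D_smul)

lemma D_ip:
  assumes f: "f \<in> L2" and g: "g \<in> L2"
  shows "ip D (cls f) (cls g) = (\<integral>x. ip (fibre \<nu> x) (f x) (g x) \<partial>\<mu>)"
proof -
  have "ip D (cls f) (cls g) =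
      (\<integral>x. ip (fibre \<nu> x) (rep (cls f) x) (rep (cls g) x) \<partial>\<mu>)"
    by (simp add: direct_integral_def)
  also have "\<dots> = (\<integral>x. ip (fibre \<nu> x) (f x) (g x) \<partial>\<mu>)"
  proof (rule integral_cong_AE)
    show "AE x in \<mu>. ip (fibre \<nu> x) (rep (cls f) x) (rep (cls g) x) = ip (fibre \<nu> x) (f x) (g x)"
      using rep_cls(2)[OF f] rep_cls(2)[OF g] by eventually_elim simp
  qed (intro ip_measurable L2_section f g rep_cls)+
  finally show ?thesis .
qed

lemma D_norm:
  assumes f: "f \<in> L2"
  shows "Re (ip D (cls f) (cls f)) = (\<integral>x. (vnorm (fibre \<nu> x) (f x))\<^sup>2 \<partial>\<mu>)"
    "ennreal (Re (ip D (cls f) (cls f))) = (\<integral>\<^sup>+x. sq_sum (f x) \<partial>\<mu>)"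
proof -
  have "Re (ip D (cls f) (cls f)) = (\<integral>x. Re (ip (fibre \<nu> x) (f x) (f x)) \<partial>\<mu>)"
    unfolding D_ip[OF f f] by (rule integral_Re[symmetric]) (rule ip_integrable[OF f f])
  then show 1: "Re (ip D (cls f) (cls f)) = (\<integral>x. (vnorm (fibre \<nu> x) (f x))\<^sup>2 \<partial>\<mu>)"
    by (simp only: model.vnorm_sq[OF L2_fibre[OF f]])
  show "ennreal (Re (ip D (cls f) (cls f))) = (\<integral>\<^sup>+x. sq_sum (f x) \<partial>\<mu>)"
    unfolding 1 section_sq_sum[OF L2_section[OF f]]
    using f by (intro nn_integral_eq_integral[symmetric]) (auto simp: L2_sections_def)
qed

lemma D_cases:
  assumes "F \<in> pts D"
  obtains f where "f \<in> L2" "F = cls f"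
  using rep_D[OF assms] by metis

lemma D_inner: "complex_inner_space D"
proof
  fix F G K a b
  show "vzero D \<in> pts D" by (simp add: D_zero L2_zero)
  assume "F \<in> pts D" then obtain f where f [simp]: "f \<in> L2" and F: "F = cls f" by (rule D_cases)
  note [simp] = L2_smul L2_add L2_zero D_smul D_add D_minus D_zero
  have [simp]: "(\<lambda>x n. - f x n) \<in> L2" using L2_smul[OF f, of "-1"] by simp
  show "smul D a F \<in> pts D" by (simp add: F)
  show "vadd D F (vzero D) = F" by (simp add: F)
  show "vadd D F (vminus D F) = vzero D" by (simp add: F)
  show "smul D (a + b) F = vadd D (smul D a F) (smul D b F)" by (simp add: F distrib_right)
  show "smul D a (smul D b F) = smul D (a * b) F" by (simp add: F mult.assoc)
  show "smul D 1 F = F" by (simp add: F)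
  show "0 \<le> Re (ip D F F)" unfolding F D_norm(1)[OF f] by simp
  show "F = vzero D" if z: "ip D F F = 0"
  proof -
    have "(\<integral>\<^sup>+x. sq_sum (f x) \<partial>\<mu>) = 0" using D_norm(2)[OF f] z by (simp add: F)
    moreover have "(\<lambda>x. sq_sum (f x)) \<in> borel_measurable \<mu>"
      by (rule measurable_sq_sum) (rule L2_coord[OF f])
    ultimately have "AE x in \<mu>. sq_sum (f x) = 0" by (simp add: nn_integral_0_iff_AE)
    then have "AE x in \<mu>. f x = (\<lambda>n. 0)"
    proof (rule eventually_mono)
      fix x assume "sq_sum (f x) = 0"
      then have "(vnorm (fibre \<nu> x) (f x))\<^sup>2 = 0"
        using sq_sum_vnorm[OF L2_fibre[OF f, of x]] by simp
      then show "f x = (\<lambda>n. 0)" using model.vnorm_eq_0[OF L2_fibre[OF f]] by simp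
    qed
    then show ?thesis unfolding F D_zero by (rule cls_cong)
  qed
  assume "G \<in> pts D" then obtain g where g [simp]: "g \<in> L2" and G: "G = cls g" by (rule D_cases)
  show "vadd D F G \<in> pts D" by (simp add: F G)
  show "vadd D F G = vadd D G F" by (simp add: F G add.commute)
  show "smul D a (vadd D F G) = vadd D (smul D a F) (smul D a G)" by (simp add: F G distrib_left)
  show "ip D (smul D a F) G = a * ip D F G"
    using model.ip_smul[OF L2_fibre[OF f] L2_fibre[OF g]]
    by (simp add: F G D_ip)
  show "ip D G F = cnj (ip D F G)"
  proof -
    have "ip D G F = (\<integral>x. cnj (ip (fibre \<nu> x) (f x) (g x)) \<partial>\<mu>)"
      unfolding F G D_ip[OF g f]
      by (intro Bochner_Integration.integral_cong model.ip_cnj[OF L2_fibre[OF f] L2_fibre[OF g]] refl)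
    then show ?thesis by (simp add: F G D_ip)
  qed
  assume "K \<in> pts D" then obtain k where k [simp]: "k \<in> L2" and K: "K = cls k" by (rule D_cases)
  show "vadd D (vadd D F G) K = vadd D F (vadd D G K)" by (simp add: F G K add.assoc)
  show "ip D (vadd D F G) K = ip D F K + ip D G K"
    using model.ip_add[OF L2_fibre[OF f] L2_fibre[OF g] L2_fibre[OF k]]
    by (simp add: F G K D_ip ip_integrable)
qed

lemma D_vdist:
  assumes f: "f \<in> L2" and g: "g \<in> L2"
  shows "ennreal ((vdist D (cls f) (cls g))\<^sup>2) = (\<integral>\<^sup>+x. sq_sum (\<lambda>n. f x n - g x n) \<partial>\<mu>)"
proof -
  interpret D: complex_inner_space D by (rule D_inner)
  have "vadd D (cls f) (vminus D (cls g)) = cls (\<lambda>x n. f x n - g x n)"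
    using f g L2_smul[OF g, of "-1"] by (simp add: D_minus D_add)
  then have "(vdist D (cls f) (cls g))\<^sup>2 =
      Re (ip D (cls (\<lambda>x n. f x n - g x n)) (cls (\<lambda>x n. f x n - g x n)))"
    by (simp add: vdist_def D.vnorm_sq L2_diff f g)
  then show ?thesis using D_norm(2)[OF L2_diff[OF f g]] by simp
qed

text \<open>The pointwise step of the Riesz-Fischer theorem. The weight \<open>3^k\<close> leaves
  the summable bound \<open>(1/3)^k\<close> for the integrals, and where the weighted series is
  finite it bounds the increments of each coordinate by a multiple of \<open>sqrt (1/3) ^ k\<close>,
  so that they telescope to a limit.\<close>

lemma fast_cauchy_AE_convergent:
  assumes f: "\<And>k. f k \<in> L2"
    and fast: "\<And>k. (\<integral>\<^sup>+x. sq_sum (\<lambda>n. f k x n - f (Suc k) x n) \<partial>\<mu>) \<le> ennreal ((1/9)^k)"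
  shows "AE x in \<mu>. \<forall>n. convergent (\<lambda>k. f k x n)"
proof -
  define a where "a k x = sq_sum (\<lambda>n. f k x n - f (Suc k) x n)" for k x
  note [measurable] = L2_coord[OF f]
  have [measurable]: "a k \<in> borel_measurable \<mu>" for k
    unfolding a_def by (rule measurable_sq_sum) measurable
  have "(\<integral>\<^sup>+x. (\<Sum>k. ennreal (3^k) * a k x) \<partial>\<mu>) = (\<Sum>k. ennreal (3^k) * (\<integral>\<^sup>+x. a k x \<partial>\<mu>))"
    by (simp add: nn_integral_suminf nn_integral_cmult)
  also have "\<dots> \<le> (\<Sum>k. ennreal ((1/3)^k))"
  proof (rule suminf_le)
    fix k
    have "ennreal (3^k) * (\<integral>\<^sup>+x. a k x \<partial>\<mu>) \<le> ennreal (3^k) * ennreal ((1/9)^k)"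
      unfolding a_def by (intro mult_left_mono fast) simp
    also have "\<dots> = ennreal ((1/3)^k)"
      by (simp add: ennreal_mult[symmetric] power_mult_distrib[symmetric])
    finally show "ennreal (3^k) * (\<integral>\<^sup>+x. a k x \<partial>\<mu>) \<le> ennreal ((1/3)^k)" .
  qed auto
  also have "\<dots> = ennreal (\<Sum>k. (1/3)^k)"
    by (rule suminf_ennreal2) (auto intro: summable_geometric)
  also have "\<dots> < \<infinity>" by simp
  finally have "AE x in \<mu>. (\<Sum>k. ennreal (3^k) * a k x) \<noteq> \<infinity>"
    by (intro nn_integral_PInf_AE) auto
  then show ?thesis
  proof (rule eventually_mono, intro allI)
    fix x n assume fin: "(\<Sum>k. ennreal (3^k) * a k x) \<noteq> \<infinity>"
    then obtain C where C: "(\<Sum>k. ennreal (3^k) * a k x) = ennreal C" "C \<ge> 0"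
      by (cases "\<Sum>k. ennreal (3^k) * a k x") auto
    have "3^k * (cmod (f k x n - f (Suc k) x n))\<^sup>2 \<le> C" for k
    proof -
      have "ennreal ((cmod (f k x n - f (Suc k) x n))\<^sup>2) \<le> a k x"
        unfolding a_def sq_sum_def by (rule ennreal_le_suminf)
      then have "ennreal (3^k) * ennreal ((cmod (f k x n - f (Suc k) x n))\<^sup>2) \<le> ennreal (3^k) * a k x"
        by (intro mult_left_mono) auto
      also have "\<dots> \<le> (\<Sum>k. ennreal (3^k) * a k x)"
        by (rule ennreal_le_suminf)
      finally show ?thesis using C by (simp add: ennreal_mult[symmetric])
    qed
    then have bound: "cmod (f (Suc k) x n - f k x n) \<le> sqrt C * sqrt (1/3) ^ k" for k
    proof -
      have "(cmod (f (Suc k) x n - f k x n))\<^sup>2 \<le> C * (1/3)^k"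
        using \<open>3^k * (cmod (f k x n - f (Suc k) x n))\<^sup>2 \<le> C\<close>
        by (simp add: norm_minus_commute field_simps power_divide)
      also have "\<dots> = (sqrt C * sqrt (1/3) ^ k)\<^sup>2"
      proof -
        have "(sqrt (1/3) ^ k)\<^sup>2 = ((sqrt (1/3))\<^sup>2) ^ k" by (simp only: power_mult[symmetric] mult.commute)
        then show ?thesis using C(2) by (simp add: power_mult_distrib)
      qed
      finally show ?thesis by (rule power2_le_imp_le) (use C(2) in simp)
    qed
    have "summable (\<lambda>k. sqrt C * sqrt (1/3) ^ k)"
      by (intro summable_mult summable_geometric) (simp add: real_sqrt_lt_1_iff)
    then have "summable (\<lambda>k. f (Suc k) x n - f k x n)"
      by (rule summable_comparison_test') (rule bound)
    then have "(\<lambda>K. \<Sum>k<K. f (Suc k) x n - f k x n) \<longlonglongrightarrow> (\<Sum>k. f (Suc k) x n - f k x n)"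
      by (rule summable_LIMSEQ)
    then have "(\<lambda>K. f K x n - f 0 x n) \<longlonglongrightarrow> (\<Sum>k. f (Suc k) x n - f k x n)"
      unfolding sum_lessThan_telescope[of "\<lambda>k. f k x n"] .
    then have "(\<lambda>K. (f K x n - f 0 x n) + f 0 x n) \<longlonglongrightarrow> (\<Sum>k. f (Suc k) x n - f k x n) + f 0 x n"
      by (intro tendsto_intros)
    then show "convergent (\<lambda>k. f k x n)" by (auto simp: convergent_def)
  qed
qed

theorem D_hilbert: "complex_hilbert_space D"
proof (intro complex_hilbert_space.intro complex_hilbert_space_axioms.intro D_inner)
  interpret D: complex_inner_space D by (rule D_inner)
  fix s :: "nat \<Rightarrow> bfield set"
  assume s: "\<forall>n. s n \<in> pts D"
    and cau: "\<forall>e>0. \<exists>N. \<forall>m\<ge>N. \<forall>n\<ge>N. vdist D (s m) (s n) < e"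
  define f where "f n = rep (s n)" for n
  have f: "f n \<in> L2" and cls_f: "cls (f n) = s n" for n using rep_D s by (auto simp: f_def)
  note [measurable] = L2_coord[OF f]
  have near: "(\<integral>\<^sup>+x. sq_sum (\<lambda>j. f m x j - f n x j) \<partial>\<mu>) = ennreal ((vdist D (s m) (s n))\<^sup>2)" for m n
    using D_vdist[OF f f] by (simp add: cls_f)
  obtain N :: "nat \<Rightarrow> nat" where N: "\<And>k m n. m \<ge> N k \<Longrightarrow> n \<ge> N k \<Longrightarrow> vdist D (s m) (s n) < (1/3)^k"
  proof -
    have "\<forall>k. \<exists>N. \<forall>m\<ge>N. \<forall>n\<ge>N. vdist D (s m) (s n) < (1/3)^k" using cau by simp
    then show ?thesis using that by metis
  qed
  \<comment> \<open>A sum serves as running maximum, so that \<open>r k\<close> and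
    \<open>r (Suc k)\<close> both lie beyond \<open>N k\<close>; the summand \<open>k\<close> makes
    \<open>r\<close> unbounded, as \<open>fatou\<close> needs.\<close>
  define r where "r k = (\<Sum>j\<le>k. N j) + k" for k
  have r_ge: "r k \<ge> N k" "r k \<ge> k" "r (Suc k) \<ge> N k" for k
    unfolding r_def using member_le_sum[of k "{..k}" N] member_le_sum[of k "{..Suc k}" N] by auto
  have "AE x in \<mu>. \<forall>n. convergent (\<lambda>k. f (r k) x n)"
  proof (rule fast_cauchy_AE_convergent)
    fix k
    have "vdist D (s (r k)) (s (r (Suc k))) < (1/3)^k" by (rule N) (rule r_ge)+
    then have "(vdist D (s (r k)) (s (r (Suc k))))\<^sup>2 \<le> ((1/3)^k)\<^sup>2"
      using s by (intro power_mono) auto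
    also have "\<dots> = (1/9)^k" by (simp add: power2_eq_square flip: power_mult_distrib)
    finally show "(\<integral>\<^sup>+x. sq_sum (\<lambda>n. f (r k) x n - f (r (Suc k)) x n) \<partial>\<mu>) \<le> ennreal ((1/9)^k)"
      unfolding near by (rule ennreal_leI)
  qed (rule f)
  define g where "g x n = lim (\<lambda>k. f (r k) x n)" for x n
  have g_lim: "AE x in \<mu>. \<forall>n. (\<lambda>k. f (r k) x n) \<longlonglongrightarrow> g x n"
    using \<open>AE x in \<mu>. \<forall>n. convergent (\<lambda>k. f (r k) x n)\<close>
    by (rule eventually_mono) (auto simp: g_def convergent_LIMSEQ_iff)
  have [measurable]: "(\<lambda>x. g x n) \<in> borel_measurable \<mu>" for n unfolding g_def by measurable
  have fatou: "(\<integral>\<^sup>+x. sq_sum (\<lambda>n. f m x n - g x n) \<partial>\<mu>) \<le> ennreal (e\<^sup>2)"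
    if e: "e > 0" and M: "\<forall>m\<ge>M. \<forall>n\<ge>M. vdist D (s m) (s n) < e" and m: "m \<ge> M" for e M m
  proof -
    have "(\<integral>\<^sup>+x. sq_sum (\<lambda>n. f m x n - g x n) \<partial>\<mu>)
        \<le> (\<integral>\<^sup>+x. liminf (\<lambda>k. sq_sum (\<lambda>n. f m x n - f (r k) x n)) \<partial>\<mu>)"
    proof (rule nn_integral_mono_AE, rule eventually_mono[OF g_lim])
      fix x assume "\<forall>n. (\<lambda>k. f (r k) x n) \<longlonglongrightarrow> g x n"
      then show "sq_sum (\<lambda>n. f m x n - g x n) \<le> liminf (\<lambda>k. sq_sum (\<lambda>n. f m x n - f (r k) x n))"
        by (intro sq_sum_liminf tendsto_intros) auto
    qed
    also have "\<dots> \<le> liminf (\<lambda>k. \<integral>\<^sup>+x. sq_sum (\<lambda>n. f m x n - f (r k) x n) \<partial>\<mu>)"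
      by (rule nn_integral_liminf) (rule measurable_sq_sum, measurable)
    also have "\<dots> \<le> liminf (\<lambda>k. ennreal (e\<^sup>2))"
    proof (rule Liminf_mono)
      show "\<forall>\<^sub>F k in sequentially. (\<integral>\<^sup>+x. sq_sum (\<lambda>n. f m x n - f (r k) x n) \<partial>\<mu>) \<le> ennreal (e\<^sup>2)"
        unfolding near
      proof (rule eventually_sequentiallyI[of M])
        fix k assume "k \<ge> M"
        then have "vdist D (s m) (s (r k)) < e" using M m r_ge(2)[of k] by auto
        then have "(vdist D (s m) (s (r k)))\<^sup>2 \<le> e\<^sup>2" using s by (intro power_mono) auto
        then show "ennreal ((vdist D (s m) (s (r k)))\<^sup>2) \<le> ennreal (e\<^sup>2)" by (rule ennreal_leI)
      qed
    qed
    also have "\<dots> = ennreal (e\<^sup>2)" by (simp add: Liminf_const)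
    finally show ?thesis .
  qed
  have fin: "AE x in \<mu>. sq_sum (g x) < \<infinity>"
  proof -
    obtain M where M: "\<forall>m\<ge>M. \<forall>n\<ge>M. vdist D (s m) (s n) < 1" using cau by (meson zero_less_one)
    have [measurable]: "(\<lambda>x. sq_sum (\<lambda>n. f M x n - g x n)) \<in> borel_measurable \<mu>"
      by (rule measurable_sq_sum) measurable
    have "(\<integral>\<^sup>+x. sq_sum (\<lambda>n. f M x n - g x n) \<partial>\<mu>) \<le> ennreal (1\<^sup>2)"
      by (rule fatou[OF _ M]) auto
    also have "\<dots> < \<infinity>" by simp
    finally have "AE x in \<mu>. sq_sum (\<lambda>n. f M x n - g x n) \<noteq> \<infinity>"
      by (intro nn_integral_PInf_AE) auto
    then show ?thesis
    proof (rule eventually_mono)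
      fix x assume "sq_sum (\<lambda>n. f M x n - g x n) \<noteq> \<infinity>"
      then have "summable (\<lambda>n. (cmod (f M x n - g x n))\<^sup>2)"
        by (intro sq_sum_finite) (simp add: less_top)
      then have "summable (\<lambda>n. (cmod (g x n - f M x n))\<^sup>2)" by (simp add: norm_minus_commute)
      then have "summable (\<lambda>n. (cmod ((g x n - f M x n) + f M x n))\<^sup>2)"
        using L2_fibre[OF f, of M x] by (intro l2_add_summable) (auto simp: in_model)
      then have "g x \<in> pts (model_space \<infinity>)" by (simp add: in_model)
      then show "sq_sum (g x) < \<infinity>" by (simp add: sq_sum_vnorm)
    qed
  qed
  \<comment> \<open>A section has to lie in its fibre at every point, so the limit is set to zero
    where it fails to. The condition on \<open>\<nu>\<close> is not known to be measurable;
    \<open>w_eq\<close> eliminates it outside the null set \<open>Z\<close>, on which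
    \<open>w\<close> is zero.\<close>
  define h where "h x = (if sq_sum (g x) < \<infinity> \<and> (\<forall>n. \<nu> x \<le> enat n \<longrightarrow> g x n = 0) then g x else (\<lambda>n. 0))" for x
  define h' where "h' x = (if sq_sum (g x) < \<infinity> then g x else (\<lambda>n. 0))" for x
  have supp: "h x = h' x" if "\<forall>n. (\<lambda>k. f (r k) x n) \<longlonglongrightarrow> g x n" for x
  proof -
    have "g x n = 0" if "\<nu> x \<le> enat n" for n
    proof -
      have "(\<lambda>k. f (r k) x n) = (\<lambda>k. 0)" using L2_fibre[OF f] that by (auto simp: in_model)
      then show ?thesis using \<open>\<forall>n. (\<lambda>k. f (r k) x n) \<longlonglongrightarrow> g x n\<close>[rule_format, of n]
        by (simp add: LIMSEQ_const_iff)
    qed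
    then show ?thesis by (auto simp: h_def h'_def)
  qed
  obtain Z where Z: "Z \<in> null_sets \<mu>" "{x \<in> space \<mu>. \<not> (\<forall>n. (\<lambda>k. f (r k) x n) \<longlonglongrightarrow> g x n)} \<subseteq> Z"
    using g_lim by (auto simp: eventually_ae_filter)
  define w where "w x = (if x \<in> Z \<or> x \<notin> space \<mu> then (\<lambda>n. 0) else h x)" for x
  have w_eq: "w x n = (if x \<in> Z then 0 else if sq_sum (g x) < \<infinity> then g x n else 0)" if "x \<in> space \<mu>" for x n
  proof (cases "x \<in> Z")
    case False
    then have "\<forall>n. (\<lambda>k. f (r k) x n) \<longlonglongrightarrow> g x n" using Z(2) that by blast
    then show ?thesis using supp[of x] that False by (simp add: w_def h'_def)
  qed (simp add: w_def)
  have [measurable]: "Z \<in> sets \<mu>" using Z by auto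
  have [measurable]: "(\<lambda>x. sq_sum (g x)) \<in> borel_measurable \<mu>"
    by (rule measurable_sq_sum) measurable
  have w_meas [measurable]: "(\<lambda>x. w x n) \<in> borel_measurable \<mu>" for n
  proof -
    have "(\<lambda>x. if x \<in> Z then 0 else if sq_sum (g x) < \<infinity> then g x n else 0) \<in> borel_measurable \<mu>"
      by measurable
    then show ?thesis by (subst measurable_cong[OF w_eq]) auto
  qed
  have wg: "AE x in \<mu>. w x = g x"
    using fin AE_not_in[OF Z(1)] AE_space by eventually_elim (auto simp: w_eq)
  have w_sec: "measurable_section \<mu> \<nu> w"
  proof -
    have "w x \<in> pts (fibre \<nu> x)" for x
      by (auto simp: w_def h_def in_model sq_sum_finite)
    then show ?thesis by (simp add: measurable_section_def w_meas)
  qed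
  have fw: "(\<integral>\<^sup>+x. sq_sum (\<lambda>n. f m x n - w x n) \<partial>\<mu>) = (\<integral>\<^sup>+x. sq_sum (\<lambda>n. f m x n - g x n) \<partial>\<mu>)" for m
    by (rule nn_integral_cong_AE) (use wg in \<open>auto elim: eventually_mono\<close>)
  have w: "w \<in> L2"
  proof -
    obtain M where M: "\<forall>m\<ge>M. \<forall>n\<ge>M. vdist D (s m) (s n) < 1" using cau by (meson zero_less_one)
    have d_in: "(\<lambda>n. f M x n - w x n) \<in> pts (fibre \<nu> x)" for x
      by (intro model_diff_in L2_fibre[OF f] section_fibre[OF w_sec])
    have "measurable_section \<mu> \<nu> (\<lambda>x n. f M x n - w x n)"
      unfolding measurable_section_def using d_in by auto
    moreover have "(\<integral>\<^sup>+x. sq_sum (\<lambda>n. f M x n - w x n) \<partial>\<mu>) \<le> ennreal (1\<^sup>2)"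
      unfolding fw by (rule fatou[OF _ M]) auto
    then have "(\<integral>\<^sup>+x. sq_sum (\<lambda>n. f M x n - w x n) \<partial>\<mu>) < \<infinity>"
      by (rule le_less_trans) simp
    ultimately have "(\<lambda>x n. f M x n - w x n) \<in> L2" by (simp add: L2_iff)
    from L2_diff[OF f[of M] this] show ?thesis by simp
  qed
  have "(\<lambda>n. vdist D (s n) (cls w)) \<longlonglongrightarrow> 0"
  proof (rule LIMSEQ_I)
    fix e :: real assume e: "e > 0"
    then obtain M where M: "\<forall>m\<ge>M. \<forall>n\<ge>M. vdist D (s m) (s n) < e / 2"
      using cau by (meson half_gt_zero)
    have "norm (vdist D (s m) (cls w) - 0) < e" if "m \<ge> M" for m
    proof -
      have "ennreal ((vdist D (s m) (cls w))\<^sup>2) \<le> ennreal ((e / 2)\<^sup>2)"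
        using D_vdist[OF f w, of m] fw[of m] fatou[OF _ M that] e by (simp add: cls_f)
      then have "(vdist D (s m) (cls w))\<^sup>2 \<le> (e / 2)\<^sup>2"
        by (subst (asm) ennreal_le_iff) auto
      then have "vdist D (s m) (cls w) \<le> e / 2"
        by (rule power2_le_imp_le) (use e in simp)
      then show ?thesis using e s w by simp
    qed
    then show "\<exists>no. \<forall>n\<ge>no. norm (vdist D (s n) (cls w) - 0) < e" by blast
  qed
  then show "\<exists>v\<in>pts D. (\<lambda>n. vdist D (s n) v) \<longlonglongrightarrow> 0" using w by (intro bexI[of _ "cls w"]) auto
qed

end

section \<open>From triples to spinor structures\<close>

lemma bplus_cancel [simp]: "x \<oplus> d \<oplus> d = x"
  by (auto simp: bplus_def)

lemma bplus_swap: "x \<oplus> a \<oplus> b = x \<oplus> b \<oplus> a"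
  by (auto simp: bplus_def)

lemma delta_in_Delta [simp]: "delta k \<in> Delta"
  by (simp add: Delta_def delta_def)

section \<open>Radon-Nikodym derivatives of the translates\<close>

locale quasi_inv_measure =
  fixes \<mu> :: "bseq measure"
  assumes sets_mu: "sets \<mu> = sets borel"
    and sigma_finite_mu: "sigma_finite_measure \<mu>"
    and quasi_invariant_mu: "quasi_invariant \<mu>"
begin

interpretation sf: sigma_finite_measure \<mu> by (rule sigma_finite_mu)

lemma space_mu [simp]: "space \<mu> = UNIV"
  using sets_eq_imp_space_eq[OF sets_mu] by simp

lemma measurable_mu: "measurable \<mu> M = measurable borel M"
  by (rule measurable_cong_sets[OF sets_mu refl])

lemma shift_measurable: "(\<lambda>x. x \<oplus> d) \<in> measurable \<mu> \<mu>"
  using measurable_bplus[of d] measurable_cong_sets[OF sets_mu sets_mu] by blast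

lemma measurable_shift: "f \<in> measurable \<mu> M \<Longrightarrow> (\<lambda>x. f (x \<oplus> d)) \<in> measurable \<mu> M"
  by (rule measurable_compose[OF shift_measurable])

lemma sets_translate: "sets (translate \<mu> d) = sets \<mu>"
  by (simp add: translate_def sets_mu)

lemma translate_eq: "A \<in> sets \<mu> \<Longrightarrow> emeasure (translate \<mu> d) A = emeasure \<mu> {x. x \<oplus> d \<in> A}"
  using shift_measurable[of d] measurable_cong_sets[OF refl sets_mu, of \<mu>]
  by (simp add: translate_def emeasure_distr sets_mu vimage_def)

lemma translate_ac:
  assumes "d \<in> Delta"
  shows "absolutely_continuous \<mu> (translate \<mu> d)" "absolutely_continuous (translate \<mu> d) \<mu>"
  using quasi_invariant_mu assms by (auto simp: quasi_invariant_def)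

lemma AE_shift:
  assumes d: "d \<in> Delta" and P: "AE x in \<mu>. P x"
  shows "AE x in \<mu>. P (x \<oplus> d)"
proof -
  obtain N where N: "N \<in> null_sets \<mu>" "{x. \<not> P x} \<subseteq> N"
    using P by (auto simp: eventually_ae_filter)
  then have "N \<in> null_sets (translate \<mu> d)"
    using translate_ac(1)[OF d] by (auto simp: absolutely_continuous_def)
  then have "emeasure \<mu> {x. x \<oplus> d \<in> N} = 0" using N(1) by (simp add: translate_eq null_sets_def)
  moreover have "{x. x \<oplus> d \<in> N} \<in> sets \<mu>"
    using measurable_sets[OF shift_measurable, of N d] N(1) by (auto simp: vimage_def)
  ultimately have "{x. x \<oplus> d \<in> N} \<in> null_sets \<mu>" by auto
  then show ?thesis by (rule AE_I') (use N(2) in auto)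
qed

text \<open>Finiteness of the derivative in \<open>rho_finite\<close> rests on this.\<close>

lemma sigma_finite_translate: "sigma_finite_measure (translate \<mu> d)"
proof -
  obtain A :: "nat \<Rightarrow> bseq set" where A: "range A \<subseteq> sets \<mu>" "(\<Union>i. A i) = space \<mu>"
      "\<And>i. emeasure \<mu> (A i) \<noteq> \<infinity>"
    by (rule sf.sigma_finite) auto
  define B where "B i = {x. x \<oplus> d \<in> A i}" for i
  have B: "B i \<in> sets \<mu>" for i
    using measurable_sets[OF shift_measurable, of "A i" d] A(1) by (auto simp: vimage_def B_def)
  have "emeasure (translate \<mu> d) (B i) = emeasure \<mu> (A i)" for i
    using B by (simp add: translate_eq) (simp add: B_def)
  moreover have "(\<Union>i. B i) = UNIV" using A(2) by (auto simp: B_def)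
  ultimately show ?thesis
    using A(3) B by (intro sigma_finite_measure.intro exI[of _ "range B"])
      (auto simp: sets_translate, simp add: translate_def)
qed

abbreviation "rho k \<equiv> RN_deriv \<mu> (translate \<mu> (delta k))"

lemma rho_density: "density \<mu> (rho k) = translate \<mu> (delta k)"
  by (rule sf.density_RN_deriv) (auto simp: translate_ac sets_translate)

lemma nn_integral_shift:
  assumes "g \<in> borel_measurable \<mu>"
  shows "(\<integral>\<^sup>+x. rho k x * g x \<partial>\<mu>) = (\<integral>\<^sup>+x. g (x \<oplus> delta k) \<partial>\<mu>)"
proof -
  have T: "(\<lambda>x. x \<oplus> delta k) \<in> measurable \<mu> borel"
    using measurable_bplus by (simp only: measurable_cong_sets[OF sets_mu refl])
  have "g \<in> borel_measurable borel"
    using assms by (simp only: measurable_cong_sets[OF sets_mu refl])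
  then have g: "g \<in> borel_measurable (distr \<mu> borel (\<lambda>x. x \<oplus> delta k))"
    by (simp only: measurable_distr_eq1)
  have "(\<integral>\<^sup>+x. rho k x * g x \<partial>\<mu>) = integral\<^sup>N (density \<mu> (rho k)) g"
    by (rule nn_integral_density[symmetric]) (use assms in measurable)
  then show ?thesis
    unfolding rho_density unfolding translate_def nn_integral_distr[OF T g] .
qed

lemma rho_finite: "AE x in \<mu>. rho k x < \<infinity>"
proof -
  have "AE x in \<mu>. rho k x \<noteq> \<infinity>"
    by (rule sf.RN_deriv_finite) (auto simp: translate_ac sets_translate sigma_finite_translate)
  then show ?thesis by (rule eventually_mono) (simp add: less_top)
qed

lemma density_eq_imp_AE:
  assumes "f \<in> borel_measurable \<mu>" "g \<in> borel_measurable \<mu>"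
    and "\<And>A. A \<in> sets \<mu> \<Longrightarrow> (\<integral>\<^sup>+x. f x * indicator A x \<partial>\<mu>) = (\<integral>\<^sup>+x. g x * indicator A x \<partial>\<mu>)"
  shows "AE x in \<mu>. f x = g x"
proof -
  have "density \<mu> f = density \<mu> g"
    by (rule measure_eqI) (auto simp: emeasure_density assms)
  then show ?thesis by (rule sf.density_unique[OF assms(1,2)])
qed

text \<open>The product is the density of a double translate. The right-hand side is symmetric in
  \<open>k\<close> and \<open>l\<close> and collapses for \<open>k = l\<close>, which gives
  \<open>rho_cocycle\<close> and \<open>rho_inverse\<close> by uniqueness of densities.\<close>

lemma rho_rho_integral:
  assumes [measurable]: "A \<in> sets \<mu>"
  shows "(\<integral>\<^sup>+x. rho k x * rho l (x \<oplus> delta k) * indicator A x \<partial>\<mu>) =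
    (\<integral>\<^sup>+x. indicator A (x \<oplus> delta k \<oplus> delta l) \<partial>\<mu>)"
proof -
  note [measurable] = measurable_shift[of "rho l" borel "delta k"]
    measurable_shift[of "indicator A :: _ \<Rightarrow> ennreal" borel "delta k"]
  have "(\<integral>\<^sup>+x. rho k x * (rho l (x \<oplus> delta k) * indicator A x) \<partial>\<mu>) =
      (\<integral>\<^sup>+x. rho l (x \<oplus> delta k \<oplus> delta k) * indicator A (x \<oplus> delta k) \<partial>\<mu>)"
    by (rule nn_integral_shift) measurable
  moreover have "(\<integral>\<^sup>+x. rho l x * indicator A (x \<oplus> delta k) \<partial>\<mu>) =
      (\<integral>\<^sup>+x. indicator A (x \<oplus> delta l \<oplus> delta k) \<partial>\<mu>)"
    by (rule nn_integral_shift) measurable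
  ultimately show ?thesis
    unfolding bplus_cancel bplus_swap[of _ "delta l" "delta k"] by (simp only: mult.assoc)
qed

lemma rho_cocycle: "AE x in \<mu>. rho k x * rho l (x \<oplus> delta k) = rho l x * rho k (x \<oplus> delta l)"
proof (rule density_eq_imp_AE)
  note [measurable] = measurable_shift[of "rho l" borel "delta k"]
    measurable_shift[of "rho k" borel "delta l"]
  show "(\<lambda>x. rho k x * rho l (x \<oplus> delta k)) \<in> borel_measurable \<mu>"
    "(\<lambda>x. rho l x * rho k (x \<oplus> delta l)) \<in> borel_measurable \<mu>" by measurable
qed (simp only: rho_rho_integral bplus_swap)

lemma rho_inverse: "AE x in \<mu>. rho k x * rho k (x \<oplus> delta k) = 1"
proof (rule density_eq_imp_AE)
  note [measurable] = measurable_shift[of "rho k" borel "delta k"]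
  show "(\<lambda>x. rho k x * rho k (x \<oplus> delta k)) \<in> borel_measurable \<mu>" by measurable
qed (simp_all add: rho_rho_integral)

abbreviation "tau \<equiv> translation_factor \<mu>"

lemma tau_measurable: "tau k \<in> borel_measurable \<mu>"
  unfolding translation_factor_def by measurable

lemma tau_cocycle: "AE x in \<mu>. tau k x * tau l (x \<oplus> delta k) = tau l x * tau k (x \<oplus> delta l)"
  using rho_cocycle[of k l]
  by (rule eventually_mono)
    (simp add: translation_factor_def flip: of_real_mult real_sqrt_mult enn2real_mult)

lemma tau_inverse: "AE x in \<mu>. tau k x * tau k (x \<oplus> delta k) = 1"
  using rho_inverse[of k]
  by (rule eventually_mono)
    (simp add: translation_factor_def flip: of_real_mult real_sqrt_mult enn2real_mult)

lemma tau_sq: "AE x in \<mu>. ennreal ((cmod (tau k x))\<^sup>2) = rho k x"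
  using rho_finite[of k] by (rule eventually_mono) (simp add: translation_factor_def)

end

definition par :: "bseq \<Rightarrow> nat \<Rightarrow> complex" where
  "par x k = (- 1) ^ (\<Sum>j<k. of_bool (x j))"

lemma par_0 [simp]: "par x 0 = 1" by (simp add: par_def)

lemma par_Suc: "par x (Suc k) = par x k * (if x k then - 1 else 1)"
  by (simp add: par_def)

text \<open>The signs in the anticommutation relations come from this asymmetry between
  \<open>l < k\<close> and \<open>k \<le> l\<close>.\<close>

lemma par_shift: "par (x \<oplus> delta l) k = (if l < k then - par x k else par x k)"
proof (induction k)
  case (Suc k)
  then show ?case by (cases "l = k") (auto simp: par_Suc bplus_def delta_def less_Suc_eq)
qed simp

lemma par_sq: "par x k * par x k = 1"
  by (induction k) (auto simp: par_Suc algebra_simps)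

lemma i_par_sq: "\<i> * par x k * (\<i> * par x k) = - 1"
proof -
  have "\<i> * par x k * (\<i> * par x k) = (\<i> * \<i>) * (par x k * par x k)" by (simp only: mult_ac)
  then show ?thesis by (simp add: par_sq)
qed

lemma cmod_par: "cmod (par x k) = 1"
  by (induction k) (auto simp: par_Suc norm_mult)

lemma coord_measurable: "Measurable.pred borel (\<lambda>x::bseq. x k)"
proof -
  have "continuous_on UNIV (\<lambda>x::bseq. x k)" by (rule continuous_on_product_coordinates)
  then have "(\<lambda>x::bseq. x k) \<in> borel_measurable borel" by (rule borel_measurable_continuous_onI)
  moreover have "sets (borel :: bool measure) = sets (count_space UNIV)"
    by (rule sets_borel_eq_count_space)
  ultimately show ?thesis using measurable_cong_sets by blast
qed

lemma par_measurable: "(\<lambda>x. par x k) \<in> borel_measurable borel"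
proof (induction k)
  case (Suc k)
  note [measurable] = coord_measurable Suc
  show ?case unfolding par_Suc by measurable
qed simp

section \<open>Translation operators of a triple with an arbitrary phase\<close>

context gw_triple
begin

sublocale section_space \<mu> \<nu> .

sublocale quasi_inv_measure \<mu>
  by (intro quasi_inv_measure.intro borel_sets sigma_finite quasi_inv)

text \<open>\<open>gw_J\<close> and \<open>gw_J'\<close> differ only in their phases. With the phase
  \<open>\<phi>\<close> as a parameter, each relation is proved once and becomes a condition on
  phases.\<close>

definition raw :: "(bseq \<Rightarrow> complex) \<Rightarrow> nat \<Rightarrow> bfield \<Rightarrow> bfield" where
  "raw \<phi> k f x = smul (fibre \<nu> x) (\<phi> x)
     (c k x (smul (fibre \<nu> x) (tau k x) (f (x \<oplus> delta k))))"

definition gw_op :: "(bseq \<Rightarrow> complex) \<Rightarrow> nat \<Rightarrow> bfield set \<Rightarrow> bfield set" where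
  "gw_op \<phi> k F = (\<Union>f\<in>F. cls (raw \<phi> k f))"

definition unimodular :: "(bseq \<Rightarrow> complex) \<Rightarrow> bool" where
  "unimodular \<phi> \<longleftrightarrow> \<phi> \<in> borel_measurable \<mu> \<and> (\<forall>x. cmod (\<phi> x) = 1)"

lemma fibre_shift: "AE x in \<mu>. fibre \<nu> (x \<oplus> delta k) = fibre \<nu> x"
  by (rule nu_invariant) simp

lemma fibre_shift2: "AE x in \<mu>. fibre \<nu> (x \<oplus> delta k \<oplus> delta l) = fibre \<nu> x"
  using AE_shift[OF delta_in_Delta fibre_shift[of l], of k] fibre_shift[of k]
  by eventually_elim simp

lemma c_in: "v \<in> pts (fibre \<nu> x) \<Longrightarrow> c k x v \<in> pts (fibre \<nu> x)"
  using c_unitary[of x k] unfolding unitary_map_def clinear_map_def by blast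

lemma c_add: "\<lbrakk>v \<in> pts (fibre \<nu> x); w \<in> pts (fibre \<nu> x)\<rbrakk> \<Longrightarrow>
    c k x (\<lambda>n. v n + w n) = (\<lambda>n. c k x v n + c k x w n)"
  using c_unitary[of x k] unfolding unitary_map_def clinear_map_def model_simps by blast

lemma c_smul: "v \<in> pts (fibre \<nu> x) \<Longrightarrow> c k x (\<lambda>n. a * v n) = (\<lambda>n. a * c k x v n)"
  using c_unitary[of x k] unfolding unitary_map_def clinear_map_def model_simps by blast

lemma c_ip: "\<lbrakk>v \<in> pts (fibre \<nu> x); w \<in> pts (fibre \<nu> x)\<rbrakk> \<Longrightarrow>
    ip (fibre \<nu> x) (c k x v) (c k x w) = ip (fibre \<nu> x) v w"
  using c_unitary[of x k] unfolding unitary_map_def by blast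

lemma smul_in: "v \<in> pts (model_space d) \<Longrightarrow> (\<lambda>n. a * v n) \<in> pts (model_space d)"
  using model.smul_closed[of v d a] by simp

lemma raw_eq:
  assumes "f (x \<oplus> delta k) \<in> pts (fibre \<nu> x)"
  shows "raw \<phi> k f x = (\<lambda>n. \<phi> x * tau k x * c k x (f (x \<oplus> delta k)) n)"
  unfolding raw_def model_simps by (subst c_smul[OF assms]) (simp add: mult.assoc)

lemma L2_shift_fibre: "f \<in> L2 \<Longrightarrow> AE x in \<mu>. f (x \<oplus> delta k) \<in> pts (fibre \<nu> x)"
  using fibre_shift[of k] L2_fibre[of f] by (elim eventually_mono) metis

text \<open>The adjoint of a unitary operator is its inverse; \<open>c_adjoint\<close> identifies it
  with the operator at the translated point.\<close>

lemma c_involution: "AE x in \<mu>. \<forall>v\<in>pts (fibre \<nu> x). c k x (c k (x \<oplus> delta k) v) = v"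
  using c_adjoint[of k] fibre_shift[of k]
proof eventually_elim
  case (elim x)
  let ?d = "x \<oplus> delta k"
  have fib: "pts (fibre \<nu> ?d) = pts (fibre \<nu> x)" "ip (fibre \<nu> ?d) = ip (fibre \<nu> x)"
    using elim(2) by simp_all
  have in_V: "c k ?d v \<in> pts (fibre \<nu> x)" if "v \<in> pts (fibre \<nu> x)" for v
    using c_in[of v ?d k] that fib by simp
  show ?case
  proof
    fix v assume v: "v \<in> pts (fibre \<nu> x)"
    show "c k x (c k ?d v) = v"
    proof (rule model.eq_by_ip[of _ "\<nu> x"])
      fix w assume w: "w \<in> pts (fibre \<nu> x)"
      have "ip (fibre \<nu> x) (c k x (c k ?d v)) w = ip (fibre \<nu> x) (c k ?d v) (c k ?d w)"
        using elim(1) in_V[OF v] w unfolding is_adjoint_def fib by blast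
      also have "\<dots> = ip (fibre \<nu> x) v w" using c_ip[of v ?d w k] v w fib by simp
      finally show "ip (fibre \<nu> x) (c k x (c k ?d v)) w = ip (fibre \<nu> x) v w" .
    qed (use v in_V c_in in auto)
  qed
qed

text \<open>\<open>raw \<phi> k f\<close> need not be a section, as on a null set
  \<open>f (x \<oplus> delta k)\<close> may leave the fibre at \<open>x\<close>; hence the detour
  through \<open>g\<close>. The norm survives because \<open>tau\<close> is a square root of the
  density of the translate and \<open>c k x\<close> is unitary.\<close>

lemma raw_L2:
  assumes f: "f \<in> L2" and phi: "unimodular \<phi>"
  shows "\<exists>g\<in>L2. (AE x in \<mu>. g x = raw \<phi> k f x) \<and>
    (\<integral>\<^sup>+x. sq_sum (g x) \<partial>\<mu>) = (\<integral>\<^sup>+x. sq_sum (f x) \<partial>\<mu>)"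
proof -
  have [measurable]: "\<phi> \<in> borel_measurable \<mu>" and phi1: "cmod (\<phi> x) = 1" for x
    using phi by (auto simp: unimodular_def)
  obtain N where N: "N \<in> null_sets \<mu>" "{x. fibre \<nu> (x \<oplus> delta k) \<noteq> fibre \<nu> x} \<subseteq> N"
    using fibre_shift[of k] by (auto simp: eventually_ae_filter)
  have [measurable]: "N \<in> sets \<mu>" using N by auto
  note [measurable] = tau_measurable measurable_shift[OF L2_coord[OF f]]
  \<comment> \<open>Cut off before \<open>c k x\<close> is applied, since
    \<open>c_measurable\<close> speaks about sections only.\<close>
  define h where "h x = (if x \<in> N then (\<lambda>n. 0) else (\<lambda>n. tau k x * f (x \<oplus> delta k) n))" for x
  have h_sec: "measurable_section \<mu> \<nu> h"
    unfolding measurable_section_def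
  proof (intro conjI allI)
    fix x
    have "f (x \<oplus> delta k) \<in> pts (fibre \<nu> x)" if "x \<notin> N"
      using L2_fibre[OF f, of "x \<oplus> delta k"] N(2) that by (metis (mono_tags, lifting) mem_Collect_eq subsetD)
    then show "h x \<in> pts (fibre \<nu> x)"
      using smul_in model.zero_closed[of "\<nu> x"] by (simp add: h_def)
  next
    fix n
    have "(\<lambda>x. if x \<in> N then 0 else tau k x * f (x \<oplus> delta k) n) \<in> borel_measurable \<mu>"
      by measurable
    moreover have "(\<lambda>x. h x n) = (\<lambda>x. if x \<in> N then 0 else tau k x * f (x \<oplus> delta k) n)"
      by (auto simp: h_def)
    ultimately show "(\<lambda>x. h x n) \<in> borel_measurable \<mu>" by simp
  qed
  have ch_sec: "measurable_section \<mu> \<nu> (\<lambda>x. c k x (h x))" by (rule c_measurable[OF h_sec])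
  define g where "g x = (\<lambda>n. \<phi> x * c k x (h x) n)" for x
  note [measurable] = section_coord[OF ch_sec]
  have g_sec: "measurable_section \<mu> \<nu> g"
    unfolding measurable_section_def g_def using smul_in section_fibre[OF ch_sec] by auto
  have g_raw: "AE x in \<mu>. g x = raw \<phi> k f x"
    using AE_not_in[OF N(1)] by (rule eventually_mono) (simp add: g_def h_def raw_def)
  have norm_g: "sq_sum (g x) = sq_sum (h x)" for x
  proof -
    have "vnorm (fibre \<nu> x) (g x) = vnorm (fibre \<nu> x) (c k x (h x))"
      using model.vnorm_smul[OF section_fibre[OF ch_sec], of x "\<phi> x"] by (simp add: g_def phi1)
    also have "\<dots> = vnorm (fibre \<nu> x) (h x)"
      using c_ip[OF section_fibre[OF h_sec] section_fibre[OF h_sec]] by (simp add: vnorm_def)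
    finally show ?thesis using section_sq_sum[OF g_sec] section_sq_sum[OF h_sec] by simp
  qed
  have "(\<integral>\<^sup>+x. sq_sum (g x) \<partial>\<mu>) = (\<integral>\<^sup>+x. rho k x * sq_sum (f (x \<oplus> delta k)) \<partial>\<mu>)"
    unfolding norm_g
  proof (rule nn_integral_cong_AE)
    show "AE x in \<mu>. sq_sum (h x) = rho k x * sq_sum (f (x \<oplus> delta k))"
      using AE_not_in[OF N(1)] tau_sq[of k]
    proof eventually_elim
      case (elim x)
      have "sq_sum (h x) = ennreal ((cmod (tau k x))\<^sup>2) * sq_sum (f (x \<oplus> delta k))"
        using elim(1) by (simp add: h_def sq_sum_def norm_mult power_mult_distrib ennreal_mult)
      then show ?case using elim(2) by simp
    qed
  qed
  also have "\<dots> = (\<integral>\<^sup>+x. sq_sum (f x) \<partial>\<mu>)"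
    using measurable_shift[OF measurable_sq_sum[OF L2_coord[OF f]]] by (subst nn_integral_shift) auto
  finally have nn: "(\<integral>\<^sup>+x. sq_sum (g x) \<partial>\<mu>) = (\<integral>\<^sup>+x. sq_sum (f x) \<partial>\<mu>)" .
  then have "g \<in> L2" using f g_sec by (simp add: L2_iff)
  then show ?thesis using g_raw nn by blast
qed

lemma gw_op_cls:
  assumes "f \<in> L2" shows "gw_op \<phi> k (cls f) = cls (raw \<phi> k f)"
  unfolding gw_op_def
proof (rule UN_cls[OF assms])
  fix g assume "g \<in> L2" "AE x in \<mu>. g x = f x"
  then have "AE x in \<mu>. g (x \<oplus> delta k) = f (x \<oplus> delta k)" by (intro AE_shift) auto
  then show "AE x in \<mu>. raw \<phi> k g x = raw \<phi> k f x"
    by (rule eventually_mono) (simp add: raw_def)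
qed

lemma gw_op_rep:
  assumes "f \<in> L2" "unimodular \<phi>"
  obtains g where "g \<in> L2" "AE x in \<mu>. g x = raw \<phi> k f x" "gw_op \<phi> k (cls f) = cls g"
    "vnorm D (cls g) = vnorm D (cls f)"
proof -
  obtain g where g: "g \<in> L2" "AE x in \<mu>. g x = raw \<phi> k f x"
      "(\<integral>\<^sup>+x. sq_sum (g x) \<partial>\<mu>) = (\<integral>\<^sup>+x. sq_sum (f x) \<partial>\<mu>)"
    using raw_L2[OF assms, of k] by blast
  interpret D: complex_inner_space D by (rule D_inner)
  have "gw_op \<phi> k (cls f) = cls g"
    unfolding gw_op_cls[OF assms(1)] using g(2) by (intro cls_cong) (auto elim: eventually_mono)
  moreover have "vnorm D (cls g) = vnorm D (cls f)"
  proof -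
    have "ennreal (Re (ip D (cls g) (cls g))) = ennreal (Re (ip D (cls f) (cls f)))"
      unfolding D_norm(2)[OF g(1)] D_norm(2)[OF assms(1)] by (rule g(3))
    then show ?thesis
      using D.ip_nonneg[of "cls g"] D.ip_nonneg[of "cls f"] assms(1) g(1) by (simp add: vnorm_def)
  qed
  ultimately show ?thesis using that g by blast
qed

lemma gw_op_linear:
  assumes phi: "unimodular \<phi>" shows "clinear_map D D (gw_op \<phi> k)"
  unfolding clinear_map_def
proof (intro conjI ballI allI)
  fix F assume "F \<in> pts D"
  then obtain f where f: "f \<in> L2" "F = cls f" by (rule D_cases)
  obtain g where g: "g \<in> L2" "AE x in \<mu>. g x = raw \<phi> k f x" "gw_op \<phi> k (cls f) = cls g"
    using gw_op_rep[OF f(1) phi] by metis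
  then show "gw_op \<phi> k F \<in> pts D" using f by simp
  fix a
  have "gw_op \<phi> k (smul D a F) = cls (raw \<phi> k (\<lambda>x n. a * f x n))"
    using f by (simp add: D_smul gw_op_cls L2_smul)
  also have "\<dots> = cls (\<lambda>x n. a * g x n)"
  proof (rule cls_cong)
    show "AE x in \<mu>. raw \<phi> k (\<lambda>x n. a * f x n) x = (\<lambda>n. a * g x n)"
      using g(2) L2_shift_fibre[OF f(1), of k]
      by eventually_elim (simp add: raw_eq c_smul smul_in algebra_simps)
  qed
  also have "\<dots> = smul D a (gw_op \<phi> k F)" using f g by (simp add: D_smul)
  finally show "gw_op \<phi> k (smul D a F) = smul D a (gw_op \<phi> k F)" .
next
  fix F F' assume "F \<in> pts D" "F' \<in> pts D"
  then obtain f f' where f: "f \<in> L2" "F = cls f" and f': "f' \<in> L2" "F' = cls f'"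
    by (metis D_cases)
  obtain g where g: "g \<in> L2" "AE x in \<mu>. g x = raw \<phi> k f x" "gw_op \<phi> k (cls f) = cls g"
    using gw_op_rep[OF f(1) phi] by metis
  obtain g' where g': "g' \<in> L2" "AE x in \<mu>. g' x = raw \<phi> k f' x" "gw_op \<phi> k (cls f') = cls g'"
    using gw_op_rep[OF f'(1) phi] by metis
  have "gw_op \<phi> k (vadd D F F') = cls (raw \<phi> k (\<lambda>x n. f x n + f' x n))"
    using f f' by (simp add: D_add gw_op_cls L2_add)
  also have "\<dots> = cls (\<lambda>x n. g x n + g' x n)"
  proof (rule cls_cong)
    show "AE x in \<mu>. raw \<phi> k (\<lambda>x n. f x n + f' x n) x = (\<lambda>n. g x n + g' x n)"
      using g(2) g'(2) L2_shift_fibre[OF f(1), of k] L2_shift_fibre[OF f'(1), of k]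
    proof eventually_elim
      case (elim x)
      then show ?case using model.add_closed[OF elim(3,4)]
        by (simp add: raw_eq c_add distrib_left)
    qed
  qed
  also have "\<dots> = vadd D (gw_op \<phi> k F) (gw_op \<phi> k F')" using f f' g g' by (simp add: D_add)
  finally show "gw_op \<phi> k (vadd D F F') = vadd D (gw_op \<phi> k F) (gw_op \<phi> k F')" .
qed

lemma gw_op_comp:
  assumes f: "f \<in> L2" and psi: "unimodular \<psi>"
  shows "gw_op \<phi> k (gw_op \<psi> l (cls f)) = cls (\<lambda>x n. \<phi> x * \<psi> (x \<oplus> delta k) *
    (tau k x * tau l (x \<oplus> delta k)) * c k x (c l (x \<oplus> delta k) (f (x \<oplus> delta k \<oplus> delta l))) n)"
proof -
  obtain g where g: "g \<in> L2" "AE x in \<mu>. g x = raw \<psi> l f x" "gw_op \<psi> l (cls f) = cls g"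
    using gw_op_rep[OF f psi] by metis
  show ?thesis unfolding g(3) gw_op_cls[OF g(1)]
  proof (rule cls_cong)
    show "AE x in \<mu>. raw \<phi> k g x = (\<lambda>n. \<phi> x * \<psi> (x \<oplus> delta k) *
        (tau k x * tau l (x \<oplus> delta k)) * c k x (c l (x \<oplus> delta k) (f (x \<oplus> delta k \<oplus> delta l))) n)"
      using AE_shift[OF delta_in_Delta g(2), of k] L2_shift_fibre[OF g(1), of k] fibre_shift[of k]
        AE_shift[OF delta_in_Delta L2_shift_fibre[OF f, of l], of k]
    proof eventually_elim
      case (elim x)
      let ?d = "x \<oplus> delta k"
      have fib: "pts (fibre \<nu> ?d) = pts (fibre \<nu> x)" using elim(3) by simp
      have "c l ?d (f (?d \<oplus> delta l)) \<in> pts (fibre \<nu> x)"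
        using c_in[OF elim(4)] fib by simp
      then show ?case
        unfolding raw_eq[of g, OF elim(2)] elim(1) raw_eq[of f, OF elim(4)]
        by (subst c_smul) (auto simp: algebra_simps)
    qed
  qed
qed

text \<open>By \<open>tau_cocycle\<close> and \<open>c_commute\<close> the weighted translations
  commute apart from their phases, so the phases alone decide the sign.\<close>

lemma gw_op_anticommute:
  assumes "unimodular \<phi>" "unimodular \<psi>"
    and sign: "\<And>x. \<phi> x * \<psi> (x \<oplus> delta k) = - (\<psi> x * \<phi> (x \<oplus> delta l))"
  shows "anticommute D (gw_op \<phi> k) (gw_op \<psi> l)"
  unfolding anticommute_def
proof
  fix F assume "F \<in> pts D"
  then obtain f where f: "f \<in> L2" and F: "F = cls f" by (rule D_cases)
  obtain g where g: "g \<in> L2" "gw_op \<phi> k (cls f) = cls g"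
    using gw_op_rep[OF f assms(1)] by metis
  obtain h where h: "h \<in> L2" "gw_op \<psi> l (cls g) = cls h"
    using gw_op_rep[OF g(1) assms(2)] by metis
  have h_eq: "cls h = cls (\<lambda>x n. \<psi> x * \<phi> (x \<oplus> delta l) *
      (tau l x * tau k (x \<oplus> delta l)) * c l x (c k (x \<oplus> delta l) (f (x \<oplus> delta l \<oplus> delta k))) n)"
    using gw_op_comp[OF f assms(1), of \<psi> l k] g h by simp
  have "gw_op \<phi> k (gw_op \<psi> l F) = cls (\<lambda>x n. - h x n)"
    unfolding F gw_op_comp[OF f assms(2)]
  proof (rule cls_cong)
    show "AE x in \<mu>. (\<lambda>n. \<phi> x * \<psi> (x \<oplus> delta k) * (tau k x * tau l (x \<oplus> delta k)) *
        c k x (c l (x \<oplus> delta k) (f (x \<oplus> delta k \<oplus> delta l))) n) = (\<lambda>n. - h x n)"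
      using h_eq[unfolded cls_eq_iff[OF h(1)]] tau_cocycle[of k l] c_commute[of k l] fibre_shift2[of k l]
    proof eventually_elim
      case (elim x)
      have "f (x \<oplus> delta k \<oplus> delta l) \<in> pts (fibre \<nu> x)"
        using L2_fibre[OF f, of "x \<oplus> delta k \<oplus> delta l"] elim(4) by simp
      then show ?case
        unfolding elim(1,2) using elim(3) sign[of x] by (simp add: bplus_swap[of x "delta l" "delta k"])
    qed
  qed
  also have "\<dots> = vminus D (gw_op \<psi> l (gw_op \<phi> k F))" unfolding F g(2) h(2) D_minus[OF h(1)] ..
  finally show "gw_op \<phi> k (gw_op \<psi> l F) = vminus D (gw_op \<psi> l (gw_op \<phi> k F))" .
qed

lemma gw_op_structure:
  assumes phi: "unimodular \<phi>" and sign: "\<And>x. \<phi> x * \<phi> (x \<oplus> delta k) = - 1"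
  shows "orthogonal_complex_structure D (gw_op \<phi> k)"
  unfolding orthogonal_complex_structure_def
proof (intro conjI ballI gw_op_linear[OF phi])
  fix F assume "F \<in> pts D"
  then obtain f where f: "f \<in> L2" and F: "F = cls f" by (rule D_cases)
  show "vnorm D (gw_op \<phi> k F) = vnorm D F"
    using gw_op_rep[OF f phi] F by metis
  have "gw_op \<phi> k (gw_op \<phi> k F) = cls (\<lambda>x n. - f x n)"
    unfolding F gw_op_comp[OF f phi]
  proof (rule cls_cong)
    show "AE x in \<mu>. (\<lambda>n. \<phi> x * \<phi> (x \<oplus> delta k) * (tau k x * tau k (x \<oplus> delta k)) *
        c k x (c k (x \<oplus> delta k) (f (x \<oplus> delta k \<oplus> delta k))) n) = (\<lambda>n. - f x n)"
      using tau_inverse[of k] c_involution[of k]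
      by eventually_elim (simp add: sign L2_fibre[OF f])
  qed
  then show "gw_op \<phi> k (gw_op \<phi> k F) = vminus D F" by (simp add: F D_minus[OF f])
qed

definition sgn_fun :: "nat \<Rightarrow> bseq \<Rightarrow> complex" where
  "sgn_fun n x = (if even n then - \<i> * par x (n div 2) else par x (Suc (n div 2)))"

lemma interleave_gw:
  "interleave (gw_J \<mu> \<nu> c) (gw_J' \<mu> \<nu> c) n = gw_op (sgn_fun n) (n div 2)"
proof
  fix F
  show "interleave (gw_J \<mu> \<nu> c) (gw_J' \<mu> \<nu> c) n F = gw_op (sgn_fun n) (n div 2) F"
    unfolding interleave_def gw_op_def raw_def[abs_def]
    by (cases "even n")
      (simp_all only: sgn_fun_def gw_J_def gw_J'_def par_def lessThan_Suc_atMost if_True if_False simp_thms)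
qed

lemma sgn_unimodular: "unimodular (sgn_fun n)"
proof -
  have [measurable]: "(\<lambda>x. par x k) \<in> borel_measurable \<mu>" for k
    using par_measurable measurable_mu by blast
  show ?thesis
    unfolding unimodular_def sgn_fun_def
    by (cases "even n") (auto simp: norm_mult cmod_par)
qed

theorem gw_spinor_structure:
  "complex_spinor_structure D (interleave (gw_J \<mu> \<nu> c) (gw_J' \<mu> \<nu> c))"
  unfolding complex_spinor_structure_def interleave_gw
proof (intro conjI allI impI D_hilbert)
  show "orthogonal_complex_structure D (gw_op (sgn_fun n) (n div 2))" for n
    by (rule gw_op_structure[OF sgn_unimodular])
      (auto simp: sgn_fun_def par_shift par_sq i_par_sq)
  fix m n :: nat assume mn: "m \<noteq> n"
  \<comment> \<open>Equal halves mean \<open>J k\<close> against \<open>J' k\<close>, where both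
    phases belong to the same translation.\<close>
  have "even m \<noteq> even n" if "m div 2 = n div 2" using mn that by (metis dvd_mult_div_cancel odd_two_times_div_two_succ)
  then show "anticommute D (gw_op (sgn_fun m) (m div 2)) (gw_op (sgn_fun n) (n div 2))"
    by (intro gw_op_anticommute sgn_unimodular)
      (cases "m div 2" "n div 2" rule: linorder_cases; auto simp: sgn_fun_def par_shift)
qed

end

section \<open>Measures on binary sequences\<close>

text \<open>Makes Borel measurability of maps into \<open>bseq\<close> a matter of single
  coordinates, as used in \<open>sets_borel_cylinders\<close>.\<close>

instance bool :: second_countable_topology
proof
  have "open = generate_topology (UNIV :: bool set set)"
    by (auto simp: fun_eq_iff open_discrete intro: generate_topology.Basis)
  then show "\<exists>B::bool set set. countable B \<and> open = generate_topology B"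
    by (intro exI[of _ UNIV]) simp
qed

section \<open>Cylinders as a generator of the Borel sets\<close>

definition cyl :: "nat \<Rightarrow> bseq \<Rightarrow> bseq set" where
  "cyl n s = {x. \<forall>j<n. x j = s j}"

abbreviation "cylinders \<equiv> insert {} (range (\<lambda>(n, s). cyl n s))"

lemma cyl_0 [simp]: "cyl 0 s = UNIV" by (simp add: cyl_def)

lemma cyl_shift: "x \<oplus> d \<in> cyl n s \<longleftrightarrow> x \<in> cyl n (s \<oplus> d)"
  by (auto simp: cyl_def bplus_def)

lemma cyl_borel [measurable]: "cyl n s \<in> sets borel"
proof -
  note [measurable] = coord_measurable
  have "Measurable.pred borel (\<lambda>x. \<forall>j\<in>{..<n}. x j = s j)" by measurable
  then have "{x \<in> space borel. \<forall>j\<in>{..<n}. x j = s j} \<in> sets borel" by (rule predE)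
  moreover have "cyl n s = {x \<in> space borel. \<forall>j\<in>{..<n}. x j = s j}" by (auto simp: cyl_def)
  ultimately show ?thesis by simp
qed

lemma cylinders_Pow: "cylinders \<subseteq> Pow UNIV" by simp

lemma sets_borel_cylinders: "sets (borel :: bseq measure) = sigma_sets UNIV cylinders"
proof
  let ?S = "sigma (UNIV :: bseq set) cylinders"
  have sets_S: "sets ?S = sigma_sets UNIV cylinders" by (rule sets_measure_of) simp
  have cyl_S: "cyl n s \<in> sets ?S" for n s unfolding sets_S by (rule sigma_sets.Basic) auto
  have "(\<lambda>x::bseq. x) \<in> borel_measurable ?S"
  proof (rule measurable_coordinatewise_then_product)
    fix i
    \<comment> \<open>A finite union: one cylinder for each prefix of length \<open>Suc i\<close>
      ending in \<open>True\<close>.\<close>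
    have "{x::bseq. x i} = (\<Union>A\<in>{A\<in>Pow {..i}. i \<in> A}. cyl (Suc i) (\<lambda>j. j \<in> A))"
    proof (intro set_eqI iffI)
      fix x :: bseq assume "x \<in> {x. x i}"
      then show "x \<in> (\<Union>A\<in>{A\<in>Pow {..i}. i \<in> A}. cyl (Suc i) (\<lambda>j. j \<in> A))"
        by (intro UN_I[of "{j. j \<le> i \<and> x j}"]) (auto simp: cyl_def)
    qed (auto simp: cyl_def)
    also have "\<dots> \<in> sets ?S" by (intro sets.finite_UN cyl_S) auto
    finally have *: "{x::bseq. x i} \<in> sets ?S" .
    have "(\<lambda>x. x i) \<in> measurable ?S (count_space UNIV)"
      using * by (simp add: pred_def)
    moreover have "sets (borel :: bool measure) = sets (count_space UNIV)"
      by (rule sets_borel_eq_count_space)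
    ultimately show "(\<lambda>x. x i) \<in> borel_measurable ?S" using measurable_cong_sets by blast
  qed
  then show "sets (borel :: bseq measure) \<subseteq> sigma_sets UNIV cylinders"
    using measurable_sets[of "\<lambda>x::bseq. x" ?S borel] sets_S by auto
  show "sigma_sets UNIV cylinders \<subseteq> sets (borel :: bseq measure)"
  proof -
    have "cylinders \<subseteq> sets (borel :: bseq measure)" by auto
    then show ?thesis using sets.sigma_sets_subset[of cylinders "borel :: bseq measure"] by simp
  qed
qed

lemma cyl_Int: "n \<le> m \<Longrightarrow> cyl n s \<inter> cyl m t = (if t \<in> cyl n s then cyl m t else {})"
  by (auto simp: cyl_def)

lemma cylinders_Int: "Int_stable cylinders"
proof -
  have "cyl n s \<inter> cyl m t \<in> cylinders" for n m s t
  proof (cases "n \<le> m")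
    case True
    then show ?thesis by (auto simp: cyl_Int)
  next
    case False
    then have "cyl n s \<inter> cyl m t = (if s \<in> cyl m t then cyl n s else {})"
      using cyl_Int[of m n t s] by (auto simp: Int_commute)
    then show ?thesis by auto
  qed
  then show ?thesis by (auto simp: Int_stable_def)
qed

lemma measure_eq_by_cylinders:
  assumes "sets M = sets borel" "sets N = sets borel"
    and eq: "\<And>n s. emeasure M (cyl n s) = emeasure N (cyl n s)" and fin: "emeasure M UNIV \<noteq> \<infinity>"
  shows "M = N"
proof (rule measure_eqI_generator_eq[OF cylinders_Int cylinders_Pow])
  show "sets M = sigma_sets UNIV cylinders" "sets N = sigma_sets UNIV cylinders"
    using assms sets_borel_cylinders by auto
  show "range (\<lambda>_::nat. UNIV) \<subseteq> cylinders" using range_eqI[of UNIV "\<lambda>(n, s). cyl n s" "(0, undefined)"] by auto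
qed (use eq fin in auto)

text \<open>The positive and negative parts of \<open>f\<close> are densities of two finite measures
  that agree on cylinders, hence everywhere. Since \<open>ennreal\<close> sends negative numbers to
  0, \<open>ennreal (f x) = ennreal (- f x)\<close> forces \<open>f x = 0\<close>.\<close>

lemma real_eq_AE_by_cylinders:
  fixes f :: "bseq \<Rightarrow> real"
  assumes sets_M: "sets M = sets borel" and f: "integrable M f"
    and zero: "\<And>n s. (\<integral>x. indicator (cyl n s) x * f x \<partial>M) = 0"
  shows "AE x in M. f x = 0"
proof -
  have [measurable]: "f \<in> borel_measurable M" using f by auto
  have [measurable]: "cyl n s \<in> sets M" for n s by (simp add: sets_M)
  have fin: "(\<integral>\<^sup>+x. ennreal (f x) \<partial>M) < \<infinity>" "(\<integral>\<^sup>+x. ennreal (- f x) \<partial>M) < \<infinity>"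
    using f by (auto simp: real_integrable_def less_top)
  have eq: "density M (\<lambda>x. ennreal (f x)) = density M (\<lambda>x. ennreal (- f x))"
  proof (rule measure_eq_by_cylinders)
    show "emeasure (density M (\<lambda>x. ennreal (f x))) UNIV \<noteq> \<infinity>"
    proof -
      have "UNIV \<in> sets M" using sets_M by simp
      then show ?thesis using fin(1) by (simp add: emeasure_density)
    qed
    fix n s
    let ?C = "cyl n s"
    have int: "integrable M (\<lambda>x. indicator ?C x * f x)"
      using integrable_mult_indicator[OF _ f, of ?C] by simp
    have pos: "(\<integral>\<^sup>+x. ennreal (indicator ?C x * f x) \<partial>M) = (\<integral>\<^sup>+x. ennreal (f x) * indicator ?C x \<partial>M)"
      "(\<integral>\<^sup>+x. ennreal (- (indicator ?C x * f x)) \<partial>M) = (\<integral>\<^sup>+x. ennreal (- f x) * indicator ?C x \<partial>M)"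
      by (auto intro!: nn_integral_cong simp: indicator_def)
    have lt: "(\<integral>\<^sup>+x. ennreal (f x) * indicator ?C x \<partial>M) < \<infinity>"
      "(\<integral>\<^sup>+x. ennreal (- f x) * indicator ?C x \<partial>M) < \<infinity>"
      by (rule le_less_trans[OF nn_integral_mono fin(1)], simp add: indicator_def)
        (rule le_less_trans[OF nn_integral_mono fin(2)], simp add: indicator_def)
    have "enn2real (\<integral>\<^sup>+x. ennreal (f x) * indicator ?C x \<partial>M) =
        enn2real (\<integral>\<^sup>+x. ennreal (- f x) * indicator ?C x \<partial>M)"
      using real_lebesgue_integral_def[OF int] zero[of n s] unfolding pos by simp
    then have "(\<integral>\<^sup>+x. ennreal (f x) * indicator ?C x \<partial>M) =
        (\<integral>\<^sup>+x. ennreal (- f x) * indicator ?C x \<partial>M)"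
      using lt by (metis ennreal_enn2real infinity_ennreal_def)
    then show "emeasure (density M (\<lambda>x. ennreal (f x))) ?C =
        emeasure (density M (\<lambda>x. ennreal (- f x))) ?C"
      by (simp add: emeasure_density)
  qed (simp_all add: sets_M)
  have "AE x in M. ennreal (f x) = ennreal (- f x)"
    using eq fin(1) by (subst (asm) finite_density_unique) auto
  then show ?thesis
    by (rule eventually_mono) (smt (verit) ennreal_eq_0_iff ennreal_neg)
qed

lemma complex_eq_AE_by_cylinders:
  fixes f g :: "bseq \<Rightarrow> complex"
  assumes sets_M: "sets M = sets borel" and f: "integrable M f" and g: "integrable M g"
    and eq: "\<And>n s. (\<integral>x. indicator (cyl n s) x * f x \<partial>M) = (\<integral>x. indicator (cyl n s) x * g x \<partial>M)"
  shows "AE x in M. f x = g x"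
proof -
  have [measurable]: "f \<in> borel_measurable M" "g \<in> borel_measurable M" using f g by auto
  have int: "integrable M (\<lambda>x. indicator (cyl n s) x * h x)" if "integrable M h" for n s and h :: "bseq \<Rightarrow> complex"
  proof -
    have "integrable M (\<lambda>x. indicator (cyl n s) x *\<^sub>R h x)"
      by (rule integrable_mult_indicator[OF _ that]) (simp add: sets_M)
    moreover have "indicator (cyl n s) x *\<^sub>R h x = indicator (cyl n s) x * h x" for x
      by (simp add: indicator_def)
    ultimately show ?thesis by simp
  qed
  define d where "d x = f x - g x" for x
  have d: "integrable M d" unfolding d_def by (intro Bochner_Integration.integrable_diff f g)
  have zero: "(\<integral>x. indicator (cyl n s) x * d x \<partial>M) = 0" for n s
    unfolding d_def right_diff_distrib by (simp add: int f g eq)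
  have "AE x in M. Re (d x) = 0"
  proof (rule real_eq_AE_by_cylinders[OF sets_M integrable_Re[OF d]])
    fix n s
    have "(\<integral>x. indicator (cyl n s) x * Re (d x) \<partial>M) = (\<integral>x. Re (indicator (cyl n s) x * d x) \<partial>M)"
      by (rule Bochner_Integration.integral_cong) (auto simp: indicator_def)
    then show "(\<integral>x. indicator (cyl n s) x * Re (d x) \<partial>M) = 0"
      using integral_Re[OF int[OF d, of n s]] zero[of n s] by simp
  qed
  moreover have "AE x in M. Im (d x) = 0"
  proof (rule real_eq_AE_by_cylinders[OF sets_M integrable_Im[OF d]])
    fix n s
    have "(\<integral>x. indicator (cyl n s) x * Im (d x) \<partial>M) = (\<integral>x. Im (indicator (cyl n s) x * d x) \<partial>M)"
      by (rule Bochner_Integration.integral_cong) (auto simp: indicator_def)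
    then show "(\<integral>x. indicator (cyl n s) x * Im (d x) \<partial>M) = 0"
      using integral_Im[OF int[OF d, of n s]] zero[of n s] by simp
  qed
  ultimately show ?thesis by eventually_elim (simp add: d_def complex_eq_iff)
qed

text \<open>
  A consistent mass distribution \<open>p\<close> on the binary tree: the masses of the cylinders of length
  \<open>n\<close> are laid out as consecutive intervals, so that every point of \<open>[0, p 0)\<close> determines an
  infinite branch; the measure sought is the image of Lebesgue measure.
\<close>

locale tree_masses =
  fixes p :: "nat \<Rightarrow> bseq \<Rightarrow> real"
  assumes mass_nonneg: "0 \<le> p n s"
    and mass_cong: "(\<And>j. j < n \<Longrightarrow> s j = t j) \<Longrightarrow> p n s = p n t"
    and mass_split: "p n s = p (Suc n) (s(n := False)) + p (Suc n) (s(n := True))"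
begin

text \<open>The left endpoint of the interval that belongs to the prefix of \<open>s\<close> of
  length \<open>n\<close>: each step to a \<open>True\<close> child skips the mass of its
  \<open>False\<close> sibling.\<close>

definition left :: "nat \<Rightarrow> bseq \<Rightarrow> real" where
  "left n s = (\<Sum>j<n. if s j then p (Suc j) (s(j := False)) else 0)"

primrec prefix :: "real \<Rightarrow> nat \<Rightarrow> bseq" where
  "prefix t 0 = (\<lambda>_. False)"
| "prefix t (Suc n) = (prefix t n)
    (n := left n (prefix t n) + p (Suc n) ((prefix t n)(n := False)) \<le> t)"

definition branch :: "real \<Rightarrow> bseq" where
  "branch t j = prefix t (Suc j) j"

lemma left_cong: "(\<And>j. j < n \<Longrightarrow> s j = t j) \<Longrightarrow> left n s = left n t"
  unfolding left_def
proof (rule sum.cong)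
  fix j assume eq: "\<And>j. j < n \<Longrightarrow> s j = t j" and "j \<in> {..<n}"
  moreover have "p (Suc j) (s(j := False)) = p (Suc j) (t(j := False))"
    by (rule mass_cong) (use calculation in \<open>auto simp: less_Suc_eq\<close>)
  ultimately show "(if s j then p (Suc j) (s(j := False)) else 0) = (if t j then p (Suc j) (t(j := False)) else 0)"
    by auto
qed simp

lemma prefix_branch: "j < n \<Longrightarrow> prefix t n j = branch t j"
  by (induction n) (auto simp: branch_def less_Suc_eq)

lemma left_bounds: "0 \<le> left n s \<and> left n s + p n s \<le> p 0 s"
proof (induction n)
  case (Suc n)
  have "p (Suc n) (s(n := s n)) = p (Suc n) s" by simp
  then have "left (Suc n) s + p (Suc n) s \<le> left n s + p n s"
    using mass_split[of n s] mass_nonneg[of "Suc n" "s(n := True)"]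
    by (cases "s n") (auto simp: left_def)
  then show ?case using Suc mass_nonneg by (auto simp: left_def intro: add_nonneg_nonneg)
qed (simp add: left_def)

text \<open>Half-open intervals make the choice of a child unambiguous: a child of mass zero has an
  empty interval and is never entered.\<close>

lemma branch_in_cyl:
  assumes t: "0 \<le> t" "t < p 0 s"
  shows "branch t \<in> cyl n s \<longleftrightarrow> left n s \<le> t \<and> t < left n s + p n s"
proof (induction n)
  case 0
  then show ?case using t by (simp add: left_def)
next
  case (Suc n)
  have up: "s(n := s n) = s" by simp
  have step: "branch t \<in> cyl (Suc n) s \<longleftrightarrow> branch t \<in> cyl n s \<and> branch t n = s n"
    by (auto simp: cyl_def less_Suc_eq)
  show ?case
  proof (cases "branch t \<in> cyl n s")
    case True
    have agree: "prefix t n j = s j" if "j < n" for j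
      using True that by (simp add: prefix_branch cyl_def)
    have "left n (prefix t n) = left n s" by (rule left_cong) (rule agree)
    moreover have "p (Suc n) ((prefix t n)(n := False)) = p (Suc n) (s(n := False))"
      by (rule mass_cong) (auto simp: agree less_Suc_eq)
    ultimately have "branch t n \<longleftrightarrow> left n s + p (Suc n) (s(n := False)) \<le> t"
      by (simp add: branch_def)
    moreover have "left n s \<le> t \<and> t < left n s + p n s" using Suc True by simp
    ultimately show ?thesis
      unfolding step using True mass_split[of n s] up by (cases "s n") (auto simp: left_def)
  next
    case False
    \<comment> \<open>The interval of a child lies within that of its parent, which \<open>t\<close>
      already misses.\<close>
    have "left n s \<le> left (Suc n) s \<and> left (Suc n) s + p (Suc n) s \<le> left n s + p n s"
      using mass_split[of n s] mass_nonneg[of "Suc n"] up by (cases "s n") (auto simp: left_def)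
    then show ?thesis unfolding step using False Suc by auto
  qed
qed

theorem measure_exists:
  "\<exists>M. sets M = sets borel \<and> (\<forall>n s. emeasure M (cyl n s) = ennreal (p n s))"
proof -
  define P where "P = p 0 (\<lambda>_. False)"
  have P: "p 0 s = P" for s unfolding P_def by (rule mass_cong) simp
  let ?I = "restrict_space lborel {0..<P}"
  have pre: "branch -` cyl n s \<inter> {0..<P} = {left n s..<left n s + p n s}" for n s
    using branch_in_cyl[of _ s n] left_bounds[of n s] by (auto simp: P)
  have [measurable]: "branch \<in> measurable ?I borel"
  proof (rule measurable_sigma_sets[OF sets_borel_cylinders cylinders_Pow])
    fix y :: "bseq set" assume "y \<in> cylinders"
    then show "branch -` y \<inter> space ?I \<in> sets ?I"
    proof
      assume "y \<in> range (\<lambda>(n, s). cyl n s)"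
      then obtain n s where y: "y = cyl n s" by auto
      have "{left n s..<left n s + p n s} \<subseteq> {0..<P}" using pre[of n s] by blast
      then show ?thesis
        by (simp add: space_restrict_space y pre sets_restrict_space_iff)
    qed simp
  qed auto
  have "emeasure (distr ?I borel branch) (cyl n s) = ennreal (p n s)" for n s
  proof -
    have "emeasure (distr ?I borel branch) (cyl n s) = emeasure ?I {left n s..<left n s + p n s}"
      by (subst emeasure_distr) (auto simp: space_restrict_space pre)
    also have "\<dots> = emeasure lborel {left n s..<left n s + p n s}"
    proof (rule emeasure_restrict_space)
      show "{left n s..<left n s + p n s} \<subseteq> {0..<P}" using pre[of n s] by blast
    qed simp
    also have "\<dots> = ennreal (p n s)" using mass_nonneg[of n s] by simp
    finally show ?thesis .
  qed
  then show ?thesis by (intro exI[of _ "distr ?I borel branch"]) simp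
qed

end

lemma measure_sum_exists:
  fixes m :: "nat \<Rightarrow> 'a measure"
  assumes "\<And>i. sets (m i) = sets N"
  shows "\<exists>M. sets M = sets N \<and> (\<forall>A\<in>sets N. emeasure M A = (\<Sum>i. emeasure (m i) A))"
proof -
  let ?f = "\<lambda>A. \<Sum>i. emeasure (m i) A"
  define M where "M = measure_of (space N) (sets N) ?f"
  have sets_M: "sets M = sets N" unfolding M_def by (rule sets.sets_measure_of_eq)
  have ca: "countably_additive (sets N) ?f"
  proof (rule countably_additiveI)
    fix A :: "nat \<Rightarrow> 'a set" assume A: "range A \<subseteq> sets N" "disjoint_family A"
    have "(\<Sum>k. \<Sum>i. emeasure (m i) (A k)) = (\<Sum>k. \<integral>\<^sup>+i. emeasure (m i) (A k) \<partial>count_space UNIV)"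
      by (simp add: nn_integral_count_space_nat)
    also have "\<dots> = (\<integral>\<^sup>+i. (\<Sum>k. emeasure (m i) (A k)) \<partial>count_space UNIV)"
      by (rule nn_integral_suminf[symmetric]) simp
    also have "\<dots> = (\<Sum>i. \<Sum>k. emeasure (m i) (A k))"
      by (simp add: nn_integral_count_space_nat)
    also have "\<dots> = (\<Sum>i. emeasure (m i) (\<Union>k. A k))"
      using A by (simp add: suminf_emeasure assms)
    finally show "(\<Sum>k. \<Sum>i. emeasure (m i) (A k)) = (\<Sum>i. emeasure (m i) (\<Union>k. A k))" .
  qed
  have "emeasure M A = ?f A" if "A \<in> sets N" for A
    unfolding M_def
    by (rule emeasure_measure_of_sigma) (use that ca sets.sigma_algebra_axioms in \<open>auto simp: positive_def\<close>)
  then show ?thesis using sets_M by blast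
qed

section \<open>Commuting involutions on a direct integral\<close>

context section_space
begin

definition mulD :: "(bseq \<Rightarrow> complex) \<Rightarrow> bfield set \<Rightarrow> bfield set" where
  "mulD \<phi> F = cls (\<lambda>x n. \<phi> x * rep F x n)"

lemma mulD_cls: "f \<in> L2 \<Longrightarrow> mulD \<phi> (cls f) = cls (\<lambda>x n. \<phi> x * f x n)"
  unfolding mulD_def by (rule cls_cong) (use rep_cls(2)[of f] in \<open>auto elim: eventually_mono\<close>)

definition basis_field :: "nat \<Rightarrow> bfield" where
  "basis_field j x = munit (\<nu> x) j"

end

context quasi_inv_measure
begin

lemma tau_eq: "tau k x * tau k x = complex_of_real (enn2real (rho k x))"
  by (simp add: translation_factor_def flip: of_real_mult)

lemma translate_real_density: "translate \<mu> (delta k) = density \<mu> (\<lambda>x. ennreal (enn2real (rho k x)))"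
proof (rule trans[OF rho_density[symmetric] density_cong])
  show "AE x in \<mu>. rho k x = ennreal (enn2real (rho k x))"
    using rho_finite[of k] by (rule eventually_mono) simp
qed measurable

lemma integral_shift:
  fixes g :: "bseq \<Rightarrow> complex"
  assumes g: "g \<in> borel_measurable \<mu>"
  shows "(\<integral>x. tau k x * tau k x * g x \<partial>\<mu>) = (\<integral>x. g (x \<oplus> delta k) \<partial>\<mu>)"
    "integrable \<mu> (\<lambda>x. tau k x * tau k x * g x) \<longleftrightarrow> integrable \<mu> (\<lambda>x. g (x \<oplus> delta k))"
proof -
  have T: "(\<lambda>x. x \<oplus> delta k) \<in> measurable \<mu> borel"
    using measurable_bplus by (simp only: measurable_cong_sets[OF sets_mu refl])
  have g': "g \<in> borel_measurable borel"
    using g by (simp only: measurable_cong_sets[OF sets_mu refl])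
  have eq: "tau k x * tau k x * g x = enn2real (rho k x) *\<^sub>R g x" for x
    unfolding tau_eq by (simp add: scaleR_conv_of_real)
  let ?N = "density \<mu> (\<lambda>x. ennreal (enn2real (rho k x)))"
  have N: "?N = distr \<mu> borel (\<lambda>x. x \<oplus> delta k)"
    using translate_real_density[of k] by (simp only: translate_def)
  have "(\<integral>x. enn2real (rho k x) *\<^sub>R g x \<partial>\<mu>) = integral\<^sup>L ?N g"
    by (rule integral_density[symmetric]) (use g in auto)
  then show "(\<integral>x. tau k x * tau k x * g x \<partial>\<mu>) = (\<integral>x. g (x \<oplus> delta k) \<partial>\<mu>)"
    by (simp only: eq N integral_distr[OF T g'])
  have "integrable \<mu> (\<lambda>x. enn2real (rho k x) *\<^sub>R g x) = integrable ?N g"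
    by (rule integrable_density[symmetric]) (use g in auto)
  then show "integrable \<mu> (\<lambda>x. tau k x * tau k x * g x) \<longleftrightarrow> integrable \<mu> (\<lambda>x. g (x \<oplus> delta k))"
    by (simp only: eq N integrable_distr_eq[OF T g'])
qed

lemma tau_nonzero: "AE x in \<mu>. tau k x \<noteq> 0"
  using tau_inverse[of k] by (rule eventually_mono) auto

lemma cnj_tau [simp]: "cnj (tau k x) = tau k x"
  by (simp add: translation_factor_def)

end

lemma Delta_induct [consumes 1, case_names zero add]:
  assumes d: "d \<in> Delta" and zero: "P (\<lambda>_. False)"
    and add: "\<And>d k. P d \<Longrightarrow> P (d \<oplus> delta k)"
  shows "P d"
proof -
  have "\<forall>d. {j. d j} = A \<longrightarrow> P d" if "finite A" for A
    using that
  proof (induction A rule: finite_induct)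
    case empty
    have "d = (\<lambda>_. False)" if "{j. d j} = {}" for d :: bseq using that by auto
    then show ?case using zero by metis
  next
    case (insert k A)
    show ?case
    proof (intro allI impI)
      fix d :: bseq assume dA: "{j. d j} = insert k A"
      have "{j. (d(k := False)) j} = A" using dA insert.hyps(2) by (auto split: if_splits)
      then have "P (d(k := False))" using insert.IH by blast
      moreover have "d(k := False) \<oplus> delta k = d" using dA by (auto simp: bplus_def delta_def)
      ultimately show "P d" using add[of "d(k := False)" k] by simp
    qed
  qed
  then show ?thesis using d by (auto simp: Delta_def)
qed

lemma bplus_rotate: "x \<oplus> (d \<oplus> e) = x \<oplus> e \<oplus> d"
  by (auto simp: bplus_def)

text \<open>The situation after transport of the Hilbert space to a direct integral: commuting
  unitary involutions that move the cylinder multiplications as translations do. Quasi-invariance,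
  invariance of the dimension and the fibre operators are all consequences
  (\<open>quasi_inv\<close>, \<open>nu_shift_Delta\<close>, \<open>gw_triple_cT\<close>).\<close>

locale shift_system = section_space \<mu> \<nu> for \<mu> \<nu> +
  fixes U :: "nat \<Rightarrow> bfield set \<Rightarrow> bfield set"
  assumes sets_borel: "sets \<mu> = sets borel" and finite_mu: "finite_measure \<mu>"
    and nu_pos: "\<nu> x \<noteq> 0" and nu_meas: "\<nu> \<in> measurable \<mu> (count_space UNIV)"
    and U_unitary: "unitary_map D D (U k)"
    and U_involution: "F \<in> pts D \<Longrightarrow> U k (U k F) = F"
    and U_commute: "F \<in> pts D \<Longrightarrow> U k (U l F) = U l (U k F)"
    and U_cyl: "F \<in> pts D \<Longrightarrow>
      U k (mulD (indicator (cyl n s)) F) = mulD (indicator (cyl n (s \<oplus> delta k))) (U k F)"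
begin

interpretation fm: finite_measure \<mu> by (rule finite_mu)

interpretation D: complex_hilbert_space D by (rule D_hilbert)

lemma U_in [simp]: "F \<in> pts D \<Longrightarrow> U k F \<in> pts D"
  using U_unitary[of k] by (auto simp: unitary_map_def clinear_map_def)

lemma U_ip: "\<lbrakk>F \<in> pts D; G \<in> pts D\<rbrakk> \<Longrightarrow> ip D (U k F) (U k G) = ip D F G"
  using U_unitary[of k] by (auto simp: unitary_map_def)

lemma cyl_sets [measurable]: "cyl n s \<in> sets \<mu>"
  by (simp add: sets_borel)

lemma ind_L2: "f \<in> L2 \<Longrightarrow> (\<lambda>x n. indicator (cyl m s) x * f x n) \<in> L2"
  by (rule L2_mult[where B = 1]) (auto simp: indicator_def)

lemma mulD_in [simp]: "F \<in> pts D \<Longrightarrow> mulD (indicator (cyl n s)) F \<in> pts D"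
  unfolding mulD_def by (intro cls_in_D ind_L2 rep_D)

lemma ip_mulD:
  assumes F: "F \<in> pts D" and G: "G \<in> pts D"
  shows "ip D (mulD (indicator (cyl n s)) F) G =
    (\<integral>x. indicator (cyl n s) x * ip (fibre \<nu> x) (rep F x) (rep G x) \<partial>\<mu>)"
proof -
  have "ip D (mulD (indicator (cyl n s)) F) (cls (rep G)) =
      (\<integral>x. indicator (cyl n s) x * ip (fibre \<nu> x) (rep F x) (rep G x) \<partial>\<mu>)"
    unfolding mulD_def D_ip[OF ind_L2[OF rep_D(1)[OF F]] rep_D(1)[OF G]]
    using model.ip_smul[OF L2_fibre[OF rep_D(1)[OF F]] L2_fibre[OF rep_D(1)[OF G]]]
    by simp
  then show ?thesis by (simp add: rep_D(2)[OF G])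
qed

text \<open>Unitarity of \<open>U k\<close>, localised by \<open>U_cyl\<close>. As integrals over
  cylinders determine an integrable function almost everywhere, it turns into the pointwise identity
  \<open>local_ip\<close>.\<close>

lemma local_integral:
  assumes F: "F \<in> pts D" and G: "G \<in> pts D"
  shows "(\<integral>x. indicator (cyl n s) x * ip (fibre \<nu> x) (rep F x) (rep G x) \<partial>\<mu>) =
    (\<integral>x. indicator (cyl n (s \<oplus> delta k)) x * ip (fibre \<nu> x) (rep (U k F) x) (rep (U k G) x) \<partial>\<mu>)"
proof -
  have "ip D (mulD (indicator (cyl n s)) F) G = ip D (U k (mulD (indicator (cyl n s)) F)) (U k G)"
    using F G by (simp add: U_ip)
  also have "\<dots> = ip D (mulD (indicator (cyl n (s \<oplus> delta k))) (U k F)) (U k G)"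
    using F by (simp add: U_cyl)
  finally show ?thesis using F G by (simp add: ip_mulD)
qed

lemma local_mass:
  assumes F: "F \<in> pts D"
  shows "ennreal ((vnorm D (mulD (indicator (cyl n s)) F))\<^sup>2) =
    (\<integral>\<^sup>+x. sq_sum (rep F x) * indicator (cyl n s) x \<partial>\<mu>)"
proof -
  have "ennreal ((vnorm D (mulD (indicator (cyl n s)) F))\<^sup>2) =
      (\<integral>\<^sup>+x. sq_sum (\<lambda>n'. indicator (cyl n s) x * rep F x n') \<partial>\<mu>)"
    unfolding D.vnorm_sq[OF mulD_in[OF F]] unfolding mulD_def
    by (rule D_norm(2)[OF ind_L2[OF rep_D(1)[OF F]]])
  also have "\<dots> = (\<integral>\<^sup>+x. sq_sum (rep F x) * indicator (cyl n s) x \<partial>\<mu>)"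
    by (rule nn_integral_cong) (simp add: indicator_def sq_sum_def)
  finally show ?thesis .
qed

lemma basis_field_section: "measurable_section \<mu> \<nu> (basis_field j)"
proof -
  have "(\<lambda>x. basis_field j x n) \<in> borel_measurable \<mu>" for n
  proof -
    have "(\<lambda>x. munit (\<nu> x) j n) \<in> borel_measurable \<mu>"
      by (rule measurable_compose[OF nu_meas]) simp
    then show ?thesis by (simp add: basis_field_def)
  qed
  then show ?thesis by (simp add: measurable_section_def basis_field_def)
qed

lemma sq_sum_basis_field: "sq_sum (basis_field j x) = (if enat j < \<nu> x then 1 else 0)"
  using ip_munit_munit[of "\<nu> x" j j]
  by (simp add: section_sq_sum[OF basis_field_section] model.vnorm_sq section_fibre[OF basis_field_section])
    (simp add: basis_field_def)

lemma basis_field_L2 [simp]: "basis_field j \<in> L2"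
proof -
  have "(\<integral>\<^sup>+x. sq_sum (basis_field j x) \<partial>\<mu>) \<le> (\<integral>\<^sup>+x. 1 \<partial>\<mu>)"
    by (rule nn_integral_mono) (simp add: sq_sum_basis_field)
  also have "\<dots> < \<infinity>" by (simp add: fm.emeasure_finite less_top[symmetric])
  finally show ?thesis using basis_field_section by (simp add: L2_iff)
qed

definition U_basis :: "nat \<Rightarrow> nat \<Rightarrow> bfield" where
  "U_basis k j = rep (U k (cls (basis_field j)))"

lemma U_basis_L2 [simp]: "U_basis k j \<in> L2"
  unfolding U_basis_def by (intro rep_D U_in) simp

lemma distr_shift_twice:
  assumes "sets N = sets borel"
  shows "distr (distr N borel (\<lambda>x. x \<oplus> d)) borel (\<lambda>x. x \<oplus> d) = N"
proof -
  have T: "(\<lambda>x. x \<oplus> d) \<in> measurable N borel"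
    using measurable_bplus by (simp only: measurable_cong_sets[OF assms refl])
  have "distr (distr N borel (\<lambda>x. x \<oplus> d)) borel (\<lambda>x. x \<oplus> d) = distr N borel ((\<lambda>x. x \<oplus> d) \<circ> (\<lambda>x. x \<oplus> d))"
    by (rule distr_distr[OF measurable_bplus T])
  also have "\<dots> = distr N N (\<lambda>x. x)"
    by (rule distr_cong) (simp_all add: assms)
  finally show ?thesis by simp
qed

text \<open>
  Since no fibre is zero, \<open>basis_field 0\<close> has norm 1 everywhere, so its mass distribution is \<open>\<mu>\<close>
  and the mass distribution of its image under \<open>U k\<close> is the translate of \<open>\<mu>\<close>.
\<close>

lemma translate_density: "translate \<mu> (delta k) = density \<mu> (\<lambda>x. sq_sum (U_basis k 0 x))"
proof -
  have [measurable]: "(\<lambda>x. sq_sum (U_basis k 0 x)) \<in> borel_measurable \<mu>"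
    by (rule measurable_sq_sum) (rule L2_coord, simp)
  let ?N = "density \<mu> (\<lambda>x. sq_sum (U_basis k 0 x))"
  have sets_N: "sets ?N = sets borel" by (simp add: sets_borel)
  have T: "(\<lambda>x. x \<oplus> delta k) \<in> measurable ?N borel"
    using measurable_bplus by (simp only: measurable_cong_sets[OF sets_N refl])
  have E: "cls (basis_field 0) \<in> pts D" by simp
  have "\<mu> = distr ?N borel (\<lambda>x. x \<oplus> delta k)"
  proof (rule measure_eq_by_cylinders)
    fix n s
    have "emeasure \<mu> (cyl n s) = (\<integral>\<^sup>+x. sq_sum (rep (cls (basis_field 0)) x) * indicator (cyl n s) x \<partial>\<mu>)"
    proof -
      have "(\<integral>\<^sup>+x. sq_sum (rep (cls (basis_field 0)) x) * indicator (cyl n s) x \<partial>\<mu>) =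
          (\<integral>\<^sup>+x. indicator (cyl n s) x \<partial>\<mu>)"
      proof (rule nn_integral_cong_AE, rule eventually_mono[OF rep_cls(2)[OF basis_field_L2[of 0]]])
        fix x assume "rep (cls (basis_field 0)) x = basis_field 0 x"
        then show "sq_sum (rep (cls (basis_field 0)) x) * indicator (cyl n s) x = indicator (cyl n s) x"
          using nu_pos[of x] by (simp add: sq_sum_basis_field zero_enat_def[symmetric])
      qed
      then show ?thesis by simp
    qed
    also have "\<dots> = ennreal ((vnorm D (mulD (indicator (cyl n s)) (cls (basis_field 0))))\<^sup>2)"
      by (rule local_mass[OF E, symmetric])
    also have "vnorm D (mulD (indicator (cyl n s)) (cls (basis_field 0))) =
        vnorm D (U k (mulD (indicator (cyl n s)) (cls (basis_field 0))))"
      unfolding vnorm_def by (simp add: U_ip)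
    also have "\<dots> = vnorm D (mulD (indicator (cyl n (s \<oplus> delta k))) (U k (cls (basis_field 0))))"
      by (simp add: U_cyl)
    also have "ennreal (\<dots>\<^sup>2) = (\<integral>\<^sup>+x. sq_sum (U_basis k 0 x) * indicator (cyl n (s \<oplus> delta k)) x \<partial>\<mu>)"
      unfolding U_basis_def by (rule local_mass) simp
    also have "\<dots> = emeasure ?N (cyl n (s \<oplus> delta k))" by (simp add: emeasure_density)
    also have "\<dots> = emeasure (distr ?N borel (\<lambda>x. x \<oplus> delta k)) (cyl n s)"
    proof -
      have "(\<lambda>x. x \<oplus> delta k) -` cyl n s \<inter> space ?N = cyl n (s \<oplus> delta k)"
        using sets_eq_imp_space_eq[OF sets_N] by (auto simp: cyl_shift)
      then show ?thesis using emeasure_distr[OF T cyl_borel[of n s]] by simp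
    qed
    finally show "emeasure \<mu> (cyl n s) = emeasure (distr ?N borel (\<lambda>x. x \<oplus> delta k)) (cyl n s)" .
  qed (simp_all add: sets_borel fm.emeasure_finite)
  then have "translate \<mu> (delta k) = distr (distr ?N borel (\<lambda>x. x \<oplus> delta k)) borel (\<lambda>x. x \<oplus> delta k)"
    unfolding translate_def by (rule arg_cong)
  then show ?thesis by (simp only: distr_shift_twice[OF sets_N])
qed

text \<open>Densities are available for the generators \<open>delta k\<close> only. Preimages of
  null sets compose, so this form passes to all of \<open>Delta\<close> by induction.\<close>

lemma shift_null:
  assumes "d \<in> Delta"
  shows "\<forall>B\<in>null_sets \<mu>. {x. x \<oplus> d \<in> B} \<in> null_sets \<mu>"
  using assms
proof (induction rule: Delta_induct)
  case zero
  then show ?case by (simp add: bplus_def)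
next
  case (add d k)
  show ?case
  proof
    fix B assume "B \<in> null_sets \<mu>"
    then have dB: "{x. x \<oplus> d \<in> B} \<in> null_sets \<mu>" (is "?B \<in> _") using add by blast
    have [measurable]: "(\<lambda>x. sq_sum (U_basis k 0 x)) \<in> borel_measurable \<mu>"
      by (rule measurable_sq_sum) (rule L2_coord, simp)
    have "?B \<in> null_sets (translate \<mu> (delta k))"
      unfolding translate_density
      using absolutely_continuousI_density[of "\<lambda>x. sq_sum (U_basis k 0 x)" \<mu>] dB
      by (auto simp: absolutely_continuous_def)
    then have "emeasure (translate \<mu> (delta k)) ?B = 0" by auto
    moreover have T: "(\<lambda>x. x \<oplus> delta k) \<in> measurable \<mu> borel"
      using measurable_bplus by (simp only: measurable_cong_sets[OF sets_borel refl])
    moreover have B: "?B \<in> sets borel" using dB sets_borel by auto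
    ultimately have "emeasure \<mu> ((\<lambda>x. x \<oplus> delta k) -` ?B \<inter> space \<mu>) = 0"
      by (simp add: translate_def emeasure_distr)
    moreover have "(\<lambda>x. x \<oplus> delta k) -` ?B \<inter> space \<mu> \<in> sets \<mu>"
      using T B by (rule measurable_sets)
    moreover have "(\<lambda>x. x \<oplus> delta k) -` ?B \<inter> space \<mu> = {x. x \<oplus> (d \<oplus> delta k) \<in> B}"
      using sets_eq_imp_space_eq[OF sets_borel] by (auto simp: bplus_rotate)
    ultimately show "{x. x \<oplus> (d \<oplus> delta k) \<in> B} \<in> null_sets \<mu>" by auto
  qed
qed

text \<open>Each translation is its own inverse, so \<open>shift_null\<close> yields both directions
  of absolute continuity.\<close>

lemma quasi_inv: "quasi_invariant \<mu>"
proof -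
  have tr: "emeasure (translate \<mu> d) B = emeasure \<mu> {x. x \<oplus> d \<in> B}" if "B \<in> sets borel" for B d
  proof -
    have T: "(\<lambda>x. x \<oplus> d) \<in> measurable \<mu> borel"
      using measurable_bplus by (simp only: measurable_cong_sets[OF sets_borel refl])
    show ?thesis
      using emeasure_distr[OF T that] sets_eq_imp_space_eq[OF sets_borel]
      by (simp add: translate_def vimage_def)
  qed
  have twice: "{x. x \<oplus> d \<in> {x. x \<oplus> d \<in> B}} = B" for B d by simp
  have preB: "{x. x \<oplus> d \<in> B} \<in> sets borel" if "B \<in> sets borel" for B d
    using measurable_sets[OF measurable_bplus that, of d] by (simp add: vimage_def)
  show ?thesis
    unfolding quasi_invariant_def absolutely_continuous_def
  proof (intro ballI conjI subsetI)
    fix d B assume d: "d \<in> Delta" and B: "B \<in> null_sets \<mu>"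
    have "{x. x \<oplus> d \<in> B} \<in> null_sets \<mu>" using shift_null[OF d] B by blast
    then show "B \<in> null_sets (translate \<mu> d)"
      using B sets_borel tr[of B d] by (auto simp: null_sets_def translate_def)
  next
    fix d B assume d: "d \<in> Delta" and B: "B \<in> null_sets (translate \<mu> d)"
    then have Bs: "B \<in> sets borel" by (auto simp: translate_def)
    then have "{x. x \<oplus> d \<in> B} \<in> null_sets \<mu>"
      using B tr[OF Bs, of d] preB[OF Bs] sets_borel by (auto simp: null_sets_def)
    then have "{x. x \<oplus> d \<in> {x. x \<oplus> d \<in> B}} \<in> null_sets \<mu>" using shift_null[OF d] by blast
    then show "B \<in> null_sets \<mu>" by (simp only: twice)
  qed
qed

sublocale quasi_inv_measure \<mu>
  by (intro quasi_inv_measure.intro sets_borel quasi_inv) (rule fm.sigma_finite_measure_axioms)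

lemma local_ip:
  assumes F: "F \<in> pts D" and G: "G \<in> pts D"
  shows "AE x in \<mu>. ip (fibre \<nu> x) (rep (U k F) x) (rep (U k G) x) =
    tau k x * tau k x * ip (fibre \<nu> (x \<oplus> delta k)) (rep F (x \<oplus> delta k)) (rep G (x \<oplus> delta k))"
proof (rule complex_eq_AE_by_cylinders[OF sets_borel])
  define h where "h x = ip (fibre \<nu> x) (rep F x) (rep G x)" for x
  have h_int: "integrable \<mu> h" unfolding h_def by (intro ip_integrable rep_D F G)
  then have h[measurable]: "h \<in> borel_measurable \<mu>" by auto
  note [measurable] = measurable_shift[OF h, of "delta k"]
  show "integrable \<mu> (\<lambda>x. ip (fibre \<nu> x) (rep (U k F) x) (rep (U k G) x))"
    by (intro ip_integrable rep_D U_in F G)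
  have "integrable \<mu> (\<lambda>x. tau k x * tau k x * h (x \<oplus> delta k))"
    by (subst integral_shift(2)) (simp_all add: h_int)
  then show "integrable \<mu> (\<lambda>x. tau k x * tau k x *
      ip (fibre \<nu> (x \<oplus> delta k)) (rep F (x \<oplus> delta k)) (rep G (x \<oplus> delta k)))"
    by (simp add: h_def)
  fix n s
  have "(\<integral>x. tau k x * tau k x * (indicator (cyl n s) x * h (x \<oplus> delta k)) \<partial>\<mu>) =
      (\<integral>x. indicator (cyl n s) (x \<oplus> delta k) * h (x \<oplus> delta k \<oplus> delta k) \<partial>\<mu>)"
    by (rule integral_shift(1)) measurable
  also have "\<dots> = (\<integral>x. indicator (cyl n (s \<oplus> delta k)) x * h x \<partial>\<mu>)"
    by (rule Bochner_Integration.integral_cong) (simp_all add: indicator_def cyl_shift)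
  also have "\<dots> = (\<integral>x. indicator (cyl n s) x * ip (fibre \<nu> x) (rep (U k F) x) (rep (U k G) x) \<partial>\<mu>)"
    using local_integral[OF F G, of n "s \<oplus> delta k" k] by (simp add: h_def)
  finally show "(\<integral>x. indicator (cyl n s) x * ip (fibre \<nu> x) (rep (U k F) x) (rep (U k G) x) \<partial>\<mu>) =
      (\<integral>x. indicator (cyl n s) x * (tau k x * tau k x *
        ip (fibre \<nu> (x \<oplus> delta k)) (rep F (x \<oplus> delta k)) (rep G (x \<oplus> delta k))) \<partial>\<mu>)"
    by (simp add: h_def mult_ac)
qed

text \<open>By \<open>local_ip\<close> the vectors \<open>U_basis k j x\<close> have the Gram matrix
  of the basis at \<open>x \<oplus> delta k\<close>, up to the factor
  \<open>tau k x * tau k x\<close>, which scaling by \<open>inverse (tau k x)\<close> removes. The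
  source is the fibre over the translated point because the two fibres are not yet known to
  coincide.\<close>

definition is_T :: "nat \<Rightarrow> bseq \<Rightarrow> ((nat \<Rightarrow> complex) \<Rightarrow> (nat \<Rightarrow> complex)) \<Rightarrow> bool" where
  "is_T k x T \<longleftrightarrow> isometry_map (fibre \<nu> (x \<oplus> delta k)) (fibre \<nu> x) T \<and>
     (\<forall>j. T (munit (\<nu> (x \<oplus> delta k)) j) = (\<lambda>n. inverse (tau k x) * U_basis k j x n))"

definition T :: "nat \<Rightarrow> bseq \<Rightarrow> (nat \<Rightarrow> complex) \<Rightarrow> (nat \<Rightarrow> complex)" where
  "T k x = (SOME T. is_T k x T)"

lemma rep_basis_field: "AE x in \<mu>. \<forall>j. rep (cls (basis_field j)) x = basis_field j x"
  unfolding AE_all_countable using rep_cls(2)[OF basis_field_L2] by blast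

text \<open>The Gram identities for the countably many pairs \<open>i\<close>, \<open>j\<close> hold
  off a common null set, and there \<open>isometric_extension\<close> applies.\<close>

lemma T_spec: "AE x in \<mu>. is_T k x (T k x)"
proof -
  have "AE x in \<mu>. \<forall>i j. ip (fibre \<nu> x) (U_basis k i x) (U_basis k j x) =
      tau k x * tau k x * ip (fibre \<nu> (x \<oplus> delta k)) (rep (cls (basis_field i)) (x \<oplus> delta k)) (rep (cls (basis_field j)) (x \<oplus> delta k))"
    unfolding AE_all_countable U_basis_def by (intro allI local_ip) simp_all
  then show ?thesis
    using tau_nonzero[of k] AE_shift[OF delta_in_Delta rep_basis_field, of k]
  proof eventually_elim
    case (elim x)
    let ?d = "x \<oplus> delta k" and ?t = "tau k x"
    have bx: "U_basis k j x \<in> pts (fibre \<nu> x)" for j by (rule L2_fibre) simp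
    have gram: "ip (fibre \<nu> ?d) (munit (\<nu> ?d) i) (munit (\<nu> ?d) j) =
        ip (fibre \<nu> x) (\<lambda>n. inverse ?t * U_basis k i x n) (\<lambda>n. inverse ?t * U_basis k j x n)" for i j
    proof -
      have "ip (fibre \<nu> x) (\<lambda>n. inverse ?t * U_basis k i x n) (\<lambda>n. inverse ?t * U_basis k j x n) =
          inverse ?t * (cnj (inverse ?t) * ip (fibre \<nu> x) (U_basis k i x) (U_basis k j x))"
        using model.ip_smul[OF bx model.smul_closed[OF bx], of "inverse ?t" i "inverse ?t" j]
          model.ip_smul_right[OF bx bx] by simp
      moreover have "inverse ?t * (inverse ?t * (?t * ?t * z)) = z" for z
        using elim(2) by (simp add: field_simps)
      ultimately show ?thesis using elim(1,3) by (simp add: basis_field_def)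
    qed
    have "\<exists>T. isometry_map (fibre \<nu> ?d) (fibre \<nu> x) T \<and>
        (\<forall>j. T (munit (\<nu> ?d) j) = (\<lambda>n. inverse ?t * U_basis k j x n))"
    proof (rule isometric_extension[OF model_hilbert model_hilbert total_munit])
      show "(\<lambda>n. inverse ?t * U_basis k j x n) \<in> pts (fibre \<nu> x)" for j
        using model.smul_closed[OF bx] by simp
    qed (rule gram)
    then have "\<exists>T. is_T k x T" by (simp add: is_T_def)
    then show ?case unfolding T_def by (rule someI_ex)
  qed
qed

lemma is_T_in: "\<lbrakk>is_T k x T'; v \<in> pts (fibre \<nu> (x \<oplus> delta k))\<rbrakk> \<Longrightarrow> T' v \<in> pts (fibre \<nu> x)"
  by (auto simp: is_T_def isometry_map_def clinear_map_def)

lemma is_T_smul: "\<lbrakk>is_T k x T'; v \<in> pts (fibre \<nu> (x \<oplus> delta k))\<rbrakk> \<Longrightarrow> T' (\<lambda>n. a * v n) = (\<lambda>n. a * T' v n)"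
  by (auto simp: is_T_def isometry_map_def clinear_map_def)

lemma is_T_ip: "\<lbrakk>is_T k x T'; v \<in> pts (fibre \<nu> (x \<oplus> delta k)); w \<in> pts (fibre \<nu> (x \<oplus> delta k))\<rbrakk> \<Longrightarrow>
    ip (fibre \<nu> x) (T' v) (T' w) = ip (fibre \<nu> (x \<oplus> delta k)) v w"
  by (auto simp: is_T_def isometry_map_def)

text \<open>An isometry cannot lower the dimension, which gives one inequality at \<open>x\<close>
  and the opposite one at the translated point.\<close>

lemma nu_shift: "AE x in \<mu>. \<nu> (x \<oplus> delta k) = \<nu> x"
proof -
  have le: "AE x in \<mu>. \<nu> (x \<oplus> delta k) \<le> \<nu> x"
    using T_spec[of k] by (rule eventually_mono) (auto simp: is_T_def intro: isometry_dim_le)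
  show ?thesis using le AE_shift[OF delta_in_Delta le, of k] by eventually_elim simp
qed

lemma nu_shift_Delta: "d \<in> Delta \<Longrightarrow> AE x in \<mu>. \<nu> (x \<oplus> d) = \<nu> x"
proof (induction rule: Delta_induct)
  case zero
  then show ?case by (simp add: bplus_def)
next
  case (add d k)
  show ?case
    unfolding bplus_rotate[of _ d "delta k"]
    using AE_shift[OF delta_in_Delta add, of k] nu_shift[of k] by eventually_elim simp
qed

lemma U_eq_T:
  assumes F: "F \<in> pts D"
  shows "AE x in \<mu>. rep (U k F) x = (\<lambda>n. tau k x * T k x (rep F (x \<oplus> delta k)) n)"
proof -
  have "AE x in \<mu>. \<forall>j. ip (fibre \<nu> x) (rep (U k F) x) (U_basis k j x) =
      tau k x * tau k x * ip (fibre \<nu> (x \<oplus> delta k)) (rep F (x \<oplus> delta k)) (rep (cls (basis_field j)) (x \<oplus> delta k))"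
    unfolding AE_all_countable U_basis_def by (intro allI local_ip F) simp
  then show ?thesis
    using local_ip[OF F F, of k] T_spec[of k] tau_nonzero[of k] AE_shift[OF delta_in_Delta rep_basis_field, of k]
  proof eventually_elim
    case (elim x)
    let ?d = "x \<oplus> delta k" and ?t = "tau k x"
    define a where "a = rep (U k F) x"
    define z where "z = rep F ?d"
    have a: "a \<in> pts (fibre \<nu> x)" unfolding a_def by (intro L2_fibre rep_D U_in F)
    have z: "z \<in> pts (fibre \<nu> ?d)" unfolding z_def by (intro L2_fibre rep_D F)
    have tz: "(\<lambda>n. ?t * z n) \<in> pts (fibre \<nu> ?d)" using model.smul_closed[OF z] by simp
    have bx: "U_basis k j x \<in> pts (fibre \<nu> x)" for j by (rule L2_fibre) simp
    have iso: "isometry_map (fibre \<nu> ?d) (fibre \<nu> x) (T k x)" using elim(3) by (simp add: is_T_def)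
    have gen: "ip (fibre \<nu> x) a (T k x (munit (\<nu> ?d) j)) = ip (fibre \<nu> ?d) (\<lambda>n. ?t * z n) (munit (\<nu> ?d) j)" for j
    proof -
      have "ip (fibre \<nu> x) a (T k x (munit (\<nu> ?d) j)) = cnj (inverse ?t) * ip (fibre \<nu> x) a (U_basis k j x)"
        using elim(3) model.ip_smul_right[OF bx a] by (simp add: is_T_def)
      also have "ip (fibre \<nu> x) a (U_basis k j x) = ?t * ?t * ip (fibre \<nu> ?d) z (munit (\<nu> ?d) j)"
        using elim(1,5) by (simp add: a_def z_def basis_field_def)
      also have "cnj (inverse ?t) * (?t * ?t * ip (fibre \<nu> ?d) z (munit (\<nu> ?d) j)) =
          ?t * ip (fibre \<nu> ?d) z (munit (\<nu> ?d) j)"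
        using elim(4) by simp
      finally show ?thesis using model.ip_smul[OF z munit_in] by simp
    qed
    have ar: "ip (fibre \<nu> x) a (T k x v) = ip (fibre \<nu> ?d) (\<lambda>n. ?t * z n) v" if "v \<in> pts (fibre \<nu> ?d)" for v
      by (rule isometry_ip_right[OF iso model_inner that tz a gen])
    define w where "w = T k x (\<lambda>n. ?t * z n)"
    have w: "w \<in> pts (fibre \<nu> x)" unfolding w_def by (rule is_T_in[OF elim(3) tz])
    have zz: "ip (fibre \<nu> ?d) (\<lambda>n. ?t * z n) (\<lambda>n. ?t * z n) = ?t * ?t * ip (fibre \<nu> ?d) z z"
      using model.ip_smul[OF z tz] model.ip_smul_right[OF z z] by simp
    have "ip (fibre \<nu> x) a a = ?t * ?t * ip (fibre \<nu> ?d) z z" using elim(2) by (simp add: a_def z_def)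
    moreover have "ip (fibre \<nu> x) a w = ?t * ?t * ip (fibre \<nu> ?d) z z"
      unfolding w_def ar[OF tz] by (rule zz)
    moreover have "ip (fibre \<nu> x) w w = ?t * ?t * ip (fibre \<nu> ?d) z z"
      unfolding w_def is_T_ip[OF elim(3) tz tz] by (rule zz)
    ultimately have "(vdist (fibre \<nu> x) a w)\<^sup>2 = 0"
      using a w by (simp add: model.vdist_sq model.vnorm_sq)
    then have "a = w" using model.eq_by_vdist[OF a w] by simp
    then show ?case unfolding a_def w_def is_T_smul[OF elim(3) z] by (simp add: z_def)
  qed
qed

lemma U_basis_field: "AE x in \<mu>. \<forall>j. U_basis k j x = (\<lambda>n. tau k x * T k x (munit (\<nu> (x \<oplus> delta k)) j) n)"
  using T_spec[of k] tau_nonzero[of k]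
  by eventually_elim (auto simp: is_T_def)

lemma UU_basis_field:
  "AE x in \<mu>. \<forall>j. rep (U k (U l (cls (basis_field j)))) x = (\<lambda>n. tau k x * tau l (x \<oplus> delta k) *
     T k x (T l (x \<oplus> delta k) (munit (\<nu> (x \<oplus> delta k \<oplus> delta l)) j)) n)"
proof -
  have "AE x in \<mu>. \<forall>j. rep (U k (U l (cls (basis_field j)))) x = (\<lambda>n. tau k x * T k x (U_basis l j (x \<oplus> delta k)) n)"
    unfolding AE_all_countable U_basis_def by (intro allI U_eq_T) simp
  then show ?thesis
    using AE_shift[OF delta_in_Delta U_basis_field[of l], of k] T_spec[of k]
      AE_shift[OF delta_in_Delta T_spec[of l], of k]
  proof eventually_elim
    case (elim x)
    show ?case
    proof
      fix j
      have "T l (x \<oplus> delta k) (munit (\<nu> (x \<oplus> delta k \<oplus> delta l)) j) \<in> pts (fibre \<nu> (x \<oplus> delta k))"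
        by (rule is_T_in[OF elim(4)]) simp
      then show "rep (U k (U l (cls (basis_field j)))) x = (\<lambda>n. tau k x * tau l (x \<oplus> delta k) *
          T k x (T l (x \<oplus> delta k) (munit (\<nu> (x \<oplus> delta k \<oplus> delta l)) j)) n)"
        using elim(1,2) is_T_smul[OF elim(3)] by (simp add: mult.assoc)
    qed
  qed
qed

lemma isometry_comp:
  assumes "isometry_map H1 H2 A" "isometry_map H2 H3 B"
  shows "isometry_map H1 H3 (\<lambda>v. B (A v))"
  using assms unfolding isometry_map_def clinear_map_def by auto

text \<open>The operator identity for \<open>U k\<close> is evaluated on the countably many basis
  fields; \<open>isometry_model_eq\<close> extends the resulting pointwise identity from basis
  vectors to the whole fibre.\<close>

lemma T_involution: "AE x in \<mu>. \<forall>v\<in>pts (fibre \<nu> x). T k x (T k (x \<oplus> delta k) v) = v"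
proof -
  have "AE x in \<mu>. \<forall>j. rep (U k (U k (cls (basis_field j)))) x = basis_field j x"
    using rep_basis_field by (simp add: U_involution)
  then show ?thesis
    using UU_basis_field[of k k] tau_inverse[of k] T_spec[of k] AE_shift[OF delta_in_Delta T_spec[of k], of k]
  proof eventually_elim
    case (elim x)
    have iso1: "isometry_map (fibre \<nu> (x \<oplus> delta k)) (fibre \<nu> x) (T k x)"
      and iso2: "isometry_map (fibre \<nu> x) (fibre \<nu> (x \<oplus> delta k)) (T k (x \<oplus> delta k))"
      using elim(4,5) by (simp_all add: is_T_def)
    have gen: "T k x (T k (x \<oplus> delta k) (munit (\<nu> x) j)) = munit (\<nu> x) j" for j
      using elim(1,2,3) by (simp add: basis_field_def)
    have id: "isometry_map (fibre \<nu> x) (fibre \<nu> x) (\<lambda>v. v)"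
      by (simp add: isometry_map_def clinear_map_def)
    show ?case
      using isometry_model_eq[OF isometry_comp[OF iso2 iso1] id _ gen] by blast
  qed
qed

lemma T_commute:
  "AE x in \<mu>. \<forall>v\<in>pts (fibre \<nu> x). T k x (T l (x \<oplus> delta k) v) = T l x (T k (x \<oplus> delta l) v)"
proof -
  have "AE x in \<mu>. \<forall>j. rep (U k (U l (cls (basis_field j)))) x = rep (U l (U k (cls (basis_field j)))) x"
    by (simp add: U_commute[of _ k l])
  then show ?thesis
    using UU_basis_field[of k l] UU_basis_field[of l k] tau_cocycle[of k l] tau_nonzero[of k]
      AE_shift[OF delta_in_Delta tau_nonzero[of l], of k]
      T_spec[of k] AE_shift[OF delta_in_Delta T_spec[of l], of k]
      T_spec[of l] AE_shift[OF delta_in_Delta T_spec[of k], of l]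
      nu_shift[of k] AE_shift[OF delta_in_Delta nu_shift[of l], of k]
  proof eventually_elim
    case (elim x)
    have nu2: "\<nu> (x \<oplus> delta k \<oplus> delta l) = \<nu> x" "\<nu> (x \<oplus> delta l \<oplus> delta k) = \<nu> x"
      using elim(11,12) by (simp_all add: bplus_swap[of x "delta l" "delta k"])
    have iso: "isometry_map (fibre \<nu> (x \<oplus> delta k)) (fibre \<nu> x) (T k x)"
      "isometry_map (fibre \<nu> x) (fibre \<nu> (x \<oplus> delta k)) (T l (x \<oplus> delta k))"
      "isometry_map (fibre \<nu> (x \<oplus> delta l)) (fibre \<nu> x) (T l x)"
      "isometry_map (fibre \<nu> x) (fibre \<nu> (x \<oplus> delta l)) (T k (x \<oplus> delta l))"
      using elim(7-10) by (simp_all add: is_T_def nu2)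
    have gen: "T k x (T l (x \<oplus> delta k) (munit (\<nu> x) j)) = T l x (T k (x \<oplus> delta l) (munit (\<nu> x) j))" for j
    proof -
      have "(\<lambda>n. tau k x * tau l (x \<oplus> delta k) * T k x (T l (x \<oplus> delta k) (munit (\<nu> x) j)) n) =
          (\<lambda>n. tau l x * tau k (x \<oplus> delta l) * T l x (T k (x \<oplus> delta l) (munit (\<nu> x) j)) n)"
        using elim(1,2,3) by (simp add: nu2)
      then show ?thesis using elim(4,5,6) by (auto simp: fun_eq_iff)
    qed
    show ?case
      using isometry_model_eq[OF isometry_comp[OF iso(2,1)] isometry_comp[OF iso(4,3)] _ gen] by blast
  qed
qed

definition good :: "nat \<Rightarrow> bseq \<Rightarrow> bool" where
  "good k x \<longleftrightarrow> is_T k x (T k x) \<and> \<nu> (x \<oplus> delta k) = \<nu> x \<and>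
     (\<forall>v\<in>pts (fibre \<nu> x). T k (x \<oplus> delta k) v \<in> pts (fibre \<nu> x) \<and> T k x (T k (x \<oplus> delta k) v) = v)"

lemma AE_good: "AE x in \<mu>. good k x"
  using T_spec[of k] nu_shift[of k] T_involution[of k] AE_shift[OF delta_in_Delta T_spec[of k], of k]
  unfolding good_def
proof eventually_elim
  case (elim x)
  have "T k (x \<oplus> delta k) v \<in> pts (fibre \<nu> x)" if "v \<in> pts (fibre \<nu> x)" for v
    using is_T_in[OF elim(4)] that elim(2) by simp
  then show ?case using elim by blast
qed

lemma good_isometry:
  assumes "good k x"
  shows "isometry_map (fibre \<nu> x) (fibre \<nu> x) (T k x)"
    "T k x (munit (\<nu> x) j) = (\<lambda>n. inverse (tau k x) * U_basis k j x n)"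
  using assms unfolding good_def is_T_def by metis+

text \<open>
  A Borel null set outside which \<open>T k\<close> behaves; modifying \<open>T k\<close> on the set of all bad points
  itself could destroy measurability.
\<close>

definition bad :: "nat \<Rightarrow> bseq set" where
  "bad k = (SOME N. N \<in> null_sets \<mu> \<and> {x. \<not> good k x} \<subseteq> N)"

lemma bad: "bad k \<in> null_sets \<mu> \<and> {x. \<not> good k x} \<subseteq> bad k"
proof -
  have "\<exists>N. N \<in> null_sets \<mu> \<and> {x. \<not> good k x} \<subseteq> N"
    using AE_good[of k] by (auto simp: eventually_ae_filter)
  then show ?thesis unfolding bad_def by (rule someI_ex)
qed

lemma good: "x \<notin> bad k \<Longrightarrow> good k x"
  using bad[of k] by blast

definition cT :: opfield where
  "cT k x v = (if x \<in> bad k then v else T k x v)"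

lemma AE_bad: "AE x in \<mu>. x \<notin> bad k"
  using bad[of k] AE_not_in by blast

lemma cT_unitary: "unitary_map (fibre \<nu> x) (fibre \<nu> x) (cT k x)"
proof (cases "x \<in> bad k")
  case True
  then have "cT k x = (\<lambda>v. v)" by (simp add: cT_def fun_eq_iff)
  then show ?thesis by (simp add: unitary_map_def clinear_map_def bij_betw_def inj_on_def)
next
  case False
  then have g: "good k x" by (rule good)
  have c: "cT k x = T k x" using False by (simp add: cT_def fun_eq_iff)
  note iso = good_isometry(1)[OF g]
  have "inj_on (T k x) (pts (fibre \<nu> x))"
  proof (rule inj_onI)
    fix u v assume uv: "u \<in> pts (fibre \<nu> x)" "v \<in> pts (fibre \<nu> x)" "T k x u = T k x v"
    have "T k x v \<in> pts (fibre \<nu> x)" using iso uv by (auto simp: isometry_map_def clinear_map_def)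
    then have "vdist (fibre \<nu> x) u v = 0"
      using isometry_vdist[OF iso model_inner model_inner uv(1,2)] uv(3) by simp
    then show "u = v" by (rule model.eq_by_vdist[OF uv(1,2)])
  qed
  moreover have "T k x ` pts (fibre \<nu> x) = pts (fibre \<nu> x)"
  proof
    show "T k x ` pts (fibre \<nu> x) \<subseteq> pts (fibre \<nu> x)"
      using iso by (auto simp: isometry_map_def clinear_map_def)
    show "pts (fibre \<nu> x) \<subseteq> T k x ` pts (fibre \<nu> x)"
      using g unfolding good_def by (metis image_eqI subsetI)
  qed
  ultimately show ?thesis
    using iso unfolding c unitary_map_def isometry_map_def bij_betw_def by blast
qed

text \<open>\<open>T k x\<close> is picked separately at each point, yet its matrix entries are
  coordinates of \<open>U_basis k j\<close> divided by \<open>tau k x\<close>, so each coordinate of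
  the image is a series of measurable functions.\<close>

lemma cT_measurable:
  assumes f: "measurable_section \<mu> \<nu> f"
  shows "measurable_section \<mu> \<nu> (\<lambda>x. cT k x (f x))"
  unfolding measurable_section_def
proof (intro conjI allI)
  show "cT k x (f x) \<in> pts (fibre \<nu> x)" for x
    using cT_unitary[of x k] section_fibre[OF f, of x] by (auto simp: unitary_map_def clinear_map_def)
  fix n
  note [measurable] = section_coord[OF f] tau_measurable L2_coord[OF U_basis_L2]
  have [measurable]: "bad k \<in> sets \<mu>" using bad by auto
  have eq: "cT k x (f x) n =
      (if x \<in> bad k then f x n else (\<Sum>j. f x j * (inverse (tau k x) * U_basis k j x n)))" for x
  proof (cases "x \<in> bad k")
    case False
    then have g: "good k x" by (rule good)
    note iso = good_isometry(1)[OF g] and gen = good_isometry(2)[OF g]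
    show ?thesis
      using sums_unique[OF isometry_model_sums[OF iso section_fibre[OF f], of n]] False
      by (simp add: cT_def gen)
  qed (simp add: cT_def)
  show "(\<lambda>x. cT k x (f x) n) \<in> borel_measurable \<mu>"
    unfolding eq by measurable
qed

lemma fibre_Delta: "d \<in> Delta \<Longrightarrow> AE x in \<mu>. fibre \<nu> (x \<oplus> d) = fibre \<nu> x"
  using nu_shift_Delta[of d] by (auto elim: eventually_mono)

theorem gw_triple_cT: "gw_triple \<mu> \<nu> cT"
proof
  show "AE x in \<mu>. is_adjoint (fibre \<nu> x) (fibre \<nu> (x \<oplus> delta k)) (cT k x) (cT k (x \<oplus> delta k))" for k
    using AE_bad[of k] AE_shift[OF delta_in_Delta AE_bad[of k], of k]
  proof eventually_elim
    case (elim x)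
    have g: "good k x" using elim(1) by (rule good)
    show ?case
      unfolding is_adjoint_def
    proof (intro ballI)
      fix u v assume u: "u \<in> pts (fibre \<nu> x)" and v: "v \<in> pts (fibre \<nu> (x \<oplus> delta k))"
      have nu: "\<nu> (x \<oplus> delta k) = \<nu> x" using g by (simp add: good_def)
      have Tv: "T k (x \<oplus> delta k) v \<in> pts (fibre \<nu> x)" "T k x (T k (x \<oplus> delta k) v) = v"
        using g v nu by (auto simp: good_def)
      have "ip (fibre \<nu> x) (T k x u) (T k x (T k (x \<oplus> delta k) v)) = ip (fibre \<nu> x) u (T k (x \<oplus> delta k) v)"
        using is_T_ip[of k x "T k x" u "T k (x \<oplus> delta k) v"] g u Tv nu by (simp add: good_def)
      then show "ip (fibre \<nu> (x \<oplus> delta k)) (cT k x u) v = ip (fibre \<nu> x) u (cT k (x \<oplus> delta k) v)"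
        using elim Tv nu by (simp add: cT_def)
    qed
  qed
  show "AE x in \<mu>. \<forall>v\<in>pts (fibre \<nu> x).
      cT k x (cT l (x \<oplus> delta k) v) = cT l x (cT k (x \<oplus> delta l) v)" for k l
    using AE_bad[of k] AE_bad[of l] AE_shift[OF delta_in_Delta AE_bad[of k], of l]
      AE_shift[OF delta_in_Delta AE_bad[of l], of k] T_commute[of k l]
    by eventually_elim (simp add: cT_def)
qed (use sets_borel quasi_inv nu_pos nu_meas fibre_Delta cT_unitary cT_measurable
    fm.sigma_finite_measure_axioms in auto)

theorem gw_op_cT:
  assumes F: "F \<in> pts D"
  shows "gw_triple.gw_op \<mu> \<nu> cT \<phi> k F = mulD \<phi> (U k F)"
proof -
  interpret gw: gw_triple \<mu> \<nu> cT by (rule gw_triple_cT)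
  have "gw.gw_op \<phi> k (cls (rep F)) = cls (gw.raw \<phi> k (rep F))"
    by (rule gw.gw_op_cls[OF rep_D(1)[OF F]])
  also have "\<dots> = cls (\<lambda>x n. \<phi> x * rep (U k F) x n)"
  proof (rule cls_cong)
    show "AE x in \<mu>. gw.raw \<phi> k (rep F) x = (\<lambda>n. \<phi> x * rep (U k F) x n)"
      using AE_bad[of k] U_eq_T[OF F, of k]
    proof eventually_elim
      case (elim x)
      have "\<nu> (x \<oplus> delta k) = \<nu> x" using good[OF elim(1)] by (simp add: good_def)
      then have "rep F (x \<oplus> delta k) \<in> pts (fibre \<nu> x)"
        using L2_fibre[OF rep_D(1)[OF F], of "x \<oplus> delta k"] by simp
      then show ?case using elim by (simp add: gw.raw_eq cT_def mult.assoc)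
    qed
  qed
  finally show ?thesis by (simp add: rep_D(2)[OF F] mulD_def)
qed

end

section \<open>Cyclic vectors of a spinor structure\<close>

context complex_inner_space
begin

lemma smul_zero [simp]: "smul H a (vzero H) = vzero H"
  by (rule eq_by_ip) auto

definition operator :: "('a \<Rightarrow> 'a) \<Rightarrow> bool" where
  "operator T \<longleftrightarrow> clinear_map H H T"

lemma op_in: "operator T \<Longrightarrow> v \<in> pts H \<Longrightarrow> T v \<in> pts H"
  by (simp add: operator_def clinear_map_def)

lemma op_add: "\<lbrakk>operator T; u \<in> pts H; v \<in> pts H\<rbrakk> \<Longrightarrow> T (vadd H u v) = vadd H (T u) (T v)"
  by (simp add: operator_def clinear_map_def)

lemma op_smul: "\<lbrakk>operator T; v \<in> pts H\<rbrakk> \<Longrightarrow> T (smul H a v) = smul H a (T v)"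
  by (simp add: operator_def clinear_map_def)

lemma op_minus: "\<lbrakk>operator T; v \<in> pts H\<rbrakk> \<Longrightarrow> T (vminus H v) = vminus H (T v)"
  by (simp add: vminus_def op_smul)

lemma smul_0: "v \<in> pts H \<Longrightarrow> smul H 0 v = vzero H"
  by (rule eq_by_ip) auto

lemma op_zero: "operator T \<Longrightarrow> T (vzero H) = vzero H"
  using op_smul[of T "vzero H" 0] by (simp add: smul_0 op_in)

lemma minus_minus [simp]: "v \<in> pts H \<Longrightarrow> vminus H (vminus H v) = v"
  by (rule eq_by_ip) auto

lemma op_comp: "operator A \<Longrightarrow> operator B \<Longrightarrow> operator (\<lambda>v. A (B v))"
  by (simp add: operator_def clinear_map_def)

lemma op_scale: "operator A \<Longrightarrow> operator (\<lambda>v. smul H a (A v))"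
  by (simp add: operator_def clinear_map_def smul_add_right smul_smul mult.commute)

lemma polarization:
  assumes T: "operator T" and iso: "\<And>v. v \<in> pts H \<Longrightarrow> vnorm H (T v) = vnorm H v"
    and u: "u \<in> pts H" and v: "v \<in> pts H"
  shows "ip H (T u) (T v) = ip H u v"
proof -
  have Re_eq: "Re (ip H (T u) (T v)) = Re (ip H u v)" if u: "u \<in> pts H" for u
  proof -
    note in_T = op_in[OF T u] op_in[OF T v]
    have "(vnorm H (T (vadd H u v)))\<^sup>2 = (vnorm H (vadd H u v))\<^sup>2" using iso u v by simp
    moreover have "(vnorm H (T u))\<^sup>2 = (vnorm H u)\<^sup>2" "(vnorm H (T v))\<^sup>2 = (vnorm H v)\<^sup>2"
      using iso u v by simp_all
    moreover have "ip H v u = cnj (ip H u v)" "ip H (T v) (T u) = cnj (ip H (T u) (T v))"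
      using ip_cnj[OF u v] ip_cnj[OF in_T] by simp_all
    ultimately show ?thesis using u v in_T by (simp add: op_add[OF T] vnorm_sq)
  qed
  have "Re (\<i> * ip H (T u) (T v)) = Re (\<i> * ip H u v)"
    using Re_eq[of "smul H \<i> u"] u v by (simp add: op_smul[OF T] op_in[OF T])
  then show ?thesis using Re_eq[OF u] by (simp add: complex_eq_iff)
qed

end

section \<open>Commuting involutions and cylinder projections of a spinor structure\<close>

locale spinor_space = complex_hilbert_space H for H :: "'h cspace" +
  fixes S :: "nat \<Rightarrow> 'h \<Rightarrow> 'h"
  assumes spinor: "complex_spinor_structure H S" and separable: "separable_cspace H"
begin

lemma S_op: "operator (S n)"
  using spinor by (simp add: complex_spinor_structure_def orthogonal_complex_structure_def operator_def)

lemmas S_in [simp] = op_in[OF S_op]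

lemma S_sq: "v \<in> pts H \<Longrightarrow> S n (S n v) = vminus H v"
  using spinor by (simp add: complex_spinor_structure_def orthogonal_complex_structure_def)

lemma S_anti: "m \<noteq> n \<Longrightarrow> v \<in> pts H \<Longrightarrow> S m (S n v) = vminus H (S n (S m v))"
  using spinor unfolding complex_spinor_structure_def anticommute_def by blast

lemma S_vnorm: "v \<in> pts H \<Longrightarrow> vnorm H (S n v) = vnorm H v"
  using spinor by (simp add: complex_spinor_structure_def orthogonal_complex_structure_def)

lemma S_ip: "u \<in> pts H \<Longrightarrow> v \<in> pts H \<Longrightarrow> ip H (S n u) (S n v) = ip H u v"
  by (rule polarization[OF S_op S_vnorm])

lemma S_skew:
  assumes "u \<in> pts H" "v \<in> pts H" shows "ip H (S n u) v = - ip H u (S n v)"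
proof -
  have "- ip H (S n u) v = ip H u (S n v)" using S_ip[of u "S n v" n] assms by (simp add: S_sq)
  then show ?thesis by (metis minus_equation_iff)
qed

text \<open>In the model, \<open>A k\<close> is multiplication by \<open>(-1)\<close> to the power \<open>x k\<close>.\<close>

definition A :: "nat \<Rightarrow> 'h \<Rightarrow> 'h" where
  "A k v = smul H (- \<i>) (S (2 * k) (S (Suc (2 * k)) v))"

lemma A_op: "operator (A k)"
  unfolding A_def[abs_def] by (rule op_scale[OF op_comp[OF S_op S_op]])

lemmas A_in [simp] = op_in[OF A_op]
lemmas A_smul = op_smul[OF A_op]
lemmas A_add = op_add[OF A_op]
lemmas A_minus = op_minus[OF A_op]

lemma A_selfadjoint: "u \<in> pts H \<Longrightarrow> v \<in> pts H \<Longrightarrow> ip H (A k u) v = ip H u (A k v)"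
  by (simp add: A_def S_skew S_anti[of "Suc (2 * k)" "2 * k"])

lemma minus_smul: "v \<in> pts H \<Longrightarrow> smul H a (vminus H v) = smul H (- a) v"
  by (rule eq_by_ip) auto

text \<open>Moving \<open>S n\<close> past the two factors of \<open>A k\<close> costs two signs,
  which cancel, unless \<open>S n\<close> is one of these factors and only the other one produces a
  sign.\<close>

lemma A_S:
  assumes v: "v \<in> pts H"
  shows "A k (S n v) = (if n div 2 = k then vminus H (S n (A k v)) else S n (A k v))"
proof -
  let ?a = "2 * k" and ?b = "Suc (2 * k)"
  consider "n = ?a" | "n = ?b" | "n \<noteq> ?a" "n \<noteq> ?b" "n div 2 \<noteq> k" by linarith
  then show ?thesis
  proof cases
    case 1
    then show ?thesis
      using v by (simp add: A_def op_smul[OF S_op] S_anti[of ?b ?a] op_minus[OF S_op] S_sq)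
        (simp add: vminus_def smul_smul)
  next
    case 2
    have "S ?b (S ?a (S ?b v)) = S ?a v"
      using v by (simp add: S_anti[of ?b ?a] S_sq op_minus[OF S_op])
    then show ?thesis
      using v 2 by (simp add: A_def op_smul[OF S_op] S_sq op_minus[OF S_op])
        (simp add: vminus_def smul_smul)
  next
    case 3
    then show ?thesis
      using v by (simp add: A_def op_smul[OF S_op] S_anti[of _ n] op_minus[OF S_op])
  qed
qed

lemma A_sq: "v \<in> pts H \<Longrightarrow> A k (A k v) = v"
proof -
  assume v: "v \<in> pts H"
  have "A k (A k v) = smul H (- \<i>) (S (2 * k) (S (Suc (2 * k)) (A k v)))" by (rule A_def)
  also have "S (2 * k) (S (Suc (2 * k)) (A k v)) = A k (S (2 * k) (S (Suc (2 * k)) v))"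
    using v by (simp add: A_S op_minus[OF S_op])
  also have "S (2 * k) (S (Suc (2 * k)) v) = smul H \<i> (A k v)"
    using v by (simp add: A_def smul_smul smul_one)
  finally show ?thesis
    using v by (simp add: A_def op_smul[OF S_op] smul_smul S_anti[of "Suc (2 * k)" "2 * k"] S_sq
        op_minus[OF S_op] minus_smul smul_one)
qed

lemma A_commute: "v \<in> pts H \<Longrightarrow> A k (A l v) = A l (A k v)"
  by (cases "k = l") (auto simp: A_def[of l] A_smul A_S)

text \<open>The operator counterpart of the sign \<open>par x k\<close>, see
  \<open>Phi_Par\<close>.\<close>

primrec Par :: "nat \<Rightarrow> 'h \<Rightarrow> 'h" where
  "Par 0 v = v"
| "Par (Suc k) v = A k (Par k v)"

lemma Par_op: "operator (Par k)"
proof (induction k)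
  case 0
  then show ?case by (simp add: operator_def clinear_map_def)
next
  case (Suc k)
  then have "operator (\<lambda>v. A k (Par k v))" by (rule op_comp[OF A_op])
  then show ?case by (simp add: operator_def clinear_map_def)
qed

lemmas Par_in [simp] = op_in[OF Par_op]

lemma A_Par: "v \<in> pts H \<Longrightarrow> A j (Par k v) = Par k (A j v)"
  by (induction k) (simp_all add: A_commute[of _ j])

lemma Par_sq: "v \<in> pts H \<Longrightarrow> Par k (Par k v) = v"
  by (induction k) (simp_all add: A_Par[symmetric] A_sq)

lemma Par_Par: "v \<in> pts H \<Longrightarrow> Par k (Par l v) = Par l (Par k v)"
  by (induction k) (simp_all add: A_Par)

lemma Par_selfadjoint: "u \<in> pts H \<Longrightarrow> v \<in> pts H \<Longrightarrow> ip H (Par k u) v = ip H u (Par k v)"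
  by (induction k arbitrary: v) (simp_all add: A_selfadjoint A_Par[symmetric])

lemma Par_ip: "u \<in> pts H \<Longrightarrow> v \<in> pts H \<Longrightarrow> ip H (Par k u) (Par k v) = ip H u v"
  by (simp add: Par_selfadjoint Par_sq)

lemma Par_S: "v \<in> pts H \<Longrightarrow>
    Par k (S n v) = (if n div 2 < k then vminus H (S n (Par k v)) else S n (Par k v))"
  by (induction k) (auto simp: A_S A_minus less_Suc_eq op_minus[OF S_op])

text \<open>In the model, \<open>U k\<close> is \<open>c k\<close> composed with the normalised translation by \<open>delta k\<close>.\<close>

definition U :: "nat \<Rightarrow> 'h \<Rightarrow> 'h" where
  "U k v = smul H \<i> (Par k (S (2 * k) v))"

lemma U_op: "operator (U k)"
  unfolding U_def[abs_def] by (rule op_scale[OF op_comp[OF Par_op S_op]])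

lemmas U_in [simp] = op_in[OF U_op]

lemma U_ip: "u \<in> pts H \<Longrightarrow> v \<in> pts H \<Longrightarrow> ip H (U k u) (U k v) = ip H u v"
  by (simp add: U_def Par_ip S_ip flip: mult.assoc)

lemma U_sq: "v \<in> pts H \<Longrightarrow> U k (U k v) = v"
proof -
  assume v: "v \<in> pts H"
  have "Par k (S (2 * k) (Par k (S (2 * k) v))) = vminus H v"
  proof -
    have "S (2 * k) (Par k (S (2 * k) v)) = Par k (S (2 * k) (S (2 * k) v))"
      using Par_S[of "S (2 * k) v" k "2 * k"] v by simp
    then show ?thesis using v by (simp add: S_sq op_minus[OF Par_op] Par_sq)
  qed
  then show ?thesis
    using v by (simp add: U_def op_smul[OF S_op] op_smul[OF Par_op] smul_smul)
      (simp add: vminus_def smul_smul smul_one)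
qed

text \<open>The sign from exchanging \<open>S (2 * k)\<close> and \<open>S (2 * l)\<close> is
  cancelled by the one from moving \<open>S (2 * k)\<close> past \<open>Par l\<close>, which
  contains \<open>A k\<close>; moving \<open>S (2 * l)\<close> past \<open>Par k\<close> costs
  nothing.\<close>

lemma U_comm_less: "v \<in> pts H \<Longrightarrow> k < l \<Longrightarrow> U k (U l v) = U l (U k v)"
proof -
  assume v: "v \<in> pts H" and kl: "k < l"
  have 1: "S (2 * k) (Par l (S (2 * l) v)) = vminus H (Par l (S (2 * k) (S (2 * l) v)))"
    using Par_S[of "S (2 * l) v" l "2 * k"] v kl by simp
  have 2: "S (2 * l) (Par k (S (2 * k) v)) = Par k (S (2 * l) (S (2 * k) v))"
    using Par_S[of "S (2 * k) v" k "2 * l"] v kl by simp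
  have 3: "S (2 * l) (S (2 * k) v) = vminus H (S (2 * k) (S (2 * l) v))"
    using S_anti[of "2 * l" "2 * k" v] v kl by simp
  show ?thesis
    using v by (simp add: U_def op_smul[OF S_op] op_smul[OF Par_op] smul_smul 1 2 3
        op_minus[OF Par_op] Par_Par[of _ k l])
qed

lemma U_comm: "v \<in> pts H \<Longrightarrow> U k (U l v) = U l (U k v)"
  by (metis U_comm_less linorder_neqE_nat)

lemma A_U: "v \<in> pts H \<Longrightarrow> A j (U k v) = (if j = k then vminus H (U k (A j v)) else U k (A j v))"
  by (simp add: U_def A_smul A_Par A_S op_minus[OF Par_op])
    (simp add: vminus_def smul_smul)

lemma S_even: "v \<in> pts H \<Longrightarrow> S (2 * k) v = smul H (- \<i>) (Par k (U k v))"
  by (simp add: U_def op_smul[OF Par_op] smul_smul smul_one Par_sq)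

lemma S_odd: "v \<in> pts H \<Longrightarrow> S (Suc (2 * k)) v = Par (Suc k) (U k v)"
proof -
  assume v: "v \<in> pts H"
  have "Par (Suc k) (U k v) = smul H \<i> (A k (S (2 * k) v))"
    using v by (simp add: U_def op_smul[OF Par_op] A_smul Par_sq)
  also have "\<dots> = S (Suc (2 * k)) v"
    using v by (simp add: A_def smul_smul smul_one S_anti[of "Suc (2 * k)" "2 * k"] S_sq op_minus[OF S_op])
  finally show ?thesis by simp
qed

definition sg :: "bool \<Rightarrow> complex" where "sg b = (if b then - 1 else 1)"

text \<open>The product of the projections \<open>(1 + sg (s j) A j) / 2\<close> over
  \<open>j < n\<close>. It becomes multiplication by the indicator of \<open>cyl n s\<close>, see
  \<open>Phi_E\<close>.\<close>

primrec E :: "nat \<Rightarrow> bseq \<Rightarrow> 'h \<Rightarrow> 'h" where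
  "E 0 s v = v"
| "E (Suc n) s v = smul H (1 / 2) (vadd H (E n s v) (smul H (sg (s n)) (A n (E n s v))))"

lemma E_op: "operator (E n s)"
proof (induction n)
  case 0
  then show ?case by (simp add: operator_def clinear_map_def)
next
  case (Suc n)
  note [simp] = op_in[OF Suc]
  show ?case
    unfolding operator_def clinear_map_def
  proof (intro conjI ballI allI)
    fix u v assume uv: "u \<in> pts H" "v \<in> pts H"
    show "E (Suc n) s (vadd H u v) = vadd H (E (Suc n) s u) (E (Suc n) s v)"
      by (rule eq_by_ip) (use uv in \<open>auto simp: op_add[OF Suc] A_add algebra_simps add_divide_distrib\<close>)
  next
    fix a v assume v: "v \<in> pts H"
    show "E (Suc n) s (smul H a v) = smul H a (E (Suc n) s v)"
      by (rule eq_by_ip) (use v in \<open>auto simp: op_smul[OF Suc] A_smul algebra_simps add_divide_distrib\<close>)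
  qed simp
qed

lemmas E_in [simp] = op_in[OF E_op]
lemmas E_zero = op_zero[OF E_op]

lemma sg_real [simp]: "cnj (sg b) = sg b" by (simp add: sg_def)

lemma sg_sq [simp]: "sg b * sg b = 1" by (simp add: sg_def)

lemma E_cong: "(\<And>j. j < n \<Longrightarrow> s j = t j) \<Longrightarrow> E n s v = E n t v"
  by (induction n) simp_all

lemma A_E: "v \<in> pts H \<Longrightarrow> A k (E n s v) = E n s (A k v)"
proof (induction n)
  case (Suc n)
  have "A k (A n (E n s v)) = A n (E n s (A k v))"
    using Suc A_commute[of "E n s v" k n] by simp
  then show ?case using Suc by (simp add: A_smul A_add)
qed simp

lemma A_E_less:
  "v \<in> pts H \<Longrightarrow> k < n \<Longrightarrow> A k (E n s v) = smul H (sg (s k)) (E n s v)"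
proof (induction n)
  case (Suc n)
  show ?case
  proof (cases "k = n")
    case True
    show ?thesis
      by (rule eq_by_ip) (use Suc True in \<open>auto simp: A_smul A_add A_sq algebra_simps\<close>)
  next
    case False
    then have IH: "A k (E n s v) = smul H (sg (s k)) (E n s v)" using Suc by simp
    have "A k (A n (E n s v)) = A n (smul H (sg (s k)) (E n s v))"
      using Suc.prems A_commute[of "E n s v" k n] IH by simp
    then show ?thesis
      by (intro eq_by_ip) (use Suc.prems IH in \<open>auto simp: A_smul A_add algebra_simps\<close>)
  qed
qed simp

lemma E_selfadjoint: "u \<in> pts H \<Longrightarrow> v \<in> pts H \<Longrightarrow> ip H (E n s u) v = ip H u (E n s v)"
proof (induction n arbitrary: v)
  case (Suc n)
  then show ?case by (simp add: A_selfadjoint A_E[symmetric])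
qed simp

lemma E_E:
  assumes v: "v \<in> pts H"
  shows "m \<le> n \<Longrightarrow> E m s (E n t v) = (if t \<in> cyl m s then E n t v else vzero H)"
proof (induction m)
  case (Suc m)
  then have IH: "E m s (E n t v) = (if t \<in> cyl m s then E n t v else vzero H)" by simp
  have st: "t \<in> cyl (Suc m) s \<longleftrightarrow> t \<in> cyl m s \<and> t m = s m"
    by (auto simp: cyl_def less_Suc_eq)
  have Am: "A m (E n t v) = smul H (sg (t m)) (E n t v)" using v Suc.prems by (intro A_E_less) auto
  show ?case
  proof (cases "t \<in> cyl m s")
    case True
    show ?thesis
    proof (rule eq_by_ip)
      fix w assume w: "w \<in> pts H"
      have "sg (s m) * sg (t m) = (if t m = s m then 1 else - 1)" by (simp add: sg_def)
      then show "ip H (E (Suc m) s (E n t v)) w = ip H (if t \<in> cyl (Suc m) s then E n t v else vzero H) w"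
        using v w True IH Am st by (simp add: algebra_simps smul_smul)
    qed (use v in auto)
  next
    case False
    then show ?thesis
      using IH st op_zero[OF A_op, of m] by (intro eq_by_ip) auto
  qed
qed simp

lemma E_comm: "v \<in> pts H \<Longrightarrow> E m s (E n t v) = E n t (E m s v)"
proof (induction m)
  case (Suc m)
  then show ?case by (simp add: A_E op_smul[OF E_op] op_add[OF E_op])
qed simp

lemma E_split: "v \<in> pts H \<Longrightarrow>
    E n s v = vadd H (E (Suc n) (s(n := False)) v) (E (Suc n) (s(n := True)) v)"
proof -
  assume v: "v \<in> pts H"
  have eq: "E n (s(n := b)) v = E n s v" for b by (rule E_cong) simp
  show ?thesis
    by (rule eq_by_ip) (use v in \<open>auto simp: eq sg_def algebra_simps\<close>)
qed

text \<open>\<open>U k\<close> anticommutes with \<open>A k\<close> and commutes with every other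
  \<open>A j\<close>, so it exchanges the two eigenspaces of \<open>A k\<close>: coordinate
  \<open>k\<close> of the cylinder is flipped.\<close>

lemma U_E: "v \<in> pts H \<Longrightarrow> U k (E n s v) = E n (s \<oplus> delta k) (U k v)"
proof (induction n)
  case (Suc n)
  have b: "sg ((s \<oplus> delta k) n) = (if n = k then - sg (s n) else sg (s n))"
    by (auto simp: sg_def bplus_def delta_def)
  have "U k (A n (E n s v)) = (if n = k then vminus H (A n (U k (E n s v))) else A n (U k (E n s v)))"
    using A_U[of "E n s v" n k] Suc.prems by (cases "n = k") auto
  then show ?case
    using Suc b by (auto simp: op_smul[OF U_op] op_add[OF U_op] minus_smul)
qed simp

text \<open>A nonzero vector orthogonal to all the cyclic subspaces could be normalised and added to
  a maximal set. In \<open>orth\<close> a projection on one side is enough: the projections are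
  self-adjoint, and the product of two of them is again one of them or zero.\<close>

lemma cyclic_family_exists:
  "\<exists>w::nat \<Rightarrow> 'h. (\<forall>m. w m \<in> pts H \<and> vnorm H (w m) \<le> (1/2)^m) \<and>
     (\<forall>m m' n s. m \<noteq> m' \<longrightarrow> ip H (E n s (w m)) (w m') = 0) \<and>
     (\<forall>v\<in>pts H. (\<forall>m n s. ip H v (E n s (w m)) = 0) \<longrightarrow> v = vzero H)"
proof -
  define orth where "orth u v \<longleftrightarrow> (\<forall>n s. ip H (E n s u) v = 0)" for u v
  define \<W> where "\<W> = {W. W \<subseteq> pts H \<and> (\<forall>w\<in>W. vnorm H w = 1) \<and>
      (\<forall>u\<in>W. \<forall>v\<in>W. u \<noteq> v \<longrightarrow> orth u v)}"
  have "\<exists>W\<in>\<W>. \<forall>X\<in>\<W>. W \<subseteq> X \<longrightarrow> X = W"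
  proof (rule subset_Zorn')
    fix C assume C: "subset.chain \<W> C"
    have "orth u v" if "u \<in> \<Union> C" "v \<in> \<Union> C" "u \<noteq> v" for u v
    proof -
      obtain X Y where X: "X \<in> C" "u \<in> X" and Y: "Y \<in> C" "v \<in> Y" using \<open>u \<in> \<Union> C\<close> \<open>v \<in> \<Union> C\<close> by auto
      have "X \<subseteq> Y \<or> Y \<subseteq> X" using C X Y by (auto simp: subset.chain_def subset_chain_def)
      moreover have "X \<in> \<W>" "Y \<in> \<W>" using C X Y by (auto simp: subset_chain_def)
      ultimately show ?thesis using X Y \<open>u \<noteq> v\<close> by (auto simp: \<W>_def)
    qed
    moreover have "C \<subseteq> \<W>" using C by (auto simp: subset_chain_def)
    ultimately show "\<Union> C \<in> \<W>" by (auto simp: \<W>_def)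
  qed
  then obtain W where W: "W \<in> \<W>" and max: "\<And>X. X \<in> \<W> \<Longrightarrow> W \<subseteq> X \<Longrightarrow> X = W" by blast
  have W_in: "v \<in> pts H" "vnorm H v = 1" if "v \<in> W" for v using W that by (auto simp: \<W>_def)
  have W_orth: "orth u v" if "u \<in> W" "v \<in> W" "u \<noteq> v" for u v using W that by (auto simp: \<W>_def)
  have "countable W"
  proof -
    obtain D where D: "countable D" "D \<subseteq> pts H" "\<forall>v\<in>pts H. \<forall>e>0. \<exists>d\<in>D. vdist H v d < e"
      using separable by (auto simp: separable_cspace_def)
    \<comment> \<open>Distinct members of \<open>W\<close> are at distance \<open>sqrt 2\<close>, so
      no point of \<open>D\<close> is within 1/2 of two of them; this makes the choice
      \<open>d\<close> injective.\<close>
    have "\<exists>d\<in>D. vdist H v d < 1 / 2" if "v \<in> W" for v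
      using D(3)[rule_format, OF W_in(1)[OF that], of "1 / 2"] by simp
    then obtain d where d: "\<And>v. v \<in> W \<Longrightarrow> d v \<in> D \<and> vdist H v (d v) < 1 / 2" by metis
    have "inj_on d W"
    proof (rule inj_onI, rule ccontr)
      fix u v assume uv: "u \<in> W" "v \<in> W" "d u = d v" "u \<noteq> v"
      have dv: "d v \<in> pts H" using d uv D(2) by blast
      have "ip H u v = 0" using W_orth[OF uv(1,2,4)] unfolding orth_def by (metis E.simps(1))
      then have "(vdist H u v)\<^sup>2 = 2" using uv W_in by (simp add: vdist_sq)
      moreover have "vdist H u v \<le> vdist H u (d v) + vdist H (d v) v"
        using uv W_in dv by (intro vdist_triangle) auto
      moreover have "vdist H u (d v) < 1 / 2" "vdist H (d v) v < 1 / 2"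
        using d[OF uv(1)] d[OF uv(2)] uv(3) vdist_commute[OF dv, of v] W_in[OF uv(2)] by auto
      ultimately have "(vdist H u v)\<^sup>2 \<le> 1\<^sup>2" using uv W_in by (intro power_mono) auto
      then show False using \<open>(vdist H u v)\<^sup>2 = 2\<close> by simp
    qed
    moreover have "countable (d ` W)" by (rule countable_subset[OF _ D(1)]) (use d in auto)
    ultimately show ?thesis by (rule countable_image_inj_on[rotated])
  qed
  define I where "I = to_nat_on W ` W"
  \<comment> \<open>Indices outside \<open>I\<close> get the zero vector, whose cyclic subspace is
    trivial; finite \<open>W\<close> is covered in this way.\<close>
  define g where "g m = (if m \<in> I then from_nat_into W m else vzero H)" for m
  have g_I: "g m \<in> W \<and> to_nat_on W (g m) = m" if "m \<in> I" for m
    using that \<open>countable W\<close> by (auto simp: g_def I_def)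
  have g_out: "g m = vzero H" if "m \<notin> I" for m using that by (simp add: g_def)
  have g_in: "g m \<in> pts H" for m using g_I[of m] g_out[of m] W_in by (cases "m \<in> I") auto
  have g_orth: "orth (g m) (g m')" if "m \<noteq> m'" for m m'
  proof (cases "m \<in> I \<and> m' \<in> I")
    case True
    then have "g m \<noteq> g m'" using g_I[of m] g_I[of m'] that by auto
    then show ?thesis using True g_I by (intro W_orth) auto
  next
    case False
    then show ?thesis using g_out[of m] g_out[of m'] g_in by (auto simp: orth_def E_zero)
  qed
  \<comment> \<open>The squared norms, which become the total masses of the measures
    \<open>M m\<close>, are then at most \<open>(1/4)^m\<close> and have a finite sum.\<close>
  define w where "w m = smul H (complex_of_real ((1/2)^m)) (g m)" for m
  have w_in: "w m \<in> pts H" for m using g_in by (simp add: w_def)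
  have g_norm: "vnorm H (g m) \<le> 1" for m
    using g_I[of m] g_out[of m] W_in[of "g m"] vnorm_eq_0[of "vzero H"] by (cases "m \<in> I") auto
  have w_norm: "vnorm H (w m) \<le> (1/2)^m" for m
    using g_norm[of m] g_in[of m] by (simp add: w_def vnorm_smul norm_power mult_left_le)
  have w_orth: "ip H (E n s (w m)) (w m') = 0" if "m \<noteq> m'" for m m' n s
    using g_orth[OF that] g_in by (simp add: w_def op_smul[OF E_op] orth_def)
  have total: "v = vzero H" if v: "v \<in> pts H" and z: "\<forall>m n s. ip H v (E n s (w m)) = 0" for v
  proof (rule ccontr)
    assume nz: "v \<noteq> vzero H"
    then have n0: "vnorm H v > 0" using v vnorm_nonneg[OF v] by (simp add: vnorm_eq_0 less_le)
    have vW: "ip H v (E n s a) = 0" if "a \<in> W" for a n s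
    proof -
      define m where "m = to_nat_on W a"
      have "m \<in> I" using that by (simp add: I_def m_def)
      then have "g m = a" using \<open>countable W\<close> that by (simp add: g_def m_def)
      then have "w m = smul H (complex_of_real ((1/2)^m)) a" by (simp add: w_def)
      then show ?thesis using z[rule_format, of n s m] v W_in[OF that] by (simp add: op_smul[OF E_op])
    qed
    define u where "u = smul H (complex_of_real (1 / vnorm H v)) v"
    have u: "u \<in> pts H" using v by (simp add: u_def)
    have u1: "vnorm H u = 1" using v n0 by (simp add: u_def vnorm_smul norm_divide)
    have uW: "ip H u (E n s a) = 0" if "a \<in> W" for a n s
      using vW[OF that] v W_in[OF that] by (simp add: u_def)
    have o1: "orth u a" if "a \<in> W" for a
      using uW[OF that] u W_in[OF that] by (simp add: orth_def E_selfadjoint)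
    have o2: "orth a u" if "a \<in> W" for a
      unfolding orth_def
    proof (intro allI)
      fix n s
      have "ip H (E n s a) u = cnj (ip H u (E n s a))" using W_in[OF that] u by (intro ip_cnj) auto
      then show "ip H (E n s a) u = 0" using uW[OF that] by simp
    qed
    have "insert u W \<in> \<W>" using W u u1 o1 o2 by (auto simp: \<W>_def)
    then have "insert u W = W" by (rule max) auto
    then have "u \<in> W" by blast
    then have "ip H u (E 0 (\<lambda>_. False) u) = 0" by (rule uW)
    then have "vnorm H u = 0" using u by (simp add: vnorm_def)
    then show False using u1 by simp
  qed
  show ?thesis
  proof (intro exI[of _ w] conjI allI impI ballI)
    show "v = vzero H" if "v \<in> pts H" "\<forall>m n s. ip H v (E n s (w m)) = 0" for v
      using that by (rule total)
  qed (simp_all add: w_in w_norm w_orth)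
qed

end

section \<open>From spinor structures to triples\<close>

context section_space
begin

section \<open>Bounded multiplication operators on the direct integral\<close>

definition multiplier :: "(bseq \<Rightarrow> complex) \<Rightarrow> bool" where
  "multiplier \<phi> \<longleftrightarrow> \<phi> \<in> borel_measurable \<mu> \<and> (\<forall>x. cmod (\<phi> x) \<le> 1)"

lemma multiplier_L2: "multiplier \<phi> \<Longrightarrow> f \<in> L2 \<Longrightarrow> (\<lambda>x n. \<phi> x * f x n) \<in> L2"
  by (rule L2_mult[where B = 1]) (auto simp: multiplier_def)

lemma mulD_in: "multiplier \<phi> \<Longrightarrow> F \<in> pts D \<Longrightarrow> mulD \<phi> F \<in> pts D"
  unfolding mulD_def by (intro cls_in_D multiplier_L2 rep_D)

lemma mulD_mulD:
  assumes "multiplier \<psi>" "F \<in> pts D"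
  shows "mulD \<phi> (mulD \<psi> F) = mulD (\<lambda>x. \<phi> x * \<psi> x) F"
proof -
  have "mulD \<phi> (cls (\<lambda>x n. \<psi> x * rep F x n)) = cls (\<lambda>x n. \<phi> x * (\<psi> x * rep F x n))"
    by (rule mulD_cls) (intro multiplier_L2 assms rep_D)
  then show ?thesis unfolding mulD_def[of \<psi> F] by (simp add: mulD_def mult.assoc)
qed

lemma mulD_selfadjoint:
  assumes phi: "multiplier \<phi>" and real: "\<And>x. cnj (\<phi> x) = \<phi> x"
    and F: "F \<in> pts D" and G: "G \<in> pts D"
  shows "ip D (mulD \<phi> F) G = ip D F (mulD \<phi> G)"
proof -
  note f = rep_D[OF F] and g = rep_D[OF G]
  have "ip D (mulD \<phi> F) (cls (rep G)) = (\<integral>x. \<phi> x * ip (fibre \<nu> x) (rep F x) (rep G x) \<partial>\<mu>)"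
    unfolding mulD_def D_ip[OF multiplier_L2[OF phi f(1)] g(1)]
    using model.ip_smul[OF L2_fibre[OF f(1)] L2_fibre[OF g(1)]] by simp
  moreover have "ip D (cls (rep F)) (mulD \<phi> G) = (\<integral>x. \<phi> x * ip (fibre \<nu> x) (rep F x) (rep G x) \<partial>\<mu>)"
    unfolding mulD_def D_ip[OF f(1) multiplier_L2[OF phi g(1)]]
    using model.ip_smul_right[OF L2_fibre[OF g(1)] L2_fibre[OF f(1)]] real by simp
  ultimately show ?thesis by (simp add: f g)
qed

lemma mulD_add:
  assumes phi: "multiplier \<phi>" and F: "F \<in> pts D" and G: "G \<in> pts D"
  shows "mulD \<phi> (vadd D F G) = vadd D (mulD \<phi> F) (mulD \<phi> G)"
proof -
  note f = rep_D[OF F] and g = rep_D[OF G]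
  have "mulD \<phi> (vadd D (cls (rep F)) (cls (rep G))) = cls (\<lambda>x n. \<phi> x * (rep F x n + rep G x n))"
    unfolding D_add[OF f(1) g(1)] by (rule mulD_cls) (intro L2_add f g)
  also have "\<dots> = vadd D (mulD \<phi> F) (mulD \<phi> G)"
    unfolding mulD_def D_add[OF multiplier_L2[OF phi f(1)] multiplier_L2[OF phi g(1)]]
    by (simp add: distrib_left)
  finally show ?thesis by (simp add: f g)
qed

lemma mulD_smul:
  assumes "multiplier \<phi>" "F \<in> pts D"
  shows "smul D a (mulD \<phi> F) = mulD (\<lambda>x. a * \<phi> x) F"
  unfolding mulD_def D_smul[OF multiplier_L2[OF assms(1) rep_D(1)[OF assms(2)]]]
  by (simp add: mult.assoc)

lemma mulD_zero: "mulD (\<lambda>x. 0) F = vzero D"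
  by (simp add: mulD_def D_zero)

lemma mulD_one: "F \<in> pts D \<Longrightarrow> mulD (\<lambda>x. 1) F = F"
  by (simp add: mulD_def rep_D)

end

context spinor_space
begin

definition mass :: "'h \<Rightarrow> nat \<Rightarrow> bseq \<Rightarrow> real" where
  "mass v n s = Re (ip H (E n s v) v)"

lemma mass_norm:
  assumes v: "v \<in> pts H" shows "ip H (E n s v) v = complex_of_real (mass v n s)" "0 \<le> mass v n s"
proof -
  have "s \<in> cyl n s" by (simp add: cyl_def)
  then have "E n s (E n s v) = E n s v" using E_E[OF v, of n n s s] by simp
  then have "ip H (E n s v) v = ip H (E n s v) (E n s v)"
    using E_selfadjoint[of "E n s v" v n s] v by simp
  also have "\<dots> = complex_of_real ((vnorm H (E n s v))\<^sup>2)" using v by (simp add: ip_self)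
  finally have *: "ip H (E n s v) v = complex_of_real ((vnorm H (E n s v))\<^sup>2)" .
  then show "ip H (E n s v) v = complex_of_real (mass v n s)" "0 \<le> mass v n s"
    by (simp_all only: mass_def Re_complex_of_real zero_le_power2)
qed

lemma tree_masses_mass: "v \<in> pts H \<Longrightarrow> tree_masses (mass v)"
proof
  assume v: "v \<in> pts H"
  show "0 \<le> mass v n s" for n s by (rule mass_norm[OF v])
  show "mass v n s = mass v n t" if "\<And>j. j < n \<Longrightarrow> s j = t j" for n s t
    using E_cong[OF that] by (simp add: mass_def)
  show "mass v n s = mass v (Suc n) (s(n := False)) + mass v (Suc n) (s(n := True))" for n s
    unfolding mass_def by (subst E_split[OF v]) (use v in \<open>simp del: E.simps\<close>)
qed

end

locale spinor_model = spinor_space H S for H :: "'h cspace" and S +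
  fixes w :: "nat \<Rightarrow> 'h" and M :: "nat \<Rightarrow> bseq measure" and \<mu> :: "bseq measure"
  assumes w_in [simp]: "w m \<in> pts H"
    and w_orth: "m \<noteq> m' \<Longrightarrow> ip H (E n s (w m)) (w m') = 0"
    and w_total: "\<lbrakk>v \<in> pts H; \<And>m n s. ip H v (E n s (w m)) = 0\<rbrakk> \<Longrightarrow> v = vzero H"
    and sets_M: "sets (M m) = sets borel"
    and M_cyl: "emeasure (M m) (cyl n s) = ennreal (mass (w m) n s)"
    and sets_mu: "sets \<mu> = sets borel"
    and mu_sum: "B \<in> sets borel \<Longrightarrow> emeasure \<mu> B = (\<Sum>m. emeasure (M m) B)"
    and mu_finite: "emeasure \<mu> UNIV < \<infinity>"

lemma (in spinor_space) spinor_model_exists: "\<exists>w M \<mu>. spinor_model H S w M \<mu>"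
proof -
  obtain w where w: "\<And>m. w m \<in> pts H" "\<And>m. vnorm H (w m) \<le> (1/2)^m"
      "\<And>m m' n s. m \<noteq> m' \<Longrightarrow> ip H (E n s (w m)) (w m') = 0"
      "\<And>v. v \<in> pts H \<Longrightarrow> (\<And>m n s. ip H v (E n s (w m)) = 0) \<Longrightarrow> v = vzero H"
    using cyclic_family_exists by metis
  have "\<exists>M. sets M = sets borel \<and> (\<forall>n s. emeasure M (cyl n s) = ennreal (mass (w m) n s))" for m
    by (rule tree_masses.measure_exists[OF tree_masses_mass[OF w(1)]])
  then obtain M where M: "\<And>m. sets (M m) = sets borel"
      "\<And>m n s. emeasure (M m) (cyl n s) = ennreal (mass (w m) n s)" by metis
  obtain \<mu> where mu: "sets \<mu> = sets borel" "\<And>B. B \<in> sets borel \<Longrightarrow> emeasure \<mu> B = (\<Sum>m. emeasure (M m) B)"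
    using measure_sum_exists[of M "borel :: bseq measure", OF M(1)] by metis
  have "emeasure (M m) UNIV \<le> ennreal ((1/4)^m)" for m
  proof -
    have "mass (w m) 0 (\<lambda>_. False) = (vnorm H (w m))\<^sup>2" by (simp add: mass_def vnorm_sq w)
    also have "\<dots> \<le> ((1/2)^m)\<^sup>2" by (intro power_mono w) (simp add: w)
    also have "((1/2)^m)\<^sup>2 = ((1/4)^m :: real)" by (simp add: power2_eq_square flip: power_mult_distrib)
    finally show ?thesis using M(2)[of m 0 "\<lambda>_. False"] by (simp add: ennreal_leI)
  qed
  then have "(\<Sum>m. emeasure (M m) UNIV) \<le> (\<Sum>m. ennreal ((1/4)^m))" by (intro suminf_le) auto
  also have "\<dots> = ennreal (\<Sum>m. (1/4)^m)" by (rule suminf_ennreal2) (auto intro: summable_geometric)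
  also have "\<dots> < \<infinity>" by simp
  finally have "emeasure \<mu> UNIV < \<infinity>" using mu(2)[of UNIV] by simp
  then have "spinor_model H S w M \<mu>"
    by unfold_locales (use w M mu in auto)
  then show ?thesis by blast
qed

context spinor_model
begin

lemma space_mu [simp]: "space \<mu> = UNIV"
  using sets_eq_imp_space_eq[OF sets_mu] by simp

lemma fm: "finite_measure \<mu>"
  by (rule finite_measureI) (use mu_finite in auto)

interpretation fm: finite_measure \<mu> by (rule fm)

lemma M_le: "B \<in> sets borel \<Longrightarrow> emeasure (M m) B \<le> emeasure \<mu> B"
  unfolding mu_sum by (rule ennreal_le_suminf)

definition dens :: "nat \<Rightarrow> bseq \<Rightarrow> real" where
  "dens m x = enn2real (RN_deriv \<mu> (M m) x)"

lemma dens_nonneg [simp]: "0 \<le> dens m x" by (simp add: dens_def)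

lemma dens_measurable [measurable]: "dens m \<in> borel_measurable \<mu>"
  unfolding dens_def by measurable

lemma dens_density: "density \<mu> (\<lambda>x. ennreal (dens m x)) = M m"
proof -
  have ac: "absolutely_continuous \<mu> (M m)"
    unfolding absolutely_continuous_def
  proof
    fix N assume N: "N \<in> null_sets \<mu>"
    then have "emeasure (M m) N \<le> 0" using M_le[of N m] sets_mu by (auto simp: null_sets_def)
    then show "N \<in> null_sets (M m)" using N sets_mu sets_M[of m] by (auto simp: null_sets_def)
  qed
  have sets_eq: "sets (M m) = sets \<mu>" by (simp add: sets_M sets_mu)
  have "finite_measure (M m)"
  proof (rule finite_measureI)
    have "emeasure (M m) UNIV < \<infinity>" using M_le[of UNIV m] mu_finite by (auto intro: le_less_trans)
    then show "emeasure (M m) (space (M m)) \<noteq> \<infinity>"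
      using sets_eq_imp_space_eq[OF sets_M[of m]] by simp
  qed
  then have "AE x in \<mu>. RN_deriv \<mu> (M m) x \<noteq> \<infinity>"
    by (intro fm.RN_deriv_finite ac sets_eq finite_measure.axioms(1))
  then have "AE x in \<mu>. ennreal (dens m x) = RN_deriv \<mu> (M m) x"
    by (rule eventually_mono) (simp add: dens_def less_top)
  then have "density \<mu> (\<lambda>x. ennreal (dens m x)) = density \<mu> (RN_deriv \<mu> (M m))"
    by (intro density_cong) auto
  then show ?thesis by (simp add: fm.density_RN_deriv[OF ac sets_eq])
qed

lemma M_eq: "B \<in> sets borel \<Longrightarrow> emeasure (M m) B = (\<integral>\<^sup>+x. ennreal (dens m x) * indicator B x \<partial>\<mu>)"
  using emeasure_density[of "\<lambda>x. ennreal (dens m x)" \<mu> B] by (simp add: dens_density sets_mu)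

text \<open>Where every density vanishes, each \<open>M m\<close> and hence their sum
  \<open>\<mu>\<close> has no mass. At such points no generator would reach the fibre.\<close>

lemma AE_supp: "AE x in \<mu>. \<exists>m. dens m x > 0"
proof -
  define Z where "Z = {x. \<forall>m. \<not> dens m x > 0}"
  have "Measurable.pred \<mu> (\<lambda>x. \<forall>m. \<not> dens m x > 0)" by measurable
  then have Z: "Z \<in> sets \<mu>" unfolding Z_def pred_def by simp
  have "emeasure (M m) Z = 0" for m
  proof -
    have "emeasure (M m) Z = (\<integral>\<^sup>+x. ennreal (dens m x) * indicator Z x \<partial>\<mu>)"
      using Z by (intro M_eq) (simp add: sets_mu)
    also have "\<dots> = (\<integral>\<^sup>+x. 0 \<partial>\<mu>)"
      by (rule nn_integral_cong) (auto simp: Z_def indicator_def not_less intro: antisym)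
    finally show ?thesis by simp
  qed
  then have "emeasure \<mu> Z = 0" using mu_sum[of Z] Z by (simp add: sets_mu)
  then have "Z \<in> null_sets \<mu>" using Z by auto
  then show ?thesis by (rule AE_I') (auto simp: Z_def)
qed

text \<open>A generator \<open>m\<close> with positive density at \<open>x\<close> is assigned the
  basis vector numbered by the count of positive densities before it. The active generators thus
  fill an initial segment of the coordinates, as the model space demands (\<open>rank_inj\<close>,
  \<open>rank_hits\<close>).\<close>

primrec rank :: "bseq \<Rightarrow> nat \<Rightarrow> nat" where
  "rank x 0 = 0"
| "rank x (Suc m) = (if dens m x > 0 then Suc (rank x m) else rank x m)"

text \<open>
  The dimension is the number of positive densities; the maximum with 1 only matters on a null set,
  but fibres have to be nonzero everywhere.
\<close>

definition nu :: "bseq \<Rightarrow> enat" where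
  "nu x = max 1 (SUP m. enat (rank x m))"

lemma rank_measurable [measurable]: "(\<lambda>x. rank x m) \<in> measurable \<mu> (count_space UNIV)"
proof (induction m)
  case (Suc m)
  note [measurable] = Suc
  have "(\<lambda>x. Suc (rank x m)) \<in> measurable \<mu> (count_space UNIV)"
    by (rule measurable_compose[OF Suc]) simp
  note [measurable] = this
  show ?case unfolding rank.simps by measurable
qed simp

lemma nu_measurable: "nu \<in> measurable \<mu> (count_space UNIV)"
proof -
  have "(\<lambda>x. enat (rank x m)) \<in> measurable \<mu> (count_space UNIV)" for m
    by (rule measurable_compose[OF rank_measurable]) simp
  then have "(\<lambda>x. SUP m. enat (rank x m)) \<in> measurable \<mu> (count_space UNIV)"
    by (intro measurable_SUP) auto
  then have "(\<lambda>x. max 1 (SUP m. enat (rank x m))) \<in> measurable \<mu> (count_space UNIV)"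
    by (rule measurable_compose) simp
  then show ?thesis unfolding nu_def[abs_def] .
qed

lemma nu_nonzero: "nu x \<noteq> 0"
proof -
  have "1 \<le> nu x" by (simp add: nu_def)
  then show ?thesis by auto
qed

lemma rank_mono: "m \<le> m' \<Longrightarrow> rank x m \<le> rank x m'"
  by (rule lift_Suc_mono_le[of "rank x"]) auto

lemma rank_less:
  assumes "dens m x > 0" "m < m'" shows "rank x m < rank x m'"
  using rank_mono[of "Suc m" m' x] assms by simp

lemma rank_inj: "dens m x > 0 \<Longrightarrow> dens m' x > 0 \<Longrightarrow> m \<noteq> m' \<Longrightarrow> rank x m \<noteq> rank x m'"
  using rank_less[of m x m'] rank_less[of m' x m] by (cases m m' rule: linorder_cases) auto

lemma rank_less_nu: assumes "dens m x > 0" shows "enat (rank x m) < nu x"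
proof -
  have "enat (rank x m) < enat (rank x (Suc m))" using assms by simp
  also have "\<dots> \<le> (SUP m. enat (rank x m))" by (rule SUP_upper) simp
  also have "\<dots> \<le> nu x" by (simp add: nu_def)
  finally show ?thesis .
qed

lemma rank_hits: "j < rank x N \<Longrightarrow> \<exists>m. dens m x > 0 \<and> rank x m = j"
  by (induction N) (auto split: if_splits simp: less_Suc_eq)

lemma rank_onto:
  assumes "\<exists>m. dens m x > 0" "enat j < nu x"
  shows "\<exists>m. dens m x > 0 \<and> rank x m = j"
proof -
  obtain m where m: "dens m x > 0" using assms(1) by blast
  have "1 \<le> enat (rank x (Suc m))" using m by (simp add: one_enat_def)
  also have "\<dots> \<le> (SUP m. enat (rank x m))" by (rule SUP_upper) simp
  finally have "nu x = (SUP m. enat (rank x m))" by (simp add: nu_def max_absorb2)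
  then obtain N where "enat j < enat (rank x N)" using assms(2) by (auto simp: less_SUP_iff)
  then show ?thesis using rank_hits by simp
qed

sublocale section_space \<mu> nu .

text \<open>The intended image of \<open>w m\<close>: its pointwise squared norm is the density of
  \<open>M m\<close>, and the fields of different generators are orthogonal at every point
  (\<open>ip_uu\<close>).\<close>

definition u :: "nat \<Rightarrow> bfield" where
  "u m x = (\<lambda>j. complex_of_real (sqrt (dens m x)) * munit (nu x) (rank x m) j)"

lemma u_in: "u m x \<in> pts (fibre nu x)"
  using model.smul_closed[OF munit_in] by (simp add: u_def)

lemma ip_u:
  assumes "v \<in> pts (fibre nu x)"
  shows "ip (fibre nu x) v (u m x) = complex_of_real (sqrt (dens m x)) * v (rank x m)"
  using model.ip_smul_right[OF munit_in assms, where a = "complex_of_real (sqrt (dens m x))"]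
  by (simp add: u_def ip_munit[OF assms])

lemma ip_uu: "ip (fibre nu x) (u m x) (u m' x) = (if m = m' then complex_of_real (dens m x) else 0)"
proof (cases "dens m x > 0 \<and> dens m' x > 0")
  case True
  then show ?thesis
    using rank_inj[of m x m'] rank_less_nu[of m x]
    by (auto simp: ip_u[OF u_in]) (auto simp: u_def munit_def simp flip: of_real_mult)
next
  case False
  then have "dens m x = 0 \<or> dens m' x = 0" using dens_nonneg[of m x] dens_nonneg[of m' x] by linarith
  then show ?thesis by (auto simp: ip_u[OF u_in]) (auto simp: u_def)
qed

lemma u_section: "measurable_section \<mu> nu (u m)"
proof -
  have "(\<lambda>x. u m x n) \<in> borel_measurable \<mu>" for n
  proof -
    have [measurable]: "(\<lambda>x. munit (nu x) (rank x m) n) \<in> borel_measurable \<mu>"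
      by (rule measurable_compose_countable[OF _ nu_measurable])
        (rule measurable_compose[OF rank_measurable], simp)
    show ?thesis unfolding u_def by measurable
  qed
  then show ?thesis using u_in by (simp add: measurable_section_def)
qed

lemma sq_sum_u: "sq_sum (u m x) = ennreal (dens m x)"
  by (simp add: section_sq_sum[OF u_section] model.vnorm_sq u_in ip_uu)

lemma u_L2 [simp]: "u m \<in> L2"
proof -
  have "(\<integral>\<^sup>+x. sq_sum (u m x) \<partial>\<mu>) = emeasure (M m) UNIV"
    using M_eq[of UNIV m] by (simp add: sq_sum_u)
  also have "\<dots> < \<infinity>" using M_le[of UNIV m] mu_finite by (auto intro: le_less_trans)
  finally show ?thesis using u_section by (simp add: L2_iff)
qed

lemma ind_multiplier: "multiplier (indicator (cyl n s))"
  by (auto simp: multiplier_def indicator_def sets_mu measurable_cong_sets[OF sets_mu refl])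

text \<open>The index includes the cylinder, so that the cylinder projections map generators to
  generators or to zero.\<close>

definition cyc_vec :: "nat \<times> bseq \<times> nat \<Rightarrow> 'h" where
  "cyc_vec = (\<lambda>(n, s, m). E n s (w m))"

definition cyc_sec :: "nat \<times> bseq \<times> nat \<Rightarrow> bfield set" where
  "cyc_sec = (\<lambda>(n, s, m). mulD (indicator (cyl n s)) (cls (u m)))"

lemma cyc_vec_in [simp]: "cyc_vec i \<in> pts H" by (simp add: cyc_vec_def split: prod.split)

lemma cyc_sec_in [simp]: "cyc_sec i \<in> pts D" by (simp add: cyc_sec_def mulD_in ind_multiplier split: prod.split)

lemma E_cyc_vec: "E n s (cyc_vec (n', t, m)) = (if n \<le> n' then if t \<in> cyl n s then cyc_vec (n', t, m) else vzero H
    else if s \<in> cyl n' t then cyc_vec (n, s, m) else vzero H)"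
proof (cases "n \<le> n'")
  case True
  then show ?thesis by (simp add: cyc_vec_def E_E)
next
  case False
  then show ?thesis using E_comm[of "w m" n s n' t] by (simp add: cyc_vec_def E_E)
qed

lemma mul_cyc_sec: "mulD (indicator (cyl n s)) (cyc_sec (n', t, m)) =
    (if n \<le> n' then if t \<in> cyl n s then cyc_sec (n', t, m) else vzero D
     else if s \<in> cyl n' t then cyc_sec (n, s, m) else vzero D)"
proof -
  have "mulD (indicator (cyl n s)) (cyc_sec (n', t, m)) = mulD (indicator (cyl n s \<inter> cyl n' t)) (cls (u m))"
    by (simp add: cyc_sec_def mulD_mulD ind_multiplier flip: indicator_inter_arith)
  moreover have "indicator {} = (\<lambda>x::bseq. 0::complex)" by (auto simp: fun_eq_iff)
  then have "mulD (indicator {}) (cls (u m)) = vzero D" by (simp only: mulD_zero)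
  ultimately show ?thesis
    using cyl_Int[of n n' s t] cyl_Int[of n' n t s] by (auto simp: cyc_sec_def Int_commute)
qed

lemma ip_cyc_sec_u: "ip D (cyc_sec (n, s, m)) (cls (u m')) = (if m = m' then complex_of_real (mass (w m) n s) else 0)"
proof -
  have L: "(\<lambda>x j. indicator (cyl n s) x * u m x j) \<in> L2"
    by (rule multiplier_L2[OF ind_multiplier]) simp
  have "ip D (cyc_sec (n, s, m)) (cls (u m')) =
      (\<integral>x. indicator (cyl n s) x * ip (fibre nu x) (u m x) (u m' x) \<partial>\<mu>)"
    unfolding cyc_sec_def prod.case mulD_cls[OF u_L2] D_ip[OF L u_L2]
    using model.ip_smul[OF u_in u_in] by simp
  also have "\<dots> = (\<integral>x. complex_of_real (if m = m' then dens m x * indicator (cyl n s) x else 0) \<partial>\<mu>)"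
    by (rule Bochner_Integration.integral_cong) (auto simp: ip_uu indicator_def)
  also have "\<dots> = complex_of_real (\<integral>x. (if m = m' then dens m x * indicator (cyl n s) x else 0) \<partial>\<mu>)"
    by (rule integral_complex_of_real)
  also have "(\<integral>x. (if m = m' then dens m x * indicator (cyl n s) x else 0) \<partial>\<mu>) =
      (if m = m' then mass (w m) n s else 0)"
  proof (cases "m = m'")
    case True
    have [measurable]: "cyl n s \<in> sets \<mu>" by (simp add: sets_mu)
    have "(\<integral>\<^sup>+x. ennreal (dens m x * indicator (cyl n s) x) \<partial>\<mu>) = ennreal (mass (w m) n s)"
      unfolding M_cyl[symmetric] M_eq[OF cyl_borel]
      by (rule nn_integral_cong) (simp add: indicator_def)
    then have "(\<integral>x. dens m x * indicator (cyl n s) x \<partial>\<mu>) = mass (w m) n s"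
      by (intro integral_eq_nn_integral[THEN trans]) (auto simp: mass_norm)
    then show ?thesis using True by simp
  qed simp
  finally show ?thesis by simp
qed

lemma ip_cyc_vec_w: "ip H (cyc_vec (n, s, m)) (w m') = (if m = m' then complex_of_real (mass (w m) n s) else 0)"
  by (simp add: cyc_vec_def w_orth mass_norm)

text \<open>Moving the projection of \<open>j\<close> to the other side turns the generator
  \<open>i\<close> into a generator or zero, by the same rule in \<open>H\<close> and in
  \<open>D\<close>. What remains is the mass of a cylinder, the common value in
  \<open>ip_cyc_vec_w\<close> and \<open>ip_cyc_sec_u\<close>.\<close>

lemma gram: "ip H (cyc_vec i) (cyc_vec j) = ip D (cyc_sec i) (cyc_sec j)"
proof -
  interpret D: complex_inner_space D by (rule D_inner)
  obtain n s m where i: "i = (n, s, m)" by (cases i) auto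
  obtain n' t m' where j: "j = (n', t, m')" by (cases j) auto
  have "ip H (cyc_vec i) (cyc_vec j) = ip H (E n' t (cyc_vec i)) (w m')"
    unfolding i j by (simp add: cyc_vec_def E_selfadjoint)
  moreover have "cyc_sec j = mulD (indicator (cyl n' t)) (cls (u m'))" by (simp add: j cyc_sec_def)
  then have "ip D (cyc_sec i) (cyc_sec j) = ip D (mulD (indicator (cyl n' t)) (cyc_sec i)) (cls (u m'))"
    using mulD_selfadjoint[OF ind_multiplier _ cyc_sec_in[of i] cls_in_D[OF u_L2[of m']], of n' t]
    by (simp add: indicator_def)
  ultimately show ?thesis
    by (simp add: i E_cyc_vec mul_cyc_sec ip_cyc_sec_u ip_cyc_vec_w)
qed

lemma total_cyc_vec: "total_family H cyc_vec"
  unfolding total_family_def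
proof (intro conjI allI ballI impI)
  fix v assume v: "v \<in> pts H" and z: "\<forall>i. ip H v (cyc_vec i) = 0"
  show "v = vzero H"
  proof (rule w_total[OF v])
    fix m n s show "ip H v (E n s (w m)) = 0" using z[rule_format, of "(n, s, m)"] by (simp add: cyc_vec_def)
  qed
qed simp

text \<open>Orthogonality on all cylinders becomes orthogonality to every \<open>u m x\<close> at
  almost every point. By \<open>rank_onto\<close> each coordinate below the dimension belongs to
  some \<open>u m x\<close> with positive density and hence vanishes.\<close>

lemma total_cyc_sec: "total_family D cyc_sec"
  unfolding total_family_def
proof (intro conjI allI ballI impI)
  fix F assume F: "F \<in> pts D" and z: "\<forall>i. ip D F (cyc_sec i) = 0"
  define f where "f = rep F"
  have f: "f \<in> L2" "F = cls f" using rep_D[OF F] by (simp_all add: f_def)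
  have "AE x in \<mu>. ip (fibre nu x) (f x) (u m x) = 0" for m
  proof (rule complex_eq_AE_by_cylinders[OF sets_mu])
    show "integrable \<mu> (\<lambda>x. ip (fibre nu x) (f x) (u m x))" by (intro ip_integrable f) simp
    fix n s
    have L: "(\<lambda>x j. indicator (cyl n s) x * u m x j) \<in> L2"
      by (rule multiplier_L2[OF ind_multiplier]) simp
    have "ip D F (cyc_sec (n, s, m)) = (\<integral>x. indicator (cyl n s) x * ip (fibre nu x) (f x) (u m x) \<partial>\<mu>)"
      unfolding cyc_sec_def prod.case mulD_cls[OF u_L2] f(2) D_ip[OF f(1) L]
    proof (rule Bochner_Integration.integral_cong)
      fix x
      show "ip (fibre nu x) (f x) (\<lambda>j. indicator (cyl n s) x * u m x j) =
          indicator (cyl n s) x * ip (fibre nu x) (f x) (u m x)"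
        using model.ip_smul_right[OF u_in L2_fibre[OF f(1)], where a = "indicator (cyl n s) x"]
        by (simp add: indicator_def)
    qed simp
    then show "(\<integral>x. indicator (cyl n s) x * ip (fibre nu x) (f x) (u m x) \<partial>\<mu>) =
        (\<integral>x. indicator (cyl n s) x * 0 \<partial>\<mu>)" using z by simp
  qed simp
  then have "AE x in \<mu>. \<forall>m. ip (fibre nu x) (f x) (u m x) = 0" by (simp add: AE_all_countable)
  then have "AE x in \<mu>. f x = (\<lambda>n. 0)"
    using AE_supp
  proof eventually_elim
    case (elim x)
    have "f x j = 0" for j
    proof (cases "enat j < nu x")
      case True
      then obtain m where "dens m x > 0" "rank x m = j" using rank_onto[OF elim(2)] by blast
      then show ?thesis using elim(1)[rule_format, of m] ip_u[OF L2_fibre[OF f(1)], of x m] by auto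
    next
      case False
      then show ?thesis using L2_fibre[OF f(1), of x] by (auto simp: in_model)
    qed
    then show ?case by auto
  qed
  then show "F = vzero D" unfolding f(2) D_zero by (rule cls_cong)
qed simp

section \<open>Transport of the operators to the direct integral\<close>

definition Phi :: "'h \<Rightarrow> bfield set" where
  "Phi = (SOME U. unitary_map H D U \<and> (\<forall>i. U (cyc_vec i) = cyc_sec i))"

lemma Phi: "unitary_map H D Phi \<and> (\<forall>i. Phi (cyc_vec i) = cyc_sec i)"
  unfolding Phi_def
  by (rule someI_ex[OF unitary_extension[OF complex_hilbert_space_axioms D_hilbert total_cyc_vec total_cyc_sec gram]])

lemma Phi_cyc_vec: "Phi (cyc_vec i) = cyc_sec i" using Phi by blast

lemma Phi_in [simp]: "v \<in> pts H \<Longrightarrow> Phi v \<in> pts D"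
  using Phi by (auto simp: unitary_map_def clinear_map_def)

lemma Phi_ip: "v \<in> pts H \<Longrightarrow> v' \<in> pts H \<Longrightarrow> ip D (Phi v) (Phi v') = ip H v v'"
  using Phi by (auto simp: unitary_map_def)

lemma Phi_add: "v \<in> pts H \<Longrightarrow> v' \<in> pts H \<Longrightarrow> Phi (vadd H v v') = vadd D (Phi v) (Phi v')"
  using Phi by (auto simp: unitary_map_def clinear_map_def)

lemma Phi_smul: "v \<in> pts H \<Longrightarrow> Phi (smul H a v) = smul D a (Phi v)"
  using Phi by (auto simp: unitary_map_def clinear_map_def)

lemma Phi_bij: "bij_betw Phi (pts H) (pts D)"
  using Phi by (auto simp: unitary_map_def)

lemma Phi_zero: "Phi (vzero H) = vzero D"
proof -
  interpret D: complex_inner_space D by (rule D_inner)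
  show ?thesis using Phi_smul[of "vzero H" 0] by (simp add: D.smul_0)
qed

text \<open>Both operators are self-adjoint, so pairing with the total family \<open>cyc_sec\<close>
  moves them onto the generators, where they agree by \<open>gen\<close>.\<close>

lemma Phi_intertwine:
  assumes B: "\<And>v. v \<in> pts H \<Longrightarrow> B v \<in> pts H"
    and selfadj: "\<And>v v'. v \<in> pts H \<Longrightarrow> v' \<in> pts H \<Longrightarrow> ip H (B v) v' = ip H v (B v')"
    and phi: "multiplier \<phi>" "\<And>x. cnj (\<phi> x) = \<phi> x"
    and gen: "\<And>i. Phi (B (cyc_vec i)) = mulD \<phi> (cyc_sec i)"
    and v: "v \<in> pts H"
  shows "Phi (B v) = mulD \<phi> (Phi v)"
proof -
  interpret D: complex_inner_space D by (rule D_inner)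
  show ?thesis
  proof (rule D.total_family_eqI[OF total_cyc_sec])
    show "Phi (B v) \<in> pts D" "mulD \<phi> (Phi v) \<in> pts D" using v B phi by (auto intro: mulD_in)
    fix i
    have "ip D (Phi (B v)) (cyc_sec i) = ip H (B v) (cyc_vec i)"
      unfolding Phi_cyc_vec[symmetric] using v B by (intro Phi_ip) auto
    also have "\<dots> = ip H v (B (cyc_vec i))" using v by (intro selfadj) auto
    also have "\<dots> = ip D (Phi v) (Phi (B (cyc_vec i)))" using v B by (intro Phi_ip[symmetric]) auto
    also have "\<dots> = ip D (mulD \<phi> (Phi v)) (cyc_sec i)"
      unfolding gen using v phi by (intro mulD_selfadjoint[symmetric]) auto
    finally show "ip D (Phi (B v)) (cyc_sec i) = ip D (mulD \<phi> (Phi v)) (cyc_sec i)" .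
  qed
qed

lemma Phi_E: "v \<in> pts H \<Longrightarrow> Phi (E n s v) = mulD (indicator (cyl n s)) (Phi v)"
proof (rule Phi_intertwine)
  fix i :: "nat \<times> bseq \<times> nat"
  obtain n' t m where i: "i = (n', t, m)" by (cases i) auto
  show "Phi (E n s (cyc_vec i)) = mulD (indicator (cyl n s)) (cyc_sec i)"
    unfolding i E_cyc_vec mul_cyc_sec by (simp add: Phi_cyc_vec Phi_zero)
qed (auto simp: E_selfadjoint ind_multiplier split: split_indicator)

definition chi :: "nat \<Rightarrow> bseq \<Rightarrow> complex" where "chi k x = sg (x k)"

lemma chi_real: "cnj (chi k x) = chi k x" by (simp add: chi_def)

lemma chi_multiplier: "multiplier (chi k)"
proof -
  have [measurable]: "Measurable.pred \<mu> (\<lambda>x. x k)"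
    using coord_measurable measurable_cong_sets[OF sets_mu refl] by blast
  show ?thesis unfolding multiplier_def chi_def sg_def by auto
qed

text \<open>On a cylinder that fixes coordinate \<open>k\<close> the operator \<open>A k\<close> is
  a scalar. A shorter cylinder is split into its two halves, by induction downwards from length
  \<open>Suc k\<close>.\<close>

lemma Phi_A_cyc_vec: "Phi (A k (cyc_vec (n, s, m))) = mulD (chi k) (cyc_sec (n, s, m))"
proof -
  interpret D: complex_inner_space D by (rule D_inner)
  have large: "Phi (A k (cyc_vec (n, s, m))) = mulD (chi k) (cyc_sec (n, s, m))" if "k < n" for n s
  proof -
    have "A k (cyc_vec (n, s, m)) = smul H (sg (s k)) (cyc_vec (n, s, m))"
      using that by (simp add: cyc_vec_def A_E_less)
    then have "Phi (A k (cyc_vec (n, s, m))) = smul D (sg (s k)) (cyc_sec (n, s, m))"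
      by (simp add: Phi_smul Phi_cyc_vec)
    also have "\<dots> = mulD (\<lambda>x. sg (s k) * indicator (cyl n s) x) (cls (u m))"
      by (simp add: cyc_sec_def mulD_smul ind_multiplier)
    also have "(\<lambda>x. sg (s k) * indicator (cyl n s) x) = (\<lambda>x. chi k x * indicator (cyl n s) x)"
    proof
      fix x
      show "sg (s k) * indicator (cyl n s) x = chi k x * indicator (cyl n s) x"
        using that by (cases "x \<in> cyl n s") (auto simp: chi_def cyl_def)
    qed
    also have "mulD (\<lambda>x. chi k x * indicator (cyl n s) x) (cls (u m)) = mulD (chi k) (cyc_sec (n, s, m))"
      by (simp add: cyc_sec_def mulD_mulD ind_multiplier)
    finally show ?thesis .
  qed
  have "\<forall>s. Phi (A k (cyc_vec (n, s, m))) = mulD (chi k) (cyc_sec (n, s, m))" if "n \<le> Suc k" for n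
    using that
  proof (induction n rule: inc_induct)
    case base
    then show ?case using large by simp
  next
    case (step n)
    show ?case
    proof
      fix s
      let ?a = "(Suc n, s(n := False), m)" and ?b = "(Suc n, s(n := True), m)"
      have x: "cyc_vec (n, s, m) = vadd H (cyc_vec ?a) (cyc_vec ?b)"
        unfolding cyc_vec_def prod.case by (rule E_split) simp
      then have y: "cyc_sec (n, s, m) = vadd D (cyc_sec ?a) (cyc_sec ?b)"
        unfolding Phi_cyc_vec[symmetric] by (simp add: Phi_add)
      show "Phi (A k (cyc_vec (n, s, m))) = mulD (chi k) (cyc_sec (n, s, m))"
        unfolding x y
        by (simp only: A_add Phi_add mulD_add chi_multiplier step.IH[rule_format] cyc_vec_in A_in Phi_in cyc_sec_in)
    qed
  qed
  then show ?thesis using large[of n s] by (cases "k < n") auto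
qed

lemma Phi_A: "v \<in> pts H \<Longrightarrow> Phi (A k v) = mulD (chi k) (Phi v)"
proof (rule Phi_intertwine)
  fix i :: "nat \<times> bseq \<times> nat"
  show "Phi (A k (cyc_vec i)) = mulD (chi k) (cyc_sec i)" by (cases i) (simp add: Phi_A_cyc_vec)
qed (auto simp: A_selfadjoint chi_multiplier chi_real)

lemma par_multiplier: "multiplier (\<lambda>x. par x k)"
  using par_measurable measurable_cong_sets[OF sets_mu refl] by (auto simp: multiplier_def cmod_par)

lemma Phi_Par: "v \<in> pts H \<Longrightarrow> Phi (Par k v) = mulD (\<lambda>x. par x k) (Phi v)"
proof (induction k)
  case 0
  then show ?case by (simp add: mulD_one)
next
  case (Suc k)
  have "(\<lambda>x. chi k x * par x k) = (\<lambda>x. par x (Suc k))"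
    by (auto simp: chi_def sg_def par_Suc)
  then show ?case using Suc by (simp add: Phi_A mulD_mulD par_multiplier)
qed

definition Psi :: "bfield set \<Rightarrow> 'h" where "Psi = inv_into (pts H) Phi"

lemma Psi_in [simp]: "F \<in> pts D \<Longrightarrow> Psi F \<in> pts H"
  using Phi_bij unfolding Psi_def bij_betw_def by (metis inv_into_into)

lemma Phi_Psi [simp]: "F \<in> pts D \<Longrightarrow> Phi (Psi F) = F"
  using Phi_bij unfolding Psi_def by (rule bij_betw_inv_into_right)

lemma Psi_Phi [simp]: "v \<in> pts H \<Longrightarrow> Psi (Phi v) = v"
  using Phi_bij unfolding Psi_def by (rule bij_betw_inv_into_left)

definition UD :: "nat \<Rightarrow> bfield set \<Rightarrow> bfield set" where "UD k F = Phi (U k (Psi F))"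

lemma Psi_add: "F \<in> pts D \<Longrightarrow> G \<in> pts D \<Longrightarrow> Psi (vadd D F G) = vadd H (Psi F) (Psi G)"
  using Psi_Phi[of "vadd H (Psi F) (Psi G)"] by (simp add: Phi_add)

lemma Psi_smul: "F \<in> pts D \<Longrightarrow> Psi (smul D a F) = smul H a (Psi F)"
  using Psi_Phi[of "smul H a (Psi F)"] by (simp add: Phi_smul)

lemma shift_system_UD: "shift_system \<mu> nu UD"
proof
  have inv: "UD k (UD k F) = F" if "F \<in> pts D" for k F using that by (simp add: UD_def U_sq)
  show "unitary_map D D (UD k)" for k
    unfolding unitary_map_def
  proof (intro conjI ballI)
    show "clinear_map D D (UD k)"
      by (auto simp: clinear_map_def UD_def Psi_add Psi_smul op_add[OF U_op] op_smul[OF U_op] Phi_add Phi_smul)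
    show "bij_betw (UD k) (pts D) (pts D)"
      by (rule bij_betw_byWitness[of _ "UD k"]) (auto simp: inv, auto simp: UD_def)
    fix F G assume "F \<in> pts D" "G \<in> pts D"
    then show "ip D (UD k F) (UD k G) = ip D F G"
      using Phi_ip[of "Psi F" "Psi G"] by (simp add: UD_def Phi_ip U_ip)
  qed
  show "UD k (UD k F) = F" if "F \<in> pts D" for F k using inv that by simp
  show "UD k (UD l F) = UD l (UD k F)" if "F \<in> pts D" for F k l
    using that U_comm[of "Psi F" k l] by (simp add: UD_def)
  show "UD k (mulD (indicator (cyl n s)) F) = mulD (indicator (cyl n (s \<oplus> delta k))) (UD k F)"
    if "F \<in> pts D" for F k n s
  proof -
    have "UD k (mulD (indicator (cyl n s)) F) = UD k (Phi (E n s (Psi F)))" using that by (simp add: Phi_E)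
    also have "\<dots> = Phi (E n (s \<oplus> delta k) (U k (Psi F)))" using that by (simp add: UD_def U_E)
    also have "\<dots> = mulD (indicator (cyl n (s \<oplus> delta k))) (UD k F)"
      unfolding UD_def using that by (intro Phi_E) simp
    finally show ?thesis .
  qed
qed (use sets_mu fm nu_nonzero nu_measurable in auto)

theorem equivalence:
  "\<exists>\<mu> \<nu> c. gw_triple \<mu> \<nu> c \<and> unitarily_equivalent H S (direct_integral \<mu> \<nu>)
     (interleave (gw_J \<mu> \<nu> c) (gw_J' \<mu> \<nu> c))"
proof -
  interpret sh: shift_system \<mu> nu UD by (rule shift_system_UD)
  interpret gw: gw_triple \<mu> nu sh.cT by (rule sh.gw_triple_cT)
  have "Phi (S n v) = interleave (gw_J \<mu> nu sh.cT) (gw_J' \<mu> nu sh.cT) n (Phi v)" if v: "v \<in> pts H" for n v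
  proof -
    define k where "k = n div 2"
    have "interleave (gw_J \<mu> nu sh.cT) (gw_J' \<mu> nu sh.cT) n (Phi v) = mulD (gw.sgn_fun n) (UD k (Phi v))"
      unfolding gw.interleave_gw k_def using v by (intro sh.gw_op_cT) simp
    also have "UD k (Phi v) = Phi (U k v)" using v by (simp add: UD_def)
    also have "mulD (gw.sgn_fun n) (Phi (U k v)) = Phi (S n v)"
    proof (cases "even n")
      case True
      then have n: "n = 2 * k" by (simp add: k_def)
      have "Phi (S n v) = smul D (- \<i>) (mulD (\<lambda>x. par x k) (Phi (U k v)))"
        unfolding n S_even[OF v] using v by (simp add: Phi_smul Phi_Par)
      also have "\<dots> = mulD (\<lambda>x. - \<i> * par x k) (Phi (U k v))"
        using v by (intro mulD_smul par_multiplier) simp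
      also have "(\<lambda>x. - \<i> * par x k) = gw.sgn_fun n"
        using True by (simp add: gw.sgn_fun_def fun_eq_iff k_def)
      finally show ?thesis by simp
    next
      case False
      then have n: "n = Suc (2 * k)" by (simp add: k_def)
      have "Phi (S n v) = mulD (\<lambda>x. par x (Suc k)) (Phi (U k v))"
        unfolding n S_odd[OF v] using v by (intro Phi_Par) simp
      also have "(\<lambda>x. par x (Suc k)) = gw.sgn_fun n"
        using False by (simp add: gw.sgn_fun_def fun_eq_iff k_def)
      finally show ?thesis by simp
    qed
    finally show ?thesis by simp
  qed
  then show ?thesis
    using Phi gw.gw_triple_axioms unfolding unitarily_equivalent_def by blast
qed

end

theorem theorem2p4:
  "(\<forall>\<mu> \<nu> c. gw_triple \<mu> \<nu> c \<longrightarrow>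
      complex_spinor_structure (direct_integral \<mu> \<nu>)
        (interleave (gw_J \<mu> \<nu> c) (gw_J' \<mu> \<nu> c))) \<and>
   (\<forall>(H :: 'h cspace) S.
      complex_hilbert_space H \<and> separable_cspace H \<and> complex_spinor_structure H S \<longrightarrow>
      (\<exists>\<mu> \<nu> c. gw_triple \<mu> \<nu> c \<and>
         unitarily_equivalent H S (direct_integral \<mu> \<nu>)
           (interleave (gw_J \<mu> \<nu> c) (gw_J' \<mu> \<nu> c))))"
proof (intro conjI allI impI)
  fix \<mu> \<nu> c assume "gw_triple \<mu> \<nu> c"
  then show "complex_spinor_structure (direct_integral \<mu> \<nu>) (interleave (gw_J \<mu> \<nu> c) (gw_J' \<mu> \<nu> c))"
    by (rule gw_triple.gw_spinor_structure)
next
  fix H :: "'h cspace" and S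
  assume "complex_hilbert_space H \<and> separable_cspace H \<and> complex_spinor_structure H S"
  then have "spinor_space H S" by (intro spinor_space.intro spinor_space_axioms.intro) auto
  then obtain w M \<mu> where "spinor_model H S w M \<mu>" using spinor_space.spinor_model_exists by blast
  then show "\<exists>\<mu> \<nu> c. gw_triple \<mu> \<nu> c \<and> unitarily_equivalent H S (direct_integral \<mu> \<nu>)
      (interleave (gw_J \<mu> \<nu> c) (gw_J' \<mu> \<nu> c))" by (rule spinor_model.equivalence)
qed

end
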